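(* Let $k\ge 1$ be an integer, let $1<\alpha<2$, and let $m$ be a real number with $0\le m<k$, $m\notin\mathbb N$. Suppose that each of the functions $\tau=\varphi$ and $\tau=\psi$ satisfies: $$\tau\in C^{2k}[0,1],\qquad \tau^{(s)}(0)=\tau^{(s)}(1)=0,\quad s=0,1,\dots,k-1,$$ $$y^m\tau^{(2k)}(y)\in C^{2k}[0,1],\qquad \big(y^m\tau^{(2k)}(y)\big)^{(s)}\Big|_{y=0}=\big(y^m\tau^{(2k)}(y)\big)^{(s)}\Big|_{y=1}=0,\quad s=0,1,\dots,k-1.$$ Then there exists a solution $u$ of Problem A with data $\varphi,\psi$.
   Context: $\mathbb N=\{1,2,\dots\}$. Let $D_x=\{x:0<x<1\}$, $D_y=\{y:0<y<1\}$, $D=D_x\times D_y$. The Riemann–Liouville fractional derivative of order $\alpha\in(1,2)$ in $x$ is $$D_{0x}^{\alpha}u(x,y)=\frac{1}{\Gamma(2-\alpha)}\frac{d^2}{dx^2}\int_0^x\frac{u(\tau,y)\,d\tau}{(x-\tau)^{\alpha-1}}.$$ Problem A (with data $\varphi,\psi:[0,1]\to\mathbb R$): find a function $u(x,y)$ satisfying the equation $$(-1)^{k+1}D_{0x}^{\alpha}u(x,y)-y^m\frac{\partial^{2k}u(x,y)}{\partial y^{2k}}=0\quad\text{in } D,$$ the regularity conditions $$D_{0x}^\alpha u\in C(D_x\times\overline{D}_y),\qquad x^{2-\alpha}u(x,y)\in C^1(\overline D),\qquad \frac{\partial^{2k}u}{\partial y^{2k}}\in C(D_x\times\overline D_y),$$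 (where $x^{2-\alpha}u\in C^1(\overline D)$ means that it extends to such a function), the boundary conditions $$\frac{\partial^{s}u(x,0)}{\partial y^{s}}=\frac{\partial^{s}u(x,1)}{\partial y^{s}}=0,\qquad 0<x\le 1,\quad s=0,1,\dots,k-1,$$ and the initial conditions, for $y\in[0,1]$, $$\lim_{x\to0+}x^{2-\alpha}u(x,y)=\psi(y),\qquad \lim_{x\to0+}\frac{\partial}{\partial x}\big(x^{2-\alpha}u(x,y)\big)=\varphi(y).$$ *)

theory Defs
  imports "HOL-Analysis.Analysis"
begin

text \<open>Iterated derivative relative to \<open>S\<close>; for \<open>S = {0..1}\<close> it is one-sided at the end points.
  It is meaningful only under the matching differentiability assumption below.\<close>

definition nderiv_within :: "nat \<Rightarrow> (real \<Rightarrow> real) \<Rightarrow> real set \<Rightarrow> real \<Rightarrow> real" where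
  "nderiv_within n f S = ((\<lambda>g y. vector_derivative g (at y within S)) ^^ n) f"

definition times_differentiable_on :: "nat \<Rightarrow> (real \<Rightarrow> real) \<Rightarrow> real set \<Rightarrow> bool" where
  "times_differentiable_on n f S \<longleftrightarrow>
     (\<forall>j<n. \<forall>y\<in>S. nderiv_within j f S differentiable (at y within S))"

definition Ck_on :: "nat \<Rightarrow> (real \<Rightarrow> real) \<Rightarrow> real set \<Rightarrow> bool" where
  "Ck_on n f S \<longleftrightarrow> times_differentiable_on n f S \<and> continuous_on S (nderiv_within n f S)"

text \<open>\<open>C\<^sup>1\<close> on the closed unit square, with one-sided partial derivatives on its boundary.\<close>

definition C1_on_unit_square :: "(real \<Rightarrow> real \<Rightarrow> real) \<Rightarrow> bool" where
  "C1_on_unit_square v \<longleftrightarrow>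
     continuous_on ({0..1} \<times> {0..1}) (\<lambda>(x, y). v x y) \<and>
     (\<exists>vx vy.
        (\<forall>x\<in>{0..1}. \<forall>y\<in>{0..1}.
           ((\<lambda>t. v t y) has_real_derivative vx x y) (at x within {0..1}) \<and>
           (v x has_real_derivative vy x y) (at y within {0..1})) \<and>
        continuous_on ({0..1} \<times> {0..1}) (\<lambda>(x, y). vx x y) \<and>
        continuous_on ({0..1} \<times> {0..1}) (\<lambda>(x, y). vy x y))"

text \<open>The power \<open>y\<^sup>m\<close> for \<open>y, m \<ge> 0\<close>. In the library \<open>0 powr 0 = 0\<close>, whereas \<open>y\<^sup>0\<close> has to be
  the constant \<open>1\<close> on all of \<open>[0,1]\<close>.\<close>

definition rpow :: "real \<Rightarrow> real \<Rightarrow> real" where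
  "rpow y m = (if m = 0 then 1 else y powr m)"

text \<open>Riemann--Liouville derivative of order \<open>\<alpha> \<in> (1,2)\<close> with base point \<open>0\<close>. The value of \<open>f\<close> at
  \<open>0\<close> is irrelevant.\<close>

definition RL_kernel :: "real \<Rightarrow> (real \<Rightarrow> real) \<Rightarrow> real \<Rightarrow> real \<Rightarrow> real" where
  "RL_kernel \<alpha> f x t = f t / (x - t) powr (\<alpha> - 1)"

definition RL_integral :: "real \<Rightarrow> (real \<Rightarrow> real) \<Rightarrow> real \<Rightarrow> real" where
  "RL_integral \<alpha> f x = (LBINT t:{0<..<x}. RL_kernel \<alpha> f x t)"

definition RL_deriv :: "real \<Rightarrow> (real \<Rightarrow> real) \<Rightarrow> real \<Rightarrow> real" where
  "RL_deriv \<alpha> f x = 1 / Gamma (2 - \<alpha>) * (deriv ^^ 2) (RL_integral \<alpha> f) x"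

definition RL_differentiable_on :: "real \<Rightarrow> (real \<Rightarrow> real) \<Rightarrow> real set \<Rightarrow> bool" where
  "RL_differentiable_on \<alpha> f S \<longleftrightarrow>
     (\<forall>x\<in>S. set_integrable lborel {0<..<x} (RL_kernel \<alpha> f x) \<and>
            RL_integral \<alpha> f differentiable (at x) \<and>
            deriv (RL_integral \<alpha> f) differentiable (at x))"

text \<open>Only the values of \<open>u\<close> on \<open>(0,1] \<times> [0,1]\<close> matter. In the boundary conditions the derivatives
  are required to exist also on the edge \<open>x = 1\<close>, where the regularity conditions on
  \<open>(0,1) \<times> [0,1]\<close> do not provide them.\<close>

definition solves_problem_A ::
  "nat \<Rightarrow> real \<Rightarrow> real \<Rightarrow> (real \<Rightarrow> real) \<Rightarrow> (real \<Rightarrow> real) \<Rightarrow> (real \<Rightarrow> real \<Rightarrow> real) \<Rightarrow> bool" where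
  "solves_problem_A k \<alpha> m \<phi> \<psi> u \<longleftrightarrow>
     \<comment> \<open>equation\<close>
     (\<forall>x\<in>{0<..<1}. \<forall>y\<in>{0<..<1}.
        (-1) ^ (k + 1) * RL_deriv \<alpha> (\<lambda>t. u t y) x
          - rpow y m * nderiv_within (2 * k) (u x) {0..1} y = 0) \<and>
     \<comment> \<open>regularity\<close>
     (\<forall>y\<in>{0..1}. RL_differentiable_on \<alpha> (\<lambda>t. u t y) {0<..<1}) \<and>
     continuous_on ({0<..<1} \<times> {0..1}) (\<lambda>(x, y). RL_deriv \<alpha> (\<lambda>t. u t y) x) \<and>
     (\<exists>v. C1_on_unit_square v \<and>
        (\<forall>x\<in>{0<..1}. \<forall>y\<in>{0..1}. v x y = x powr (2 - \<alpha>) * u x y)) \<and>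
     (\<forall>x\<in>{0<..<1}. times_differentiable_on (2 * k) (u x) {0..1}) \<and>
     continuous_on ({0<..<1} \<times> {0..1}) (\<lambda>(x, y). nderiv_within (2 * k) (u x) {0..1} y) \<and>
     \<comment> \<open>boundary conditions\<close>
     (\<forall>x\<in>{0<..1}. times_differentiable_on (k - 1) (u x) {0..1} \<and>
        (\<forall>s\<in>{0..k - 1}. nderiv_within s (u x) {0..1} 0 = 0 \<and>
                        nderiv_within s (u x) {0..1} 1 = 0)) \<and>
     \<comment> \<open>initial conditions\<close>
     (\<forall>y\<in>{0..1}.
        ((\<lambda>x. x powr (2 - \<alpha>) * u x y) \<longlongrightarrow> \<psi> y) (at_right 0) \<and>
        ((\<lambda>x. deriv (\<lambda>t. t powr (2 - \<alpha>) * u t y) x) \<longlongrightarrow> \<phi> y) (at_right 0))"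

end

theory Submission
  imports Defs "HOL-Complex_Analysis.Complex_Analysis" "HOL-Real_Asymp.Real_Asymp"
begin

text \<open>The operator \<open>A = (-1)\<^sup>k y\<^sup>m d\<^sup>2\<^sup>k/dy\<^sup>2\<^sup>k\<close> with Dirichlet conditions is symmetric and
  positive for the weight \<open>y\<^sup>-\<^sup>m\<close>, the equation reads \<open>D\<^sup>\<alpha> u = - A u\<close>, and the hypotheses
  put \<open>\<phi>\<close> and \<open>\<psi>\<close> into the domain of \<open>A\<^sup>2\<close>. The solution is the sum of \<open>\<Gamma>(\<alpha>-1) x\<^sup>\<alpha>\<^sup>-\<^sup>2
  E\<^sub>\<alpha>\<^sub>,\<^sub>\<alpha>\<^sub>-\<^sub>1(- x\<^sup>\<alpha> A) \<psi>\<close> and \<open>\<Gamma>(\<alpha>) x\<^sup>\<alpha>\<^sup>-\<^sup>1 E\<^sub>\<alpha>\<^sub>,\<^sub>\<alpha>(- x\<^sup>\<alpha> A) \<phi>\<close> with Mittag-Leffler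
  functions \<open>E\<close>. Instead of expanding in eigenfunctions, these functions of \<open>A\<close> are defined
  by a continuous functional calculus for \<open>T = A\<^sup>-\<^sup>1 / c\<close>: since \<open>0 \<le> T \<le> 1\<close>, the operators
  obtained from the Bernstein basis polynomials are positive and sum to the identity, so
  that Bernstein sums converge to an operator \<open>q(T)\<close> of norm at most \<open>sup \<bar>q\<bar>\<close>. Of the two
  factors \<open>A\<^sup>-\<^sup>1\<close> gained from the data, one compensates the derivatives and the other one
  turns the energy norm into the maximum norm, which is where \<open>m < k\<close> enters.

  The calculus needs \<open>E\<^sub>\<alpha>\<^sub>,\<^sub>\<beta>(-z) \<rightarrow> 0\<close> as \<open>z \<rightarrow> \<infinity>\<close>. The Laplace transform of \<open>x\<^sup>\<alpha>\<^sup>-\<^sup>1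
  E\<^sub>\<alpha>\<^sub>,\<^sub>\<alpha>(- x\<^sup>\<alpha>)\<close> is \<open>F(p) = 1 / (p\<^sup>\<alpha> + 1)\<close>, which is holomorphic in the right half-plane
  and dominated by \<open>(1 + \<bar>p\<bar>)\<^sup>-\<^sup>\<alpha>\<close>. Cauchy's formula on circles about \<open>q > 0\<close> of radius
  tending to \<open>q\<close> bounds the derivative of order \<open>n\<close> of \<open>F\<close> at \<open>q\<close> by \<open>C n! / q\<^sup>n\<^sup>+\<^sup>1\<close>, and
  the Post--Widder inversion formula turns this into a bound for the original function.\<close>

section \<open>A Post--Widder estimate for Laplace transforms\<close>

text \<open>The spectral variable of T is t in [0,1] with \<lambda> = 1/(ct), so large \<lambda> is
  squeezed into the point t = 0, and continuity there is the difficulty for the scalar functions.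
  The Laplace transform of x^(\<alpha>-2) times the Mittag-Leffler function of second index \<alpha>
  - 1 decays only like |p|^(1-\<alpha>), too slowly for an integral estimate. Therefore the index is
  lowered without lowering the power of x: the recurrence of Gamma turns x^(\<alpha>-1) times the
  function of index \<alpha> - j, j <= 2, into a series with coefficients quadratic in the summation
  index, and its transform is rational in p^\<alpha> and still O(|p|^(-\<alpha>)). The energy form
  is degenerate, because bounded continuous functions on the line are seen only on [0,1], and
  completeness is not at hand. So q(T) f is never formed: Bernstein sums are merely Cauchy, and
  limits are taken after an operator bounded from the energy norm to the maximum norm
  (\<open>Sol\<close>, \<open>Sol'\<close> or \<open>K\<close>). The constant c is the integral of
  s^(2k-2-m) over [0,1]; it comes from Cauchy-Schwarz for s^(k-1) against the weight s^m.\<close>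

lemma powr_le_Gamma_exp:
  fixes s t :: real
  assumes s: "s \<ge> 1" and t: "t \<ge> 0"
  shows "t powr (s - 1) / Gamma s \<le> exp (t + 1)"
proof -
  have G: "Gamma s > 0" using s by (intro Gamma_real_pos) auto
  \<comment> \<open>On \<open>{t..t+1}\<close> the integrand of Gamma is at least its numerator at
    the left end over its denominator at the right end.\<close>
  have "((\<lambda>u. t powr (s - 1) / exp (t + 1)) has_integral (t + 1 - t) *\<^sub>R (t powr (s - 1) / exp (t +
      1))) (cbox t (t+1))"
    using has_integral_const_real[of "t powr (s - 1) / exp (t + 1)" t "t + 1"] by simp
  hence I1: "((\<lambda>u. t powr (s - 1) / exp (t + 1)) has_integral (t powr (s - 1) / exp (t + 1)))
      {t..t+1}"
    by simp
  have I2: "((\<lambda>u. u powr (s - 1) / exp u) has_integral Gamma s) {0..}"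
    using s by (intro Gamma_integral_real) auto
  have ion: "(\<lambda>u. u powr (s - 1) / exp u) integrable_on {t..t+1}"
    using I2 t by (intro integrable_on_subinterval[of _ "{0..}"]) auto
  have "t powr (s - 1) / exp (t + 1) \<le> integral {t..t+1} (\<lambda>u. u powr (s - 1) / exp u)"
    using I1 integrable_integral[OF ion]
    by (rule has_integral_le) (use s t in \<open>auto intro!: frac_le powr_mono2\<close>)
  also have "\<dots> \<le> Gamma s"
    using integrable_integral[OF ion] I2
    by (intro has_integral_subset_le[of "{t..t+1}" "{0..}"]) (use t in auto)
  finally show ?thesis using G by (simp add: field_simps)
qed

text \<open>The previous bound at \<open>2 * t\<close> gains \<open>2 powr (1 - s)\<close>, the
  geometric factor that makes the later series converge. The price is the growth
  \<open>exp (2 * t)\<close>, the origin of the conditions \<open>q > 2\<close> and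
  \<open>Re z > 2\<close> below.\<close>

lemma powr_over_Gamma_le:
  fixes s t :: real
  assumes s: "s \<ge> 1" and t: "t \<ge> 0"
  shows "t powr (s - 1) / Gamma s \<le> 2 powr (1 - s) * exp (2 * t + 1)"
proof -
  have "t powr (s - 1) / Gamma s = 2 powr (1 - s) * ((2 * t) powr (s - 1) / Gamma s)"
    using t by (simp add: powr_mult flip: powr_add)
  also have "\<dots> \<le> 2 powr (1 - s) * exp (2 * t + 1)"
    using powr_le_Gamma_exp[OF s, of "2 * t"] t by (intro mult_left_mono) auto
  finally show ?thesis .
qed

lemma Gamma_integral_scaled:
  fixes s q :: real
  assumes s: "s > 0" and q: "q > 0"
  shows "((\<lambda>t. t powr (s - 1) * exp (- q * t)) has_integral Gamma s / q powr s) {0..}"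
proof -
  define f where "f = (\<lambda>t::real. if t \<in> {0..} then t powr (s - 1) / exp t else 0)"
  have fint: "(f has_integral Gamma s) UNIV"
    using Gamma_integral_real[OF s] unfolding f_def by (subst has_integral_restrict_UNIV) auto
  have [measurable]: "f \<in> borel_measurable borel" unfolding f_def by measurable
  have "has_bochner_integral lborel f (Gamma s)"
  proof -
    have "(\<integral>\<^sup>+x. ennreal (f x) \<partial>lborel) = ennreal (Gamma s)"
      using nn_integral_has_integral_lborel[OF _ _ fint] by (auto simp: f_def)
    thus ?thesis using s by (intro has_bochner_integral_nn_integral) (auto simp: f_def intro!:
        Gamma_real_nonneg)
  qed
  hence "has_bochner_integral lborel (\<lambda>x. f (0 + q * x)) (Gamma s /\<^sub>R \<bar>q\<bar>)"
    using q lborel_has_bochner_integral_real_affine_iff[of q f "Gamma s" 0] by simp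
  hence "((\<lambda>x. f (q * x)) has_integral (Gamma s / q)) UNIV"
    using q has_integral_integral_lborel[of "\<lambda>x. f (q * x)"]
    by (simp add: has_bochner_integral_iff divide_inverse mult.commute)
  hence "((\<lambda>x. q powr (1 - s) * f (q * x)) has_integral (q powr (1 - s) * (Gamma s / q))) UNIV"
    by (rule has_integral_mult_right)
  moreover have "q powr (1 - s) * (Gamma s / q) = Gamma s / q powr s"
    using q by (simp add: powr_diff field_simps)
  moreover have "q powr (1 - s) * f (q * x) = (if x \<in> {0..} then x powr (s - 1) * exp (- q * x) else
      0)" for x
  proof (cases "x \<ge> 0")
    case True
    hence "q * x \<ge> 0" using q by simp
    have "q powr (1 - s) * q powr (s - 1) = 1" using q by (simp flip: powr_add)
    thus ?thesis using True q \<open>q * x \<ge> 0\<close> by (simp add: f_def powr_mult exp_minus field_simps)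
  next
    case False
    hence "q * x < 0" using q by (simp add: mult_pos_neg)
    thus ?thesis using False by (simp add: f_def)
  qed
  ultimately show ?thesis by (simp only: has_integral_restrict_UNIV)
qed

lemma power_exp_integral:
  fixes q :: real
  assumes q: "q > 0"
  shows "((\<lambda>t. t ^ n * exp (- q * t)) has_integral fact n / q ^ Suc n) {0..}"
proof -
  have "((\<lambda>t. t powr (real (Suc n) - 1) * exp (- q * t)) has_integral Gamma (real (Suc n)) / q powr
      real (Suc n)) {0..}"
    by (rule Gamma_integral_scaled) (use q in auto)
  hence *: "((\<lambda>t. t powr (real n) * exp (- q * t)) has_integral fact n / q ^ Suc n) {0..}"
    using q Gamma_fact[of n, where 'a=real] by (simp add: powr_realpow add.commute powr_add)
  show ?thesis
    by (rule has_integral_spike[OF _ _ *, of "{0}"]) (auto simp: powr_realpow)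
qed

text \<open>For \<open>q = n / x\<close> the density proportional to
  \<open>t ^ n * exp (- q * t)\<close> concentrates at \<open>x\<close> as \<open>n\<close> grows.
  Its mass before normalisation is \<open>fact n / q ^ Suc n\<close>, so \<open>bnd\<close> bounds
  averages of \<open>h\<close> by \<open>B\<close>, and continuity carries the bound to
  \<open>h x\<close>.\<close>

lemma post_widder_bound:
  fixes h :: "real \<Rightarrow> real"
  assumes x: "x > 0" and cont: "isCont h x"
    and growth: "\<And>t. t \<ge> 0 \<Longrightarrow> \<bar>h t\<bar> \<le> M * exp (2 * t)"
    and int: "\<And>n q. q > 2 \<Longrightarrow> (\<lambda>t. t ^ n * exp (- q * t) * h t) integrable_on {0..}"
    and bnd: "\<And>n q. q > 2 \<Longrightarrow> \<bar>integral {0..} (\<lambda>t. t ^ n * exp (- q * t) * h t)\<bar> \<le> B * fact n / q ^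
        Suc n"
  shows "\<bar>h x\<bar> \<le> B"
proof (rule field_le_epsilon)
  fix \<epsilon> :: real assume \<epsilon>: "\<epsilon> > 0"
  have M: "M \<ge> 0" using growth[of 0] by simp
  obtain \<delta> where \<delta>: "\<delta> > 0" "\<And>t. \<bar>t - x\<bar> < \<delta> \<Longrightarrow> \<bar>h t - h x\<bar> < \<epsilon> / 2"
    using cont \<epsilon> unfolding continuous_at_eps_delta dist_real_def
    by (metis half_gt_zero)
  define C where "C = (M + \<bar>h x\<bar>) / \<delta>\<^sup>2"
  have C: "C \<ge> 0" using M by (simp add: C_def)
  \<comment> \<open>Chebyshev's device: near \<open>x\<close> continuity gives
    \<open>\<epsilon> / 2\<close>; elsewhere \<open>(t - x)\<^sup>2 / \<delta>\<^sup>2\<close> is at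
    least 1 and pays for the growth of \<open>h\<close>.\<close>
  have dev: "\<bar>h x - h t\<bar> \<le> \<epsilon> / 2 + C * ((t - x)\<^sup>2 * exp (2 * t))" if t: "t \<ge> 0" for t
  proof (cases "\<bar>t - x\<bar> < \<delta>")
    case True
    thus ?thesis using \<delta>(2)[OF True] C by (smt (verit) exp_ge_zero mult_nonneg_nonneg
        zero_le_power2)
  next
    case False
    hence "\<delta>\<^sup>2 \<le> (t - x)\<^sup>2" using \<delta> by (metis abs_le_square_iff abs_of_pos linorder_not_less)
    hence "1 \<le> (t - x)\<^sup>2 / \<delta>\<^sup>2" using \<delta> by simp
    hence "(M + \<bar>h x\<bar>) * exp (2 * t) * 1 \<le> (M + \<bar>h x\<bar>) * exp (2 * t) * ((t - x)\<^sup>2 / \<delta>\<^sup>2)"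
      using M by (intro mult_left_mono) auto
    moreover have "\<bar>h x\<bar> \<le> \<bar>h x\<bar> * exp (2 * t)"
      using t by (simp add: mult_le_cancel_left1)
    moreover have "(M + \<bar>h x\<bar>) * exp (2 * t) * ((t - x)\<^sup>2 / \<delta>\<^sup>2) = C * ((t - x)\<^sup>2 * exp (2 * t))"
      by (simp add: C_def)
    ultimately show ?thesis using growth[OF t] \<epsilon>
      by (simp add: ring_distribs)
  qed
  \<comment> \<open>The second moment about \<open>x\<close>, with the extra weight
    \<open>exp (2 * t)\<close>, of the normalised density; the extra weight only shifts
    \<open>q\<close> to \<open>q - 2\<close>.\<close>
  define e where "e = (\<lambda>n. let q = real n / x in
     q ^ Suc n / fact n * (fact (n+2) / (q-2) ^ Suc (n+2) - 2 * x * (fact (n+1) / (q-2) ^ Suc (n+1))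
         + x\<^sup>2 * (fact n / (q-2) ^ Suc n)))"
  have main: "\<bar>h x\<bar> \<le> B + \<epsilon> / 2 + C * e n" if n: "real n / x > 2" for n
  proof -
    define q where "q = real n / x"
    have q: "q > 2" using n by (simp add: q_def)
    define g where "g = (\<lambda>t. t ^ n * exp (- q * t))"
    have g0: "g t \<ge> 0" if "t \<ge> 0" for t using that by (simp add: g_def)
    define I where "I = fact n / q ^ Suc n"
    have I: "(g has_integral I) {0..}" unfolding g_def I_def using q by (intro power_exp_integral)
        auto
    have I0: "I > 0" using q by (simp add: I_def)
    define E where "E = fact (n+2) / (q-2) ^ Suc (n+2) - 2 * x * (fact (n+1) / (q-2) ^ Suc (n+1)) +
        x\<^sup>2 * (fact n / (q-2) ^ Suc n)"
    have "((\<lambda>t. t ^ (n+2) * exp (- (q-2) * t) - 2 * x * (t ^ (n+1) * exp (- (q-2) * t)) + x\<^sup>2 * (t ^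
        n * exp (- (q-2) * t))) has_integral E) {0..}"
      unfolding E_def using q
      by (intro has_integral_add has_integral_diff has_integral_mult_right power_exp_integral) auto
    hence E: "((\<lambda>t. g t * ((t - x)\<^sup>2 * exp (2 * t))) has_integral E) {0..}"
    proof (rule has_integral_eq[rotated])
      fix t :: real
      have "exp (- (q - 2) * t) = exp (- q * t) * exp (2 * t)"
        by (simp add: algebra_simps flip: exp_add)
      thus "t ^ (n + 2) * exp (- (q - 2) * t) - 2 * x * (t ^ (n + 1) * exp (- (q - 2) * t)) +
          x\<^sup>2 * (t ^ n * exp (- (q - 2) * t)) = g t * ((t - x)\<^sup>2 * exp (2 * t))"
        unfolding g_def by (simp only:) (simp add: power2_eq_square algebra_simps)
    qed
    have Q: "((\<lambda>t. g t * (\<epsilon> / 2) + C * (g t * ((t - x)\<^sup>2 * exp (2 * t)))) has_integral I * (\<epsilon> / 2) +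
        C * E) {0..}"
      by (intro has_integral_add has_integral_mult_right has_integral_mult_left I E)
    have H: "(\<lambda>t. g t * h t) integrable_on {0..}" unfolding g_def by (rule int[OF q])
    have D: "((\<lambda>t. g t * h x - g t * h t) has_integral I * h x - integral {0..} (\<lambda>t. g t * h t))
        {0..}"
      by (intro has_integral_diff has_integral_mult_left I integrable_integral H)
    have "norm (integral {0..} (\<lambda>t. g t * h x - g t * h t)) \<le> integral {0..} (\<lambda>t. g t * (\<epsilon> / 2) + C
        * (g t * ((t - x)\<^sup>2 * exp (2 * t))))"
    proof (rule integral_norm_bound_integral)
      show "(\<lambda>t. g t * h x - g t * h t) integrable_on {0..}" using D by blast
      show "(\<lambda>t. g t * (\<epsilon> / 2) + C * (g t * ((t - x)\<^sup>2 * exp (2 * t)))) integrable_on {0..}" using Q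
          by blast
      fix t :: real assume t: "t \<in> {0..}"
      have "norm (g t * h x - g t * h t) = g t * \<bar>h x - h t\<bar>"
        using g0[of t] t by (simp add: abs_mult flip: right_diff_distrib)
      also have "\<dots> \<le> g t * (\<epsilon> / 2 + C * ((t - x)\<^sup>2 * exp (2 * t)))"
        using t g0[of t] by (intro mult_left_mono dev) auto
      finally show "norm (g t * h x - g t * h t) \<le> g t * (\<epsilon> / 2) + C * (g t * ((t - x)\<^sup>2 * exp (2 *
          t)))"
        by (simp add: algebra_simps)
    qed
    hence "\<bar>I * h x - integral {0..} (\<lambda>t. g t * h t)\<bar> \<le> I * (\<epsilon> / 2) + C * E"
      using D Q by (simp add: integral_unique)
    moreover have "\<bar>integral {0..} (\<lambda>t. g t * h t)\<bar> \<le> B * I"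
      unfolding g_def I_def using bnd[OF q] by simp
    ultimately have "\<bar>I * h x\<bar> \<le> B * I + I * (\<epsilon> / 2) + C * E" by linarith
    hence "I * \<bar>h x\<bar> \<le> I * (B + \<epsilon> / 2 + C * (E / I))"
      using I0 by (simp add: abs_mult algebra_simps)
    hence "\<bar>h x\<bar> \<le> B + \<epsilon> / 2 + C * (E / I)" using I0 by simp
    also have "E / I = q ^ Suc n / fact n * E" by (simp add: I_def)
    also have "\<dots> = e n" unfolding e_def Let_def E_def q_def ..
    finally show ?thesis .
  qed
  \<comment> \<open>In this form the first factor tends to \<open>exp (2 * x)\<close>, and the
    bracket, the second moment about \<open>x\<close> of the shifted density, tends to 0.\<close>
  have e_alt: "e n = (real n / (real n - 2 * x)) ^ Suc n * ((real n + 1) * (real n + 2) * x\<^sup>2 /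
      (real n - 2 * x)\<^sup>2 - 2 * x\<^sup>2 * (real n + 1) / (real n - 2 * x) + x\<^sup>2)"
    if n: "real n > 2 * x" for n
  proof -
    define r where "r = real n - 2 * x"
    have r: "r > 0" using n by (simp add: r_def)
    have q: "real n / x - 2 = r / x" using x by (simp add: r_def field_simps)
    have f: "fact (n + 2) = (real n + 1) * (real n + 2) * fact n" "fact (n + 1) = (real n + 1) *
        fact n"
      by (simp_all add: algebra_simps)
    show ?thesis unfolding e_def Let_def q f r_def[symmetric] using r x
      by (simp add: power_divide field_simps power2_eq_square)
  qed
  have "(\<lambda>n. (real n / (real n - 2 * x)) ^ Suc n * ((real n + 1) * (real n + 2) * x\<^sup>2 / (real n - 2
      * x)\<^sup>2 - 2 * x\<^sup>2 * (real n + 1) / (real n - 2 * x) + x\<^sup>2)) \<longlonglongrightarrow> 0"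
  proof -
    have "(\<lambda>n. (real n / (real n - 2 * x)) ^ Suc n) \<longlonglongrightarrow> exp (2 * x)" by real_asymp
    moreover have "(\<lambda>n. (real n + 1) * (real n + 2) * x\<^sup>2 / (real n - 2 * x)\<^sup>2 - 2 * x\<^sup>2 * (real n +
        1) / (real n - 2 * x) + x\<^sup>2) \<longlonglongrightarrow> 0"
    proof -
      have "(\<lambda>n. (real n + a) / (real n - 2 * x)) \<longlonglongrightarrow> 1" for a :: real
        by real_asymp
      hence "(\<lambda>n. (real n + 1) / (real n - 2 * x) * ((real n + 2) / (real n - 2 * x)) * x\<^sup>2
           - 2 * x\<^sup>2 * ((real n + 1) / (real n - 2 * x)) + x\<^sup>2) \<longlonglongrightarrow> 1 * 1 * x\<^sup>2 - 2 * x\<^sup>2 * 1 + x\<^sup>2"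
        by (intro tendsto_intros)
      moreover have "(real n + 1) / (real n - 2 * x) * ((real n + 2) / (real n - 2 * x)) * x\<^sup>2
           - 2 * x\<^sup>2 * ((real n + 1) / (real n - 2 * x)) + x\<^sup>2 =
         (real n + 1) * (real n + 2) * x\<^sup>2 / (real n - 2 * x)\<^sup>2 - 2 * x\<^sup>2 * (real n + 1) / (real n -
             2 * x) + x\<^sup>2" for n
        by (simp only: power2_eq_square times_divide_eq_left times_divide_eq_right
            divide_divide_eq_left times_divide_times_eq)
      ultimately show ?thesis by (simp add: power2_eq_square)
    qed
    ultimately have "(\<lambda>n. (real n / (real n - 2 * x)) ^ Suc n * ((real n + 1) * (real n + 2) * x\<^sup>2 /
        (real n - 2 * x)\<^sup>2 - 2 * x\<^sup>2 * (real n + 1) / (real n - 2 * x) + x\<^sup>2)) \<longlonglongrightarrow> exp (2 * x) * 0"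
      by (rule tendsto_mult)
    thus ?thesis by simp
  qed
  moreover have ev: "eventually (\<lambda>n. real n > 2 * x) sequentially" by real_asymp
  ultimately have "e \<longlonglongrightarrow> 0"
    by (rule Lim_transform_eventually[OF _ eventually_mono]) (simp add: e_alt)
  hence "(\<lambda>n. B + \<epsilon> / 2 + C * e n) \<longlonglongrightarrow> B + \<epsilon> / 2 + C * 0" by (intro tendsto_intros)
  hence "\<bar>h x\<bar> \<le> B + \<epsilon> / 2 + C * 0"
  proof (rule tendsto_lowerbound)
    show "eventually (\<lambda>n. \<bar>h x\<bar> \<le> B + \<epsilon> / 2 + C * e n) sequentially"
      using ev by eventually_elim (rule main, use x in \<open>simp add: field_simps\<close>)
  qed simp
  thus "\<bar>h x\<bar> \<le> B + \<epsilon>" using \<epsilon> by simp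
qed

section \<open>Cauchy estimates on circles that nearly touch the imaginary axis\<close>

lemma integral_inverse_powr_le:
  fixes \<alpha> r :: real
  assumes \<alpha>: "1 < \<alpha>" and r: "r > 0"
  defines "g \<equiv> (\<lambda>t. r * (1 + 4 * r * \<bar>t - 1/2\<bar>) powr (-\<alpha>))"
  shows "g integrable_on {0..1}" "integral {0..1} g \<le> 1 / (2 * (\<alpha> - 1))"
proof -
  \<comment> \<open>An antiderivative in the distance u from t = 1/2. The factor \<open>r\<close>,
    which comes from the arc length, cancels against the inner factor \<open>4 * r\<close>, and
    \<alpha> > 1 bounds the total by \<open>- 2 * G 0\<close>, whatever \<open>r\<close> is.\<close>
  define G where "G = (\<lambda>u. (1 + 4 * r * u) powr (1 - \<alpha>) / (4 * (1 - \<alpha>)))"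
  have pos: "1 + 4 * r * u > 0" if "u \<ge> 0" for u using r that by (simp add: add_pos_nonneg)
  have dG: "(G has_real_derivative r * (1 + 4 * r * u) powr (-\<alpha>)) (at u within S)" if "u \<ge> 0" for u
      S
  proof -
    have "((\<lambda>u. (1 + 4 * r * u) powr (1 - \<alpha>)) has_real_derivative (1 - \<alpha>) * (1 + 4 * r * u) powr (1
        - \<alpha> - 1) * (4 * r)) (at u within S)"
      using pos[OF that] by (auto intro!: derivative_eq_intros simp: mult_ac)
    from DERIV_cdivide[OF this, of "4 * (1 - \<alpha>)"] show ?thesis
      unfolding G_def by (rule DERIV_cong) (use \<alpha> in \<open>simp add: divide_simps\<close>)
  qed
  have A: "(g has_integral G (1/2) - G 0) {0..1/2}"
  proof -
    have "(g has_integral (- G (1/2 - 1/2)) - (- G (1/2 - 0))) {0..1/2}"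
    proof (rule fundamental_theorem_of_calculus)
      fix t :: real assume t: "t \<in> {0..1/2}"
      have "((\<lambda>t. - G (1/2 - t)) has_real_derivative - (r * (1 + 4 * r * (1/2 - t)) powr (-\<alpha>) * (0 -
          1))) (at t within {0..1/2})"
        by (intro DERIV_minus DERIV_chain2[OF dG[where S=UNIV]] derivative_intros) (use t in auto)
      thus "((\<lambda>t. - G (1/2 - t)) has_vector_derivative g t) (at t within {0..1/2})"
        using t by (simp add: g_def has_real_derivative_iff_has_vector_derivative)
    qed simp
    thus ?thesis by simp
  qed
  have B: "(g has_integral G (1/2) - G 0) {1/2..1}"
  proof -
    have "(g has_integral G (1 - 1/2) - G (1/2 - 1/2)) {1/2..1}"
    proof (rule fundamental_theorem_of_calculus)
      fix t :: real assume t: "t \<in> {1/2..1}"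
      have "((\<lambda>t. G (t - 1/2)) has_real_derivative (r * (1 + 4 * r * (t - 1/2)) powr (-\<alpha>) * (1 -
          0))) (at t within {1/2..1})"
        by (intro DERIV_chain2[OF dG[where S=UNIV]] derivative_intros) (use t in auto)
      thus "((\<lambda>t. G (t - 1/2)) has_vector_derivative g t) (at t within {1/2..1})"
        using t by (simp add: g_def has_real_derivative_iff_has_vector_derivative)
    qed simp
    thus ?thesis by simp
  qed
  have C: "(g has_integral (G (1/2) - G 0) + (G (1/2) - G 0)) {0..1}"
    by (rule has_integral_combine[OF _ _ A B]) auto
  thus "g integrable_on {0..1}" by blast
  have "G (1/2) \<le> 0" using \<alpha> by (simp add: G_def divide_nonneg_neg)
  moreover have "G 0 = - 1 / (4 * (\<alpha> - 1))" using \<alpha> by (simp add: G_def field_simps)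
  ultimately show "integral {0..1} g \<le> 1 / (2 * (\<alpha> - 1))"
  proof -
    have "1 / (2 * (\<alpha> - 1)) = - 2 * G 0" using \<alpha> unfolding \<open>G 0 = _\<close> by (simp add: divide_simps)
    thus ?thesis using integral_unique[OF C] \<open>G (1/2) \<le> 0\<close> by simp
  qed
qed

lemma cos_pi_lower_bound:
  assumes "t \<in> {0..1}"
  shows "2 * \<bar>t - 1/2\<bar> \<le> \<bar>cos (pi * t)\<bar>"
proof -
  \<comment> \<open>Jordan's inequality: on [0, pi/2] the concave sine lies above its chord.\<close>
  have jordan: "2 * s \<le> sin (pi * s)" if s: "s \<in> {0..1/2}" for s :: real
  proof -
    have "concave_on {0..pi} sin"
      by (rule f''_le0_imp_concave[where f' = cos and f'' = "\<lambda>x. - sin x"])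
         (auto intro!: derivative_eq_intros sin_ge_zero)
    hence "sin ((1 - 2 * s) *\<^sub>R 0 + (2 * s) *\<^sub>R (pi/2)) \<ge> (1 - 2 * s) * sin 0 + (2 * s) * sin
        (pi/2)"
      using s by (intro concave_onD) auto
    thus ?thesis by (simp add: mult.commute)
  qed
  have "cos (pi * t) = sin (pi * (1/2 - t))" by (simp add: sin_cos_eq algebra_simps)
  moreover have "\<bar>sin (pi * (1/2 - t))\<bar> = \<bar>sin (pi * \<bar>1/2 - t\<bar>)\<bar>"
    by (cases "1/2 - t \<ge> 0") (simp_all add: abs_if algebra_simps sin_diff)
  moreover have "2 * \<bar>1/2 - t\<bar> \<le> sin (pi * \<bar>1/2 - t\<bar>)" using assms by (intro jordan) (auto simp:
      abs_if)
  ultimately show ?thesis by (simp add: abs_minus_commute)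
qed

text \<open>The squared distance from 0 is (q - r)^2 + 4 q r cos(pi t)^2; dropping the first term
  and using r < q leaves 2 r |cos(pi t)|. The parameter t = 1/2 belongs to the point of the circle
  nearest to 0.\<close>

lemma norm_circle_ge:
  fixes q r t :: real
  assumes "0 < r" "r < q" "t \<in> {0..1}"
  shows "4 * r * \<bar>t - 1/2\<bar> \<le> norm (of_real q + of_real r * exp (2 * of_real pi * \<i> * of_real t))"
proof -
  define z where "z = of_real q + of_real r * exp (2 * of_real pi * \<i> * of_real t)"
  have e: "exp (2 * of_real pi * \<i> * of_real t) = Complex (cos (2*pi*t)) (sin (2*pi*t))"
    by (simp add: exp_eq_polar cis.ctr mult_ac)
  have "(norm z)\<^sup>2 = (q + r * cos (2*pi*t))\<^sup>2 + (r * sin (2*pi*t))\<^sup>2"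
    by (simp add: z_def e cmod_power2)
  also have "\<dots> = (q - r)\<^sup>2 + 2 * q * r * (1 + cos (2*pi*t))"
    using sin_cos_squared_add[of "2*pi*t"] by algebra
  also have "cos (2*pi*t) = 2 * (cos (pi*t))\<^sup>2 - 1"
    using cos_double_cos[of "pi*t"] by (simp add: mult_ac)
  also have "(q - r)\<^sup>2 + 2 * q * r * (1 + (2 * (cos (pi*t))\<^sup>2 - 1)) = (q - r)\<^sup>2 + 4 * (q * r) * (cos
      (pi*t))\<^sup>2"
    by simp
  finally have n: "(norm z)\<^sup>2 = (q - r)\<^sup>2 + 4 * (q * r) * (cos (pi*t))\<^sup>2" .
  have "(4 * r * \<bar>t - 1/2\<bar>)\<^sup>2 \<le> (2 * r * \<bar>cos (pi*t)\<bar>)\<^sup>2"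
    using cos_pi_lower_bound[OF assms(3)] assms by (intro power_mono) auto
  also have "\<dots> = 4 * (r * r) * (cos (pi*t))\<^sup>2" by (simp add: power2_eq_square)
  also have "\<dots> \<le> 4 * (q * r) * (cos (pi*t))\<^sup>2" using assms by (intro mult_right_mono mult_left_mono)
      auto
  also have "\<dots> \<le> (norm z)\<^sup>2" by (simp add: n)
  finally show ?thesis unfolding z_def[symmetric] by (rule power2_le_imp_le) simp
qed

text \<open>The supremum of \<open>F\<close> on the circle would yield only
  \<open>fact n / q ^ n\<close>. Since the decay exponent exceeds 1, the integral of |F| over the
  circle is bounded uniformly in the radius, which gains the missing factor 1/q demanded by
  \<open>post_widder_bound\<close>.\<close>

lemma higher_deriv_halfplane_bound:
  fixes F :: "complex \<Rightarrow> complex"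
  assumes \<alpha>: "1 < \<alpha>" and hol: "F holomorphic_on {z. Re z > 0}"
    and bnd: "\<And>z. Re z > 0 \<Longrightarrow> norm (F z) \<le> C * (1 + norm z) powr (-\<alpha>)"
    and q: "q > 0"
  shows "norm ((deriv ^^ n) F (of_real q)) \<le> C / (2 * (\<alpha> - 1)) * fact n / q ^ Suc n"
proof -
  have C: "C \<ge> 0" using order_trans[OF norm_ge_zero bnd[of 1]] by (simp add: zero_le_mult_iff)
  have *: "norm ((deriv ^^ n) F (of_real q)) * r ^ Suc n \<le> C / (2 * (\<alpha> - 1)) * fact n" if r: "0 < r"
      "r < q" for r
  proof -
    define p where "p = (\<lambda>t. of_real q + of_real r * exp (2 * of_real pi * \<i> * of_real t) ::
        complex)"
    have sub: "cball (of_real q) r \<subseteq> {z. Re z > 0}"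
    proof
      fix z :: complex assume "z \<in> cball (of_real q) r"
      hence "norm (z - of_real q) \<le> r" by (simp add: dist_norm norm_minus_commute)
      hence "\<bar>Re (z - of_real q)\<bar> \<le> r" using abs_Re_le_cmod order_trans by blast
      thus "z \<in> {z. Re z > 0}" using r by auto
    qed
    have p: "Re (p t) > 0" for t
    proof -
      have "p t \<in> cball (of_real q) r" using r
        by (simp add: p_def dist_norm norm_mult exp_eq_polar mult_ac)
      thus ?thesis using sub by auto
    qed
    have "((\<lambda>u. F u / (u - of_real q) ^ Suc n) has_contour_integral ((2 * pi * \<i>) / fact n * (deriv
        ^^ n) F (of_real q))) (circlepath (of_real q) r)"
      using sub r by (intro Cauchy_has_contour_integral_higher_derivative_circlepath
          holomorphic_on_imp_continuous_on holomorphic_on_subset[OF hol]) (use ball_subset_cball in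
              \<open>auto simp: subset_iff\<close>)
    hence hi: "((\<lambda>t. F (p t) / (p t - of_real q) ^ Suc n * (2 * pi * \<i> * r * exp (2 * of_real pi * \<i>
        * t))) has_integral ((2 * pi * \<i>) / fact n * (deriv ^^ n) F (of_real q))) {0..1}"
      unfolding has_contour_integral_def
      by (rule has_integral_eq[rotated])
         (simp only: atLeastAtMost_iff vector_derivative_circlepath01, simp add: circlepath p_def
             mult_ac)
    define g where "g = (\<lambda>t. r * (1 + 4 * r * \<bar>t - 1/2\<bar>) powr (-\<alpha>))"
    have "norm (integral {0..1} (\<lambda>t. F (p t) / (p t - of_real q) ^ Suc n * (2 * pi * \<i> * r * exp (2
        * of_real pi * \<i> * t)))) \<le> integral {0..1} (\<lambda>t. 2 * pi * C / r ^ Suc n * g t)"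
    proof (rule integral_norm_bound_integral)
      show "(\<lambda>t. 2 * pi * C / r ^ Suc n * g t) integrable_on {0..1}"
        unfolding g_def using integral_inverse_powr_le(1)[OF \<alpha> r(1)] by (rule
            integrable_on_mult_right)
      fix t :: real assume t: "t \<in> {0..1}"
      have ne: "norm (exp (2 * of_real pi * \<i> * of_real t)) = 1" by (simp add: exp_eq_polar mult_ac)
      have "norm (F (p t) / (p t - of_real q) ^ Suc n * (2 * pi * \<i> * r * exp (2 * of_real pi * \<i> *
          t)))
         = norm (F (p t)) / r ^ Suc n * (2 * pi * r)"
        using r ne by (simp add: p_def norm_mult norm_divide norm_power)
      also have "\<dots> \<le> (C * (1 + norm (p t)) powr (-\<alpha>)) / r ^ Suc n * (2 * pi * r)"
        using r by (intro mult_right_mono divide_right_mono bnd p) auto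
      also have "\<dots> \<le> (C * (1 + 4 * r * \<bar>t - 1/2\<bar>) powr (-\<alpha>)) / r ^ Suc n * (2 * pi * r)"
        using norm_circle_ge[OF r t] r \<alpha> C
        by (intro mult_right_mono divide_right_mono mult_left_mono powr_mono2') (auto simp: p_def
            add_pos_nonneg)
      also have "\<dots> = 2 * pi * C / r ^ Suc n * g t" by (simp add: g_def)
      finally show "norm (F (p t) / (p t - of_real q) ^ Suc n * (2 * pi * \<i> * r * exp (2 * of_real
          pi * \<i> * t))) \<le> 2 * pi * C / r ^ Suc n * g t" .
    qed (use hi in blast)
    also have "\<dots> = 2 * pi * C / r ^ Suc n * integral {0..1} g" by simp
    also have "\<dots> \<le> 2 * pi * C / r ^ Suc n * (1 / (2 * (\<alpha> - 1)))"
      unfolding g_def using C r by (intro mult_left_mono integral_inverse_powr_le(2) \<alpha>) auto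
    finally have "2 * pi / fact n * norm ((deriv ^^ n) F (of_real q)) \<le> 2 * pi * (C / r ^ Suc n * (1
        / (2 * (\<alpha> - 1))))"
      using hi by (simp add: integral_unique norm_mult norm_divide)
    hence "2 * pi * (norm ((deriv ^^ n) F (of_real q)) / fact n) \<le> 2 * pi * (C / r ^ Suc n * (1 / (2
        * (\<alpha> - 1))))"
      by simp
    hence "norm ((deriv ^^ n) F (of_real q)) / fact n \<le> C / r ^ Suc n * (1 / (2 * (\<alpha> - 1)))"
      by (rule mult_left_le_imp_le) simp
    hence "norm ((deriv ^^ n) F (of_real q)) \<le> C / (2 * (\<alpha> - 1)) * fact n / r ^ Suc n"
      by (simp add: pos_divide_le_eq mult_ac)
    thus ?thesis using r by (subst (asm) pos_le_divide_eq) auto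
  qed
  \<comment> \<open>The radius \<open>q\<close> itself would let the circle reach 0, outside the
    domain of \<open>F\<close>; it is approached from below by
    \<open>q * (1 - 1 / (m + 2))\<close>.\<close>
  have "(\<lambda>m. norm ((deriv ^^ n) F (of_real q)) * (q * (1 - 1 / real (m+2))) ^ Suc n) \<longlonglongrightarrow> norm ((deriv
      ^^ n) F (of_real q)) * (q * (1 - 0)) ^ Suc n"
    by (intro tendsto_intros) real_asymp
  hence "norm ((deriv ^^ n) F (of_real q)) * (q * (1 - 0)) ^ Suc n \<le> C / (2 * (\<alpha> - 1)) * fact n"
  proof (rule LIMSEQ_le_const2, intro exI allI impI)
    fix m :: nat
    have "1 / real (m + 2) > 0" "1 / real (m + 2) < 1" by (simp_all add: field_simps)
    thus "norm ((deriv ^^ n) F (of_real q)) * (q * (1 - 1 / real (m + 2))) ^ Suc n \<le> C / (2 * (\<alpha> -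
        1)) * fact n"
      using q mult_strict_left_mono[of "1 - 1 / real (m + 2)" 1 q] by (intro *) auto
  qed
  thus ?thesis using q by (subst pos_le_divide_eq) auto
qed

section \<open>Series with exponents \<alpha>(m+1) - 1 and their Laplace transforms\<close>

lemma summable_poly_geometric: "summable (\<lambda>m. A * (real m + 1)\<^sup>2 * (1/2) ^ m :: real)"
proof -
  have "(\<lambda>m. A * (real m + 1)\<^sup>2 * (1/2) ^ m) \<in> O(\<lambda>m. (3/4) ^ m :: real)"
    by real_asymp
  thus ?thesis by (rule summable_comparison_test_bigo[rotated]) simp
qed

lemma higher_deriv_powr_of_real:
  fixes s q :: real
  assumes "q > 0"
  shows "(deriv ^^ n) (\<lambda>z. z powr (- of_real s)) (of_real q :: complex) = of_real ((-1) ^ n *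
      pochhammer s n * q powr (- s - real n))"
proof -
  have "(deriv ^^ n) (\<lambda>z. z powr (- of_real s)) z = (-1) ^ n * of_real (pochhammer s n) * z powr (-
      of_real s - of_nat n)"
    if "Re z > 0" for z :: complex
    using that
  proof (induction n arbitrary: z)
    case (Suc n)
    have "(deriv ^^ Suc n) (\<lambda>z. z powr (- of_real s)) z = deriv ((deriv ^^ n) (\<lambda>z. z powr (- of_real
        s))) z" by simp
    also have "\<dots> = deriv (\<lambda>z. (-1) ^ n * of_real (pochhammer s n) * z powr (- of_real s - of_nat n))
        z"
    proof (rule deriv_cong_ev)
      have "eventually (\<lambda>z. z \<in> {z. Re z > 0}) (nhds z)"
        using Suc.prems by (intro eventually_nhds_in_open open_halfspace_Re_gt) auto
      thus "\<forall>\<^sub>F z in nhds z. (deriv ^^ n) (\<lambda>z. z powr (- of_real s)) z = (-1) ^ n * of_real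
          (pochhammer s n) * z powr (- of_real s - of_nat n)"
        by eventually_elim (use Suc.IH in auto)
    qed simp
    also have "\<dots> = (-1) ^ n * of_real (pochhammer s n) * ((- of_real s - of_nat n) * z powr (-
        of_real s - of_nat n - 1))"
    proof (rule DERIV_imp_deriv)
      have "z \<notin> \<real>\<^sub>\<le>\<^sub>0" using Suc.prems by (auto simp: complex_nonpos_Reals_iff)
      thus "((\<lambda>z. (-1) ^ n * of_real (pochhammer s n) * z powr (- of_real s - of_nat n))
          has_field_derivative
         (-1) ^ n * of_real (pochhammer s n) * ((- of_real s - of_nat n) * z powr (- of_real s -
             of_nat n - 1))) (at z)"
        by (intro DERIV_cmult has_field_derivative_powr)
    qed
    also have "\<dots> = (-1) ^ Suc n * of_real (pochhammer s (Suc n)) * z powr (- of_real s - of_nat (Suc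
        n))"
      by (simp add: pochhammer_Suc algebra_simps)
    finally show ?case .
  qed simp
  from this[of "of_real q"] assms show ?thesis
    by (simp add: powr_of_real[symmetric])
qed

definition gser :: "real \<Rightarrow> (nat \<Rightarrow> real) \<Rightarrow> real \<Rightarrow> real" where
  "gser \<alpha> a x = (\<Sum>m. a m * (x powr (\<alpha> * (real m + 1) - 1) / Gamma (\<alpha> * (real m + 1))))"

context
  fixes \<alpha> :: real and a :: "nat \<Rightarrow> real" and A :: real
  assumes \<alpha>: "1 < \<alpha>" and a: "\<And>m. \<bar>a m\<bar> \<le> A * (real m + 1)\<^sup>2"
begin

private abbreviation gterm :: "nat \<Rightarrow> real \<Rightarrow> real" where
  "gterm m x \<equiv> a m * (x powr (\<alpha> * (real m + 1) - 1) / Gamma (\<alpha> * (real m + 1)))"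

private lemma ge1: "\<alpha> * (real m + 1) > 1"
proof -
  have "1 * 1 < \<alpha> * (real m + 1)" using \<alpha> by (intro mult_less_le_imp_less) auto
  thus ?thesis by simp
qed

private lemma gser_term_bound:
  assumes "x \<ge> 0"
  shows "\<bar>gterm m x\<bar> \<le> A * (real m + 1)\<^sup>2 * (1/2) ^ m * exp (2 * x + 1)"
proof -
  have G: "Gamma (\<alpha> * (real m + 1)) > 0" using ge1[of m] by (intro Gamma_real_pos) auto
  have "x powr (\<alpha> * (real m + 1) - 1) / Gamma (\<alpha> * (real m + 1)) \<le> 2 powr (1 - \<alpha> * (real m + 1)) *
      exp (2 * x + 1)"
    using ge1[of m] assms by (intro powr_over_Gamma_le) auto
  also have "2 powr (1 - \<alpha> * (real m + 1)) \<le> 2 powr (- real m)"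
    using \<alpha> mult_right_mono[of 1 \<alpha> "real m + 1"] by (intro powr_mono) (auto simp: algebra_simps)
  also have "2 powr (- real m) = (1/2) ^ m"
    by (simp add: powr_minus powr_realpow power_divide field_simps)
  finally have *: "x powr (\<alpha> * (real m + 1) - 1) / Gamma (\<alpha> * (real m + 1)) \<le> (1/2) ^ m * exp (2 * x
      + 1)" by simp
  have "\<bar>gterm m x\<bar> = \<bar>a m\<bar> * (x powr (\<alpha> * (real m + 1) - 1) / Gamma (\<alpha> * (real m + 1)))"
    using G by (simp add: abs_mult)
  also have "\<dots> \<le> (A * (real m + 1)\<^sup>2) * ((1/2) ^ m * exp (2 * x + 1))"
    using G a[of m] by (intro mult_mono * a) (auto intro: order_trans[OF abs_ge_zero])
  finally show ?thesis by (simp add: mult_ac)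
qed

lemma gser_sums:
  assumes "x \<ge> 0"
  shows "(\<lambda>m. gterm m x) sums gser \<alpha> a x"
  unfolding gser_def
proof (rule summable_sums, rule summable_comparison_test')
  show "summable (\<lambda>m. A * (real m + 1)\<^sup>2 * (1/2) ^ m * exp (2 * x + 1))"
    using summable_poly_geometric by (rule summable_mult2)
  show "\<And>m. 0 \<le> m \<Longrightarrow> norm (gterm m x) \<le> A * (real m + 1)\<^sup>2 * (1/2) ^ m * exp (2 * x + 1)"
    using gser_term_bound[OF assms] by simp
qed

private definition "MA = exp 1 * (\<Sum>m. A * (real m + 1)\<^sup>2 * (1/2) ^ m)"

private lemma partial_bound:
  assumes x: "x \<ge> 0"
  shows "\<bar>\<Sum>m<n. gterm m x\<bar> \<le> MA * exp (2 * x)"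
proof -
  have A: "A \<ge> 0" using a[of 0] by simp
  have "\<bar>\<Sum>m<n. gterm m x\<bar> \<le> (\<Sum>m<n. A * (real m + 1)\<^sup>2 * (1/2) ^ m * exp (2 * x + 1))"
    by (rule order_trans[OF sum_abs sum_mono]) (rule gser_term_bound[OF x])
  also have "\<dots> = (\<Sum>m<n. A * (real m + 1)\<^sup>2 * (1/2) ^ m) * exp (2 * x + 1)" by (simp add:
      sum_distrib_right)
  also have "\<dots> \<le> (\<Sum>m. A * (real m + 1)\<^sup>2 * (1/2) ^ m) * exp (2 * x + 1)"
    using A by (intro mult_right_mono sum_le_suminf summable_poly_geometric) auto
  also have "\<dots> = MA * exp (2 * x)" by (simp add: MA_def exp_add)
  finally show ?thesis .
qed

private lemma gser_bound:
  assumes "x \<ge> 0"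
  shows "\<bar>gser \<alpha> a x\<bar> \<le> MA * exp (2 * x)"
  using tendsto_rabs[OF gser_sums[OF assms, unfolded sums_def]]
  by (rule LIMSEQ_le_const2) (use partial_bound[OF assms] in auto)

private lemma isCont_gser:
  assumes x: "x > 0"
  shows "isCont (gser \<alpha> a) x"
proof -
  define S where "S = {0<..<x+1}"
  have "uniform_limit S (\<lambda>n y. \<Sum>m<n. gterm m y) (\<lambda>y. \<Sum>m. gterm m y) sequentially"
  proof (rule Weierstrass_m_test)
    show "summable (\<lambda>m. A * (real m + 1)\<^sup>2 * (1/2) ^ m * exp (2 * (x+1) + 1))"
      using summable_poly_geometric by (rule summable_mult2)
    fix m y assume y: "y \<in> S"
    have "\<bar>gterm m y\<bar> \<le> A * (real m + 1)\<^sup>2 * (1/2) ^ m * exp (2 * y + 1)"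
      using y by (intro gser_term_bound) (auto simp: S_def)
    also have "\<dots> \<le> A * (real m + 1)\<^sup>2 * (1/2) ^ m * exp (2 * (x+1) + 1)"
      using y a[of 0] by (intro mult_left_mono) (auto simp: S_def)
    finally show "norm (gterm m y) \<le> A * (real m + 1)\<^sup>2 * (1/2) ^ m * exp (2 * (x+1) + 1)" by simp
  qed
  hence "continuous_on S (\<lambda>y. \<Sum>m. gterm m y)"
    by (rule uniform_limit_theorem[rotated])
       (use Gamma_real_pos[OF less_trans[OF zero_less_one ge1]] in \<open>auto simp: S_def
           less_imp_neq[symmetric] intro!: always_eventually continuous_intros\<close>)
  hence "continuous_on S (gser \<alpha> a)" by (simp add: gser_def[abs_def])
  thus ?thesis using x by (simp add: S_def continuous_on_eq_continuous_at)
qed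

text \<open>Partial sums are dominated by \<open>MA * exp (2 * t)\<close>, hence the integrands by a
  multiple of \<open>t ^ n * exp (- (q - 2) * t)\<close>, and dominated convergence permits
  integration term by term. Up to the sign (-1)^n, these integrals are the derivatives of the
  transform at \<open>q\<close>.\<close>

private lemma gser_laplace:
  assumes q: "q > 2"
  shows "(\<lambda>t. t ^ n * exp (- q * t) * gser \<alpha> a t) integrable_on {0..}"
    and "(\<lambda>m. a m * (pochhammer (\<alpha> * (real m + 1)) n * q powr (- (\<alpha> * (real m + 1)) - real n))) sums
           integral {0..} (\<lambda>t. t ^ n * exp (- q * t) * gser \<alpha> a t)"
proof -
  define s where "s = (\<lambda>m. \<alpha> * (real m + 1))"
  have s: "s m > 1" for m using ge1 by (simp add: s_def)
  have single: "((\<lambda>t. t ^ n * exp (- q * t) * (a m * (t powr (s m - 1) / Gamma (s m)))) has_integral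
     a m * (pochhammer (s m) n * q powr (- s m - real n))) {0..}" for m
  proof -
    have "((\<lambda>t. t powr (s m + n - 1) * exp (- q * t)) has_integral Gamma (s m + n) / q powr (s m +
        n)) {0..}"
      using q s[of m] by (intro Gamma_integral_scaled) auto
    hence "((\<lambda>t. a m / Gamma (s m) * (t powr (s m + n - 1) * exp (- q * t))) has_integral a m /
        Gamma (s m) * (Gamma (s m + n) / q powr (s m + n))) {0..}"
      by (rule has_integral_mult_right)
    moreover have "s m \<notin> \<int>\<^sub>\<le>\<^sub>0" using s[of m] by (auto elim!: nonpos_Ints_cases)
    hence "a m / Gamma (s m) * (Gamma (s m + n) / q powr (s m + n)) = a m * (pochhammer (s m) n * q
        powr (- s m - real n))"
      using pochhammer_Gamma[of "s m" n] by (simp add: powr_minus_divide powr_diff powr_add)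
    ultimately have "((\<lambda>t. a m / Gamma (s m) * (t powr (s m + n - 1) * exp (- q * t))) has_integral
        a m * (pochhammer (s m) n * q powr (- s m - real n))) {0..}"
      by simp
    thus ?thesis
    proof (rule has_integral_spike[of "{0}", rotated 2])
      fix t :: real assume "t \<in> {0..} - {0}"
      hence "t > 0" by auto
      have "t powr (s m + n - 1) = t powr (real n + (s m - 1))" by (simp add: algebra_simps)
      also have "\<dots> = t ^ n * t powr (s m - 1)" using \<open>t > 0\<close> by (simp only: powr_add powr_realpow)
      finally show "t ^ n * exp (- q * t) * (a m * (t powr (s m - 1) / Gamma (s m))) = a m / Gamma
          (s m) * (t powr (s m + n - 1) * exp (- q * t))"
        by simp
    qed simp
  qed
  define f where "f = (\<lambda>N t. t ^ n * exp (- q * t) * (\<Sum>m<N. a m * (t powr (s m - 1) / Gamma (s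
      m))))"
  have f: "(f N has_integral (\<Sum>m<N. a m * (pochhammer (s m) n * q powr (- s m - real n)))) {0..}"
      for N
    unfolding f_def sum_distrib_left by (intro has_integral_sum single) auto
  have dom: "(\<lambda>t. MA * (t ^ n * exp (- (q - 2) * t))) integrable_on {0..}"
    using power_exp_integral[of "q - 2" n] q by (intro integrable_on_mult_right) auto
  have le: "norm (f N t) \<le> MA * (t ^ n * exp (- (q - 2) * t))" if t: "t \<in> {0..}" for N t
  proof -
    have "exp (- (q - 2) * t) = exp (- q * t) * exp (2 * t)" by (simp add: algebra_simps flip:
        exp_add)
    moreover have "norm (f N t) \<le> t ^ n * exp (- q * t) * (MA * exp (2 * t))"
      using t partial_bound[of t N] by (auto simp: f_def abs_mult s_def intro!: mult_left_mono)
    ultimately show ?thesis by (simp add: mult_ac)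
  qed
  have lim: "(\<lambda>N. f N t) \<longlonglongrightarrow> t ^ n * exp (- q * t) * gser \<alpha> a t" if t: "t \<in> {0..}" for t
    using gser_sums[of t] t unfolding f_def sums_def s_def by (intro tendsto_intros) auto
  show "(\<lambda>t. t ^ n * exp (- q * t) * gser \<alpha> a t) integrable_on {0..}"
    by (rule dominated_convergence(1)[OF _ dom le lim]) (use f in blast)
  have "(\<lambda>N. integral {0..} (f N)) \<longlonglongrightarrow> integral {0..} (\<lambda>t. t ^ n * exp (- q * t) * gser \<alpha> a t)"
    by (rule dominated_convergence(2)[OF _ dom le lim]) (use f in blast)
  thus "(\<lambda>m. a m * (pochhammer (\<alpha> * (real m + 1)) n * q powr (- (\<alpha> * (real m + 1)) - real n))) sums
           integral {0..} (\<lambda>t. t ^ n * exp (- q * t) * gser \<alpha> a t)"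
    using integral_unique[OF f] by (simp add: sums_def s_def)
qed

text \<open>The Laplace transform of \<open>gser\<close> is \<open>F\<close>. By the Post--Widder inversion formula,
  estimates of all derivatives of \<open>F\<close> on the real axis, which Cauchy's formula provides,
  give a bound for \<open>gser\<close>.\<close>

lemma gser_bounded:
  fixes F :: "complex \<Rightarrow> complex"
  assumes hol: "F holomorphic_on {z. Re z > 0}"
    and bnd: "\<And>z. Re z > 0 \<Longrightarrow> norm (F z) \<le> C * (1 + norm z) powr (-\<alpha>)"
    and F: "\<And>z. Re z > 2 \<Longrightarrow> (\<lambda>m. of_real (a m) * z powr (- of_real (\<alpha> * (real m + 1)))) sums F z"
    and x: "x > 0"
  shows "\<bar>gser \<alpha> a x\<bar> \<le> C / (2 * (\<alpha> - 1))"
proof (rule post_widder_bound[OF x isCont_gser[OF x] gser_bound gser_laplace(1)])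
  fix n :: nat and q :: real
  assume q: "q > 2"
  define s where "s = (\<lambda>m. \<alpha> * (real m + 1))"
  have s: "s m > 1" for m using ge1 by (simp add: s_def)
  define fs where "fs = (\<lambda>N z. \<Sum>m<N. of_real (a m) * z powr (- of_real (s m) :: complex))"
  \<comment> \<open>The series represents \<open>F\<close> only in this smaller half-plane. It
    contains all points \<open>q\<close> in question, and uniform convergence passes to derivatives
    there; the circles of Cauchy's formula around these points use \<open>F\<close> on all of Re z >
    0.\<close>
  have "uniform_limit {z. Re z > 2} fs (\<lambda>z. \<Sum>m. of_real (a m) * z powr (- of_real (s m) :: complex))
      sequentially"
    unfolding fs_def
  proof (rule Weierstrass_m_test[OF _ summable_poly_geometric[of A]])
    fix m and z :: complex assume "z \<in> {z. Re z > 2}"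
    hence z: "norm z \<ge> 2" "Re z > 0" using complex_Re_le_cmod[of z] by auto
    have "norm (z powr (- of_real (s m))) = norm z powr (- s m)"
      using z norm_powr_real_powr'[of "- s m" z] by (simp add: norm_powr_real_powr')
    also have "\<dots> \<le> 2 powr (- s m)" using z s[of m] by (intro powr_mono2') auto
    also have "\<dots> \<le> 2 powr (- real m)" using \<alpha> mult_right_mono[of 1 \<alpha> "real m + 1"]
      by (intro powr_mono) (auto simp: s_def algebra_simps)
    also have "2 powr (- real m) = (1/2) ^ m"
      by (simp add: powr_minus powr_realpow power_divide field_simps)
    finally show "norm (of_real (a m) * z powr (- of_real (s m))) \<le> A * (real m + 1)\<^sup>2 * (1/2) ^ m"
      unfolding norm_mult norm_of_real using a[of m] by (intro mult_mono) (auto intro: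
          order_trans[OF abs_ge_zero])
  qed
  hence ul: "uniform_limit {z. Re z > 2} fs F sequentially"
    by (rule uniform_limit_cong'[THEN iffD1, rotated 2]) (use F in \<open>auto simp: s_def sums_iff\<close>)
  have "(\<lambda>N. (deriv ^^ n) (fs N) (of_real q)) \<longlonglongrightarrow> (deriv ^^ n) F (of_real q)"
    by (rule higher_deriv_complex_uniform_limit[OF ul])
       (use q in \<open>auto simp: fs_def open_halfspace_Re_gt complex_nonpos_Reals_iff intro!:
           always_eventually holomorphic_intros\<close>)
  moreover have "(deriv ^^ n) (fs N) (of_real q) = of_real ((-1) ^ n * (\<Sum>m<N. a m * (pochhammer (s
      m) n * q powr (- s m - real n))))" for N
  proof -
    have hol: "(\<lambda>z. z powr (- of_real (s m))) holomorphic_on {z. Re z > 0}" for m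
      by (intro holomorphic_intros) (auto simp: complex_nonpos_Reals_iff)
    have hd: "(deriv ^^ n) (\<lambda>z. of_real (a m) * z powr (- of_real (s m))) (of_real q) = of_real (a
        m) * (deriv ^^ n) (\<lambda>z. z powr (- of_real (s m))) (of_real q :: complex)" for m
      using q by (intro higher_deriv_cmult[OF hol]) (auto simp: open_halfspace_Re_gt)
    have "(deriv ^^ n) (fs N) (of_real q) = (\<Sum>m<N. (deriv ^^ n) (\<lambda>z. of_real (a m) * z powr (-
        of_real (s m))) (of_real q))"
    proof (induction N)
      case 0
      show ?case unfolding fs_def using higher_deriv_const[of n 0] by (cases n) (simp_all del:
          funpow.simps)
    next
      case (Suc N)
      have "(deriv ^^ n) (\<lambda>z. fs N z + of_real (a N) * z powr (- of_real (s N))) (of_real q) =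
         (deriv ^^ n) (fs N) (of_real q) + (deriv ^^ n) (\<lambda>z. of_real (a N) * z powr (- of_real (s
             N))) (of_real q)"
        by (rule higher_deriv_add[of _ "{z. Re z > 0}"])
           (use q in \<open>auto simp: fs_def open_halfspace_Re_gt complex_nonpos_Reals_iff intro!:
               holomorphic_intros\<close>)
      thus ?case using Suc by (simp add: fs_def)
    qed
    thus ?thesis using q by (simp add: hd higher_deriv_powr_of_real sum_distrib_left mult_ac)
  qed
  moreover have "(\<lambda>N. of_real ((-1) ^ n * (\<Sum>m<N. a m * (pochhammer (s m) n * q powr (- s m - real
      n)))) :: complex)
     \<longlonglongrightarrow> of_real ((-1) ^ n * integral {0..} (\<lambda>t. t ^ n * exp (- q * t) * gser \<alpha> a t))"
    using gser_laplace(2)[OF q, of n] unfolding sums_def s_def by (intro tendsto_intros)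
  ultimately have "(deriv ^^ n) F (of_real q) = of_real ((-1) ^ n * integral {0..} (\<lambda>t. t ^ n * exp
      (- q * t) * gser \<alpha> a t))"
    by (simp only: LIMSEQ_unique)
  hence "\<bar>integral {0..} (\<lambda>t. t ^ n * exp (- q * t) * gser \<alpha> a t)\<bar> = norm ((deriv ^^ n) F (of_real
      q))"
    by (simp add: norm_mult norm_power)
  also have "\<dots> \<le> C / (2 * (\<alpha> - 1)) * fact n / q ^ Suc n"
    using q by (intro higher_deriv_halfplane_bound[OF \<alpha> hol bnd]) auto
  finally show "\<bar>integral {0..} (\<lambda>t. t ^ n * exp (- q * t) * gser \<alpha> a t)\<bar> \<le> C / (2 * (\<alpha> - 1)) * fact
      n / q ^ Suc n" .
qed

end

section \<open>Transforms that are rational in z^\<alpha>\<close>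

lemma sums_alternating_linear:
  fixes w :: complex
  assumes w: "norm w < 1"
  shows "(\<lambda>m. (-1) ^ m * w ^ (m + 1)) sums (w / (1 + w))"
    and "(\<lambda>m. (-1) ^ m * (of_nat m + 1) * w ^ (m + 1)) sums (w / (1 + w)\<^sup>2)"
    and "(\<lambda>m. (-1) ^ m * (of_nat m + 1)\<^sup>2 * w ^ (m + 1)) sums (w * (1 - w) / (1 + w) ^ 3)"
proof -
  have n: "norm (-w) < 1" using w by simp
  have w1: "1 + w \<noteq> 0" using w by (metis add.inverse_unique norm_minus_cancel norm_one
      order_less_irrefl)
  have A: "(\<lambda>m. (-w) ^ m) sums (1 / (1 + w))" using geometric_sums[OF n] by simp
  have B: "(\<lambda>m. of_nat (Suc m) * (-w) ^ m) sums (1 / (1 + w)\<^sup>2)" using geometric_deriv_sums[OF n] by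
      simp
  have "summable (\<lambda>m. norm ((-w) ^ m))" using w by (simp add: norm_power summable_geometric)
  moreover have "summable (\<lambda>m. norm (of_nat (Suc m) * (-w) ^ m))"
    using sums_summable[OF geometric_deriv_sums[of "norm w"]] w by (simp add: norm_mult norm_power
        del: of_nat_Suc)
  \<comment> \<open>The Cauchy product of the geometric series with its derivative has the
    coefficients (k+1)(k+2)/2, up to the power of -w, and the sum 1/(1+w)^3.\<close>
  ultimately have "(\<lambda>k. \<Sum>i\<le>k. (of_nat (Suc i) * (-w) ^ i) * (-w) ^ (k - i)) sums
     ((\<Sum>m. of_nat (Suc m) * (-w) ^ m) * (\<Sum>m. (-w) ^ m))"
    by (intro Cauchy_product_sums)
  moreover have "(\<Sum>i\<le>k. (of_nat (Suc i) * (-w) ^ i) * (-w) ^ (k - i)) = ((of_nat k + 1) * (of_nat k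
      + 2) / 2) * (-w) ^ k" for k
  proof -
    have "(\<Sum>i\<le>k. (of_nat (Suc i) * (-w) ^ i) * (-w) ^ (k - i)) = (\<Sum>i\<le>k. of_nat (Suc i) * (-w) ^ k)"
      by (intro sum.cong refl) (simp add: mult.assoc flip: power_add)
    also have "\<dots> = (\<Sum>i\<le>k. of_nat (Suc i)) * (-w) ^ k" by (simp only: sum_distrib_right)
    also have "(\<Sum>i\<le>k. of_nat (Suc i)) = ((of_nat k + 1) * (of_nat k + 2) / 2 :: complex)"
      by (induction k) (simp_all add: field_simps)
    finally show ?thesis .
  qed
  ultimately have C: "(\<lambda>k. ((of_nat k + 1) * (of_nat k + 2) / 2) * (-w) ^ k) sums (1 / (1 + w)\<^sup>2 *
      (1 / (1 + w)))"
    using sums_unique[OF A] sums_unique[OF B] by (simp only:)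
  have p: "(-1) ^ m * w ^ (m + 1) = w * (-w) ^ m" for m by (simp add: power_minus[of w])
  show "(\<lambda>m. (-1) ^ m * w ^ (m + 1)) sums (w / (1 + w))"
    using sums_mult[OF A, of w] by (simp only: p) simp
  show "(\<lambda>m. (-1) ^ m * (of_nat m + 1) * w ^ (m + 1)) sums (w / (1 + w)\<^sup>2)"
  proof -
    have e: "(-1) ^ m * (of_nat m + 1) * w ^ (m + 1) = w * (of_nat (Suc m) * (-w) ^ m)" for m
      by (simp add: power_minus[of w] algebra_simps)
    show ?thesis unfolding e using sums_mult[OF B, of w] by simp
  qed
  \<comment> \<open>Here (k+1)^2 is split into twice (k+1)(k+2)/2 minus (k+1).\<close>
  have "(\<lambda>k. w * (2 * (((of_nat k + 1) * (of_nat k + 2) / 2) * (-w) ^ k) - of_nat (Suc k) * (-w) ^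
      k)) sums
    (w * (2 * (1 / (1 + w)\<^sup>2 * (1 / (1 + w))) - 1 / (1 + w)\<^sup>2))"
    by (intro sums_mult sums_diff B C)
  moreover have "w * (2 * (((of_nat k + 1) * (of_nat k + 2) / 2) * (-w) ^ k) - of_nat (Suc k) * (-w)
      ^ k) = (-1) ^ k * (of_nat k + 1)\<^sup>2 * w ^ (k + 1)" for k
    by (simp add: power2_eq_square power_minus[of w] field_simps)
  moreover have "w * (2 * (1 / (1 + w)\<^sup>2 * (1 / (1 + w))) - 1 / (1 + w)\<^sup>2) = w * (1 - w) / (1 + w) ^
      3"
    using w1 by (simp add: divide_simps power2_eq_square power3_eq_cube)
  ultimately show "(\<lambda>m. (-1) ^ m * (of_nat m + 1)\<^sup>2 * w ^ (m + 1)) sums (w * (1 - w) / (1 + w) ^ 3)"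
    by (simp only:)
qed

text \<open>The argument of \<open>z\<^sup>\<alpha>\<close> is at most \<open>\<pi>\<alpha>/2 < \<pi>\<close>.\<close>

lemma norm_powr_plus_one_ge:
  assumes \<alpha>: "1 < \<alpha>" "\<alpha> < 2"
  obtains d where "0 < d" "d \<le> 1" "\<And>z. Re z > 0 \<Longrightarrow> d * (1 + norm z powr \<alpha>) \<le> norm (z powr of_real \<alpha> +
      1)"
proof -
  define \<kappa> where "\<kappa> = cos (pi * \<alpha> / 2)"
  have \<kappa>: "-1 < \<kappa>" "\<kappa> \<le> 1"
  proof -
    have "cos (pi * \<alpha> / 2) > cos pi" using \<alpha> by (intro cos_monotone_0_pi) (auto simp: field_simps)
    thus "-1 < \<kappa>" by (simp add: \<kappa>_def)
  qed (simp add: \<kappa>_def)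
  define d where "d = sqrt ((1 + \<kappa>) / 2)"
  show thesis
  proof (rule that)
    show "0 < d" "d \<le> 1" using \<kappa> by (simp_all add: d_def)
    fix z :: complex assume z: "Re z > 0"
    define r where "r = norm z powr \<alpha>"
    have r: "r \<ge> 0" by (simp add: r_def)
    have z0: "z \<noteq> 0" using z by auto
    define t where "t = \<alpha> * Arg z"
    have zp: "z powr of_real \<alpha> = of_real r * exp (\<i> * of_real t)"
    proof -
      have "z powr of_real \<alpha> = exp (of_real \<alpha> * (of_real (ln (norm z)) + \<i> * of_real (Arg z)))"
        using z0 by (simp add: powr_def Ln_Arg)
      also have "\<dots> = exp (of_real (\<alpha> * ln (norm z))) * exp (\<i> * of_real t)"
        by (simp add: t_def ring_distribs exp_add mult_ac)
      also have "exp (of_real (\<alpha> * ln (norm z))) = complex_of_real r"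
        using z0 unfolding exp_of_real by (simp add: r_def powr_def)
      finally show ?thesis .
    qed
    have "\<bar>Arg z\<bar> < pi / 2" using z by (subst Arg_Re_pos) auto
    hence "\<bar>t\<bar> \<le> pi * \<alpha> / 2" using \<alpha> mult_left_mono[of "\<bar>Arg z\<bar>" "pi/2" \<alpha>] by (simp add: t_def
        abs_mult mult_ac)
    hence "cos (pi * \<alpha> / 2) \<le> cos \<bar>t\<bar>" using \<alpha> by (intro cos_monotone_0_pi_le) (auto simp:
        field_simps)
    hence ct: "\<kappa> \<le> cos t" by (simp add: \<kappa>_def)
    have "(norm (z powr of_real \<alpha> + 1))\<^sup>2 = (r * cos t + 1)\<^sup>2 + (r * sin t)\<^sup>2"
      unfolding zp by (simp add: cmod_power2 exp_eq_polar)
    also have "\<dots> = r\<^sup>2 + 2 * r * cos t + 1" using sin_cos_squared_add[of t] by algebra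
    also have "\<dots> \<ge> r\<^sup>2 + 2 * r * \<kappa> + 1" using ct r by (simp add: mult_left_mono)
    \<comment> \<open>A sum of two squares with coefficients that are nonnegative for -1 < \<kappa>
      <= 1; the first square is \<open>(d * (1 + r))\<^sup>2\<close>.\<close>
    also have "r\<^sup>2 + 2 * r * \<kappa> + 1 = (1 + \<kappa>) / 2 * (1 + r)\<^sup>2 + (1 - \<kappa>) / 2 * (r - 1)\<^sup>2"
      by (simp add: power2_eq_square field_simps)
    also have "\<dots> \<ge> (1 + \<kappa>) / 2 * (1 + r)\<^sup>2" using \<kappa> by simp
    finally have "(1 + \<kappa>) / 2 * (1 + r)\<^sup>2 \<le> (norm (z powr of_real \<alpha> + 1))\<^sup>2" by simp
    hence "(d * (1 + r))\<^sup>2 \<le> (norm (z powr of_real \<alpha> + 1))\<^sup>2" using \<kappa> by (simp add: d_def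
        power_mult_distrib)
    thus "d * (1 + norm z powr \<alpha>) \<le> norm (z powr of_real \<alpha> + 1)"
      unfolding r_def by (rule power2_le_imp_le) simp
  qed
qed

lemma one_plus_powr_le:
  fixes r :: real
  assumes r: "r \<ge> 0" and \<alpha>: "1 < \<alpha>" "\<alpha> < 2"
  shows "(1 + r) powr \<alpha> \<le> 4 * (1 + r powr \<alpha>)"
proof -
  have "(1 + r) powr \<alpha> \<le> (2 * max 1 r) powr \<alpha>" using r \<alpha> by (intro powr_mono2) auto
  also have "\<dots> = 2 powr \<alpha> * (max 1 r) powr \<alpha>" using r by (simp add: powr_mult)
  also have "\<dots> \<le> 2 powr 2 * (1 + r powr \<alpha>)"
    using \<alpha> r by (intro mult_mono powr_mono) (auto simp: max_def)
  finally show ?thesis by simp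
qed

text \<open>With \<zeta> = z^\<alpha>, the coefficients (-1)^m (m+1)^j for j = 0, 1, 2 have the
  transforms 1/(\<zeta>+1), \<zeta>/(\<zeta>+1)^2 and \<zeta>(\<zeta>-1)/(\<zeta>+1)^3. The
  denominator always has one degree more than the numerator, and
  \<open>norm_powr_plus_one_ge\<close> keeps \<zeta> away from the pole -1, so all three are O(1/(1
  + |\<zeta>|)).\<close>

lemma gser_quadratic_bounded:
  assumes \<alpha>: "1 < \<alpha>" "\<alpha> < 2"
  obtains B where "\<And>x. x > 0 \<Longrightarrow> \<bar>gser \<alpha> (\<lambda>m. (-1) ^ m * (c0 + c1 * (real m + 1) + c2 * (real m +
      1)\<^sup>2)) x\<bar> \<le> B"
proof -
  obtain d where d: "0 < d" "d \<le> 1" "\<And>z. Re z > 0 \<Longrightarrow> d * (1 + norm z powr \<alpha>) \<le> norm (z powr of_real \<alpha>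
      + 1)"
    using norm_powr_plus_one_ge[OF \<alpha>] by blast
  define a where "a = (\<lambda>m. (-1) ^ m * (c0 + c1 * (real m + 1) + c2 * (real m + 1)\<^sup>2))"
  define A where "A = \<bar>c0\<bar> + \<bar>c1\<bar> + \<bar>c2\<bar>"
  have a: "\<bar>a m\<bar> \<le> A * (real m + 1)\<^sup>2" for m
  proof -
    have 1: "1 \<le> (real m + 1)\<^sup>2" "real m + 1 \<le> (real m + 1)\<^sup>2" by (simp_all add: power2_eq_square
        algebra_simps)
    have "\<bar>a m\<bar> = \<bar>c0 + c1 * (real m + 1) + c2 * (real m + 1)\<^sup>2\<bar>" by (simp add: a_def abs_mult)
    also have "\<dots> \<le> \<bar>c0\<bar> * 1 + \<bar>c1\<bar> * (real m + 1) + \<bar>c2\<bar> * (real m + 1)\<^sup>2"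
      by (intro order_trans[OF abs_triangle_ineq] add_mono) (auto simp: abs_mult)
    also have "\<dots> \<le> \<bar>c0\<bar> * (real m + 1)\<^sup>2 + \<bar>c1\<bar> * (real m + 1)\<^sup>2 + \<bar>c2\<bar> * (real m + 1)\<^sup>2"
      using 1 by (intro add_mono mult_left_mono) auto
    finally show ?thesis by (simp add: A_def algebra_simps)
  qed
  define F where "F = (\<lambda>z. let \<zeta> = z powr of_real \<alpha> :: complex in
     of_real c0 * (1 / (\<zeta> + 1)) + of_real c1 * (\<zeta> / (\<zeta> + 1)\<^sup>2) + of_real c2 * (\<zeta> * (\<zeta> - 1) / (\<zeta> + 1)
         ^ 3))"
  have nz: "z powr of_real \<alpha> + 1 \<noteq> 0" if "Re z > 0" for z
  proof -
    have "0 < d * (1 + norm z powr \<alpha>)" using d(1) by (intro mult_pos_pos add_pos_nonneg) auto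
    thus ?thesis using d(3)[OF that] by auto
  qed
  have "\<bar>gser \<alpha> a x\<bar> \<le> (A * 4 / d ^ 3) / (2 * (\<alpha> - 1))" if x: "x > 0" for x
  proof (rule gser_bounded[OF \<alpha>(1) a])
    show "F holomorphic_on {z. Re z > 0}"
      unfolding F_def Let_def using nz
      by (intro holomorphic_intros) (auto simp: complex_nonpos_Reals_iff)
  next
    fix z :: complex assume z: "Re z > 0"
    define \<zeta> where "\<zeta> = z powr of_real \<alpha>"
    define R where "R = 1 + norm \<zeta>"
    have R: "R > 0" by (simp add: R_def add_pos_nonneg)
    have n\<zeta>: "norm \<zeta> = norm z powr \<alpha>" by (simp add: \<zeta>_def norm_powr_real_powr')
    define N where "N = norm (\<zeta> + 1)"
    have N: "d * R \<le> N" using d(3)[OF z] by (simp add: N_def R_def n\<zeta> \<zeta>_def[symmetric])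
    have dR: "d * R > 0" using d R by simp
    hence N0: "N > 0" using N by simp
    \<comment> \<open>As \<open>d \<le> 1\<close>, the weakest of the three bounds, the one with
      \<open>d ^ 3\<close>, serves for all.\<close>
    have dd: "d ^ 3 \<le> d" "d ^ 3 \<le> d ^ 2" using d power_decreasing[of 1 3 d] power_decreasing[of 2 3
        d] by auto
    have z1: "norm \<zeta> \<le> R" "norm (\<zeta> - 1) \<le> R" by (auto simp: R_def norm_triangle_ineq4[THEN
        order_trans])
    have f0: "norm (1 / (\<zeta> + 1)) \<le> 1 / (d ^ 3 * R)"
    proof -
      have "norm (1 / (\<zeta> + 1)) \<le> 1 / (d * R)" using N dR by (simp add: N_def norm_divide frac_le)
      also have "\<dots> \<le> 1 / (d ^ 3 * R)" using d R dd by (intro divide_left_mono mult_right_mono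
          mult_pos_pos) auto
      finally show ?thesis .
    qed
    have f1: "norm (\<zeta> / (\<zeta> + 1)\<^sup>2) \<le> 1 / (d ^ 3 * R)"
    proof -
      have "norm (\<zeta> / (\<zeta> + 1)\<^sup>2) \<le> R / (d * R)\<^sup>2"
        using N dR z1 R unfolding norm_divide norm_power N_def[symmetric] by (intro frac_le
            power_mono) auto
      also have "\<dots> = 1 / (d\<^sup>2 * R)" using R by (simp add: power2_eq_square)
      also have "\<dots> \<le> 1 / (d ^ 3 * R)" using d R dd by (intro divide_left_mono mult_right_mono
          mult_pos_pos) auto
      finally show ?thesis .
    qed
    have f2: "norm (\<zeta> * (\<zeta> - 1) / (\<zeta> + 1) ^ 3) \<le> 1 / (d ^ 3 * R)"
    proof -
      have "norm (\<zeta> * (\<zeta> - 1) / (\<zeta> + 1) ^ 3) \<le> (R * R) / (d * R) ^ 3"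
        using N dR z1 R unfolding norm_divide norm_power norm_mult N_def[symmetric] by (intro
            frac_le power_mono mult_mono) auto
      also have "\<dots> = 1 / (d ^ 3 * R)" using R by (simp add: power3_eq_cube)
      finally show ?thesis .
    qed
    have "norm (F z) \<le> \<bar>c0\<bar> * norm (1 / (\<zeta> + 1)) + \<bar>c1\<bar> * norm (\<zeta> / (\<zeta> + 1)\<^sup>2) + \<bar>c2\<bar> * norm (\<zeta> * (\<zeta>
        - 1) / (\<zeta> + 1) ^ 3)"
      unfolding F_def Let_def \<zeta>_def[symmetric]
      by (intro order_trans[OF norm_triangle_ineq] add_mono) (simp_all only: norm_mult norm_of_real
          order_refl)
    also have "\<dots> \<le> \<bar>c0\<bar> * (1 / (d ^ 3 * R)) + \<bar>c1\<bar> * (1 / (d ^ 3 * R)) + \<bar>c2\<bar> * (1 / (d ^ 3 * R))"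
      by (intro add_mono mult_left_mono f0 f1 f2) auto
    also have "\<dots> = A / d ^ 3 * (1 / R)" by (simp add: A_def algebra_simps add_divide_distrib)
    also have "\<dots> \<le> A / d ^ 3 * (4 * (1 + norm z) powr (-\<alpha>))"
    proof (rule mult_left_mono)
      have "(1 + norm z) powr \<alpha> \<le> 4 * R" using one_plus_powr_le[OF _ \<alpha>, of "norm z"] by (simp add:
          R_def n\<zeta>)
      moreover have "(1 + norm z) powr \<alpha> > 0" by (simp add: add_nonneg_eq_0_iff)
      ultimately show "1 / R \<le> 4 * (1 + norm z) powr (-\<alpha>)"
        using R by (simp add: powr_minus field_simps)
    qed (use d in \<open>auto simp: A_def\<close>)
    finally show "norm (F z) \<le> (A * 4 / d ^ 3) * (1 + norm z) powr (-\<alpha>)" by simp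
  next
    fix z :: complex assume z: "Re z > 2"
    define \<zeta> where "\<zeta> = z powr of_real \<alpha>"
    define w where "w = z powr (- of_real \<alpha>)"
    have z0: "z \<noteq> 0" using z by auto
    have w\<zeta>: "w = 1 / \<zeta>" using z0 by (simp add: w_def \<zeta>_def powr_minus field_simps)
    have \<zeta>0: "\<zeta> \<noteq> 0" using z0 by (simp add: \<zeta>_def)
    have \<zeta>1: "\<zeta> + 1 \<noteq> 0" using nz[of z] z by (simp add: \<zeta>_def)
    have "norm \<zeta> = norm z powr \<alpha>" by (simp add: \<zeta>_def norm_powr_real_powr')
    moreover have "norm z > 1" using z complex_Re_le_cmod[of z] by simp
    ultimately have "norm \<zeta> > 1" using \<alpha> by (simp add: less_powr_iff gr_one_powr)
    hence w1: "norm w < 1" by (simp add: w\<zeta> norm_divide divide_less_eq)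
    have pw: "z powr (- of_real (\<alpha> * (real m + 1))) = w ^ (m + 1)" for m
    proof -
      have "- of_real (\<alpha> * (real m + 1)) * Ln z = of_nat (m + 1) * (- of_real \<alpha> * Ln z)"
        by (simp add: algebra_simps)
      thus ?thesis using z0 unfolding w_def powr_def by (simp only: exp_of_nat_mult if_False)
    qed
    have "(\<lambda>m. of_real c0 * ((-1) ^ m * w ^ (m + 1)) + of_real c1 * ((-1) ^ m * (of_nat m + 1) * w ^
        (m + 1)) + of_real c2 * ((-1) ^ m * (of_nat m + 1)\<^sup>2 * w ^ (m + 1))) sums
       (of_real c0 * (w / (1 + w)) + of_real c1 * (w / (1 + w)\<^sup>2) + of_real c2 * (w * (1 - w) / (1 +
           w) ^ 3))"
      by (intro sums_add sums_mult sums_alternating_linear w1)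
    moreover have "w / (1 + w) = 1 / (\<zeta> + 1)" "w / (1 + w)\<^sup>2 = \<zeta> / (\<zeta> + 1)\<^sup>2" "w * (1 - w) / (1 + w)
        ^ 3 = \<zeta> * (\<zeta> - 1) / (\<zeta> + 1) ^ 3"
    proof -
      have q: "1 + w = (\<zeta> + 1) / \<zeta>" "1 - w = (\<zeta> - 1) / \<zeta>" using \<zeta>0 by (simp_all add: w\<zeta> field_simps)
      show "w / (1 + w) = 1 / (\<zeta> + 1)" "w / (1 + w)\<^sup>2 = \<zeta> / (\<zeta> + 1)\<^sup>2" "w * (1 - w) / (1 + w) ^ 3 =
          \<zeta> * (\<zeta> - 1) / (\<zeta> + 1) ^ 3"
        unfolding q using \<zeta>0 \<zeta>1 by (simp_all add: w\<zeta>) (simp_all add: power2_eq_square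
            power3_eq_cube)
    qed
    moreover have "of_real (a m) * w ^ (m + 1) = of_real c0 * ((-1) ^ m * w ^ (m + 1)) + of_real c1
        * ((-1) ^ m * (of_nat m + 1) * w ^ (m + 1)) + of_real c2 * ((-1) ^ m * (of_nat m + 1)\<^sup>2 * w
        ^ (m + 1))" for m
      by (simp add: a_def algebra_simps)
    ultimately show "(\<lambda>m. of_real (a m) * z powr (- of_real (\<alpha> * (real m + 1)))) sums F z"
      unfolding pw F_def Let_def \<zeta>_def[symmetric] by simp
  qed (fact x)
  thus ?thesis using that unfolding a_def by blast
qed

section \<open>The Mittag-Leffler function on the negative half-line\<close>

text \<open>\<open>mlf \<alpha> \<beta> z\<close> is the Mittag-Leffler function \<open>E\<^sub>\<alpha>\<^sub>,\<^sub>\<beta>(-z)\<close>.\<close>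

definition ml_coeff :: "real \<Rightarrow> real \<Rightarrow> nat \<Rightarrow> real" where
  "ml_coeff \<alpha> \<beta> m = (-1) ^ m * rGamma (\<alpha> * real m + \<beta>)"

definition mlf :: "real \<Rightarrow> real \<Rightarrow> real \<Rightarrow> real" where
  "mlf \<alpha> \<beta> z = (\<Sum>m. ml_coeff \<alpha> \<beta> m * z ^ m)"

definition mlf_deriv :: "real \<Rightarrow> real \<Rightarrow> real \<Rightarrow> real" where
  "mlf_deriv \<alpha> \<beta> z = (\<Sum>m. diffs (ml_coeff \<alpha> \<beta>) m * z ^ m)"

lemma summable_mlf:
  assumes \<alpha>: "1 < \<alpha>"
  shows "summable (\<lambda>m. ml_coeff \<alpha> \<beta> m * z ^ m)"
proof (rule powser_inside)
  define X where "X = \<bar>z\<bar> + 1"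
  \<comment> \<open>With \<open>X = t powr \<alpha>\<close>, the power \<open>X ^ m\<close> is a
    constant times \<open>t powr (s - 1)\<close> for \<open>s = \<alpha> * m + \<beta>\<close>, so
    \<open>powr_over_Gamma_le\<close> applies as soon as s >= 1.\<close>
  define t where "t = X powr (1 / \<alpha>)"
  have X: "X > 0" by (simp add: X_def)
  hence t: "t > 0" by (simp add: t_def)
  show "norm z < norm X" by (simp add: X_def)
  show "summable (\<lambda>m. ml_coeff \<alpha> \<beta> m * X ^ m)"
  proof (rule summable_comparison_test_ev)
    have "eventually (\<lambda>m. \<alpha> * real m + \<beta> \<ge> 1) sequentially" using \<alpha> by real_asymp
    thus "\<forall>\<^sub>F m in sequentially. norm (ml_coeff \<alpha> \<beta> m * X ^ m) \<le> t powr (1 - \<beta>) * (2 powr (1 - \<beta>) *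
        exp (2 * t + 1)) * (1/2) ^ m"
    proof eventually_elim
      case (elim m)
      define s where "s = \<alpha> * real m + \<beta>"
      have s: "s \<ge> 1" using elim by (simp add: s_def)
      have "X ^ m = t powr (\<alpha> * real m)" using X \<alpha> by (simp add: t_def powr_powr powr_realpow)
      also have "\<dots> = t powr (1 - \<beta>) * t powr (s - 1)" by (simp add: s_def flip: powr_add)
      finally have Xm: "X ^ m = t powr (1 - \<beta>) * t powr (s - 1)" .
      have "norm (ml_coeff \<alpha> \<beta> m * X ^ m) = t powr (1 - \<beta>) * (t powr (s - 1) / Gamma s)"
        using s X unfolding Xm by (simp add: ml_coeff_def abs_mult rGamma_inverse_Gamma
            s_def[symmetric] Gamma_real_nonneg divide_inverse)
      also have "\<dots> \<le> t powr (1 - \<beta>) * (2 powr (1 - s) * exp (2 * t + 1))"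
        using s t by (intro mult_left_mono powr_over_Gamma_le) auto
      also have "\<dots> \<le> t powr (1 - \<beta>) * ((2 powr (1 - \<beta>) * (1/2) ^ m) * exp (2 * t + 1))"
      proof (intro mult_left_mono mult_right_mono)
        have "2 powr (1 - s) \<le> 2 powr ((1 - \<beta>) + - real m)" using \<alpha> mult_right_mono[of 1 \<alpha> "real m"]
          by (intro powr_mono) (auto simp: s_def)
        also have "\<dots> = 2 powr (1 - \<beta>) * (1/2) ^ m"
          by (simp only: powr_add) (simp add: powr_minus powr_realpow power_divide field_simps)
        finally show "2 powr (1 - s) \<le> 2 powr (1 - \<beta>) * (1/2) ^ m" .
      qed auto
      finally show ?case by (simp add: mult_ac)
    qed
    show "summable (\<lambda>m. t powr (1 - \<beta>) * (2 powr (1 - \<beta>) * exp (2 * t + 1)) * (1/2) ^ m)"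
      by (intro summable_mult) (simp add: summable_geometric)
  qed
qed

lemma mlf_sums:
  assumes "1 < \<alpha>" shows "(\<lambda>m. ml_coeff \<alpha> \<beta> m * z ^ m) sums mlf \<alpha> \<beta> z"
  unfolding mlf_def using summable_mlf[OF assms] by (rule summable_sums)

lemma mlf_0: "mlf \<alpha> \<beta> 0 = rGamma \<beta>"
  by (simp add: mlf_def ml_coeff_def)

lemma mlf_has_derivative:
  assumes "1 < \<alpha>" shows "(mlf \<alpha> \<beta> has_real_derivative mlf_deriv \<alpha> \<beta> z) (at z)"
  unfolding mlf_def[abs_def] mlf_deriv_def
  using summable_mlf[OF assms] by (rule termdiffs_strong_converges_everywhere)

lemma continuous_on_mlf [continuous_intros]:
  assumes "1 < \<alpha>" shows "continuous_on S (mlf \<alpha> \<beta>)"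
  using mlf_has_derivative[OF assms] by (meson DERIV_isCont continuous_at_imp_continuous_on)

lemma continuous_on_mlf_deriv:
  assumes \<alpha>: "1 < \<alpha>" shows "continuous_on S (mlf_deriv \<alpha> \<beta>)"
proof (rule continuous_at_imp_continuous_on, rule ballI)
  fix z :: real
  have "summable (\<lambda>m. diffs (ml_coeff \<alpha> \<beta>) m * z ^ m)" for z
    by (rule termdiff_converges_all) (rule summable_mlf[OF \<alpha>])
  thus "isCont (mlf_deriv \<alpha> \<beta>) z"
    unfolding mlf_deriv_def[abs_def] by (rule DERIV_isCont[OF
        termdiffs_strong_converges_everywhere])
qed

text \<open>Coefficientwise this is \<open>rGamma (s - 1) = (s - 1) * rGamma s\<close> at
  \<open>s = \<alpha> * m + \<beta>\<close>, since \<open>z\<close> times the derivative multiplies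
  the m-th coefficient by m. With the entire function \<open>rGamma\<close> it also holds at the
  poles of Gamma.\<close>

lemma mlf_deriv_eq:
  assumes \<alpha>: "1 < \<alpha>"
  shows "\<alpha> * z * mlf_deriv \<alpha> \<beta> z = mlf \<alpha> (\<beta> - 1) z - (\<beta> - 1) * mlf \<alpha> \<beta> z"
proof -
  have "summable (\<lambda>m. diffs (ml_coeff \<alpha> \<beta>) m * z ^ m)"
    by (rule termdiff_converges_all) (rule summable_mlf[OF \<alpha>])
  from diffs_equiv[OF this]
  have "(\<lambda>m. (\<alpha> * z) * (real m * ml_coeff \<alpha> \<beta> m * z ^ (m - Suc 0))) sums (\<alpha> * z * mlf_deriv \<alpha> \<beta> z)"
    unfolding mlf_deriv_def by (rule sums_mult)
  moreover have "(\<lambda>m. ml_coeff \<alpha> (\<beta> - 1) m * z ^ m - (\<beta> - 1) * (ml_coeff \<alpha> \<beta> m * z ^ m)) sums (mlf \<alpha>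
      (\<beta> - 1) z - (\<beta> - 1) * mlf \<alpha> \<beta> z)"
    by (intro sums_diff sums_mult mlf_sums \<alpha>)
  moreover have "(\<alpha> * z) * (real m * ml_coeff \<alpha> \<beta> m * z ^ (m - Suc 0)) = ml_coeff \<alpha> (\<beta> - 1) m * z ^
      m - (\<beta> - 1) * (ml_coeff \<alpha> \<beta> m * z ^ m)" for m
  proof -
    have "rGamma (\<alpha> * real m + (\<beta> - 1)) = (\<alpha> * real m + (\<beta> - 1)) * rGamma (\<alpha> * real m + \<beta>)"
      using rGamma_plus1[of "\<alpha> * real m + (\<beta> - 1)"] by (simp add: algebra_simps)
    hence c: "ml_coeff \<alpha> (\<beta> - 1) m = (\<alpha> * real m + (\<beta> - 1)) * ml_coeff \<alpha> \<beta> m"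
      by (simp add: ml_coeff_def)
    show ?thesis unfolding c by (cases m) (simp_all add: algebra_simps)
  qed
  ultimately show ?thesis by (simp add: sums_iff)
qed

lemma mlf_shift:
  assumes \<alpha>: "1 < \<alpha>"
  shows "mlf \<alpha> \<beta> z = rGamma \<beta> - z * mlf \<alpha> (\<beta> + \<alpha>) z"
proof -
  have "mlf \<alpha> \<beta> z = ml_coeff \<alpha> \<beta> 0 * z ^ 0 + (\<Sum>m. ml_coeff \<alpha> \<beta> (Suc m) * z ^ Suc m)"
    unfolding mlf_def using suminf_split_head[OF summable_mlf[OF \<alpha>, of \<beta> z]] by simp
  also have "(\<lambda>m. ml_coeff \<alpha> \<beta> (Suc m) * z ^ Suc m) = (\<lambda>m. - z * (ml_coeff \<alpha> (\<beta> + \<alpha>) m * z ^ m))"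
    by (simp add: ml_coeff_def algebra_simps)
  also have "suminf \<dots> = - z * mlf \<alpha> (\<beta> + \<alpha>) z"
    unfolding mlf_def by (rule suminf_mult) (rule summable_mlf[OF \<alpha>])
  finally show ?thesis by (simp add: ml_coeff_def)
qed

text \<open>Each term \<open>x powr (s - 1) * rGamma s\<close> has the derivative
  \<open>x powr (s - 2) * rGamma (s - 1)\<close>. The fractional integral in
  \<open>RL_integral_mlf\<close> raises the second index by 2 - \<alpha>, two derivatives lower it
  by 2, and \<open>mlf_shift\<close> makes up for the difference \<alpha>: this is how the scalar
  equation arises.\<close>

lemma powr_mlf_has_derivative:
  assumes \<alpha>: "1 < \<alpha>" and x: "x > 0"
  shows "((\<lambda>x. x powr (\<beta> - 1) * mlf \<alpha> \<beta> (l * x powr \<alpha>)) has_real_derivative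
           x powr (\<beta> - 2) * mlf \<alpha> (\<beta> - 1) (l * x powr \<alpha>)) (at x within S)"
proof -
  define z where "z = l * x powr \<alpha>"
  have "((\<lambda>x. mlf \<alpha> \<beta> (l * x powr \<alpha>)) has_real_derivative mlf_deriv \<alpha> \<beta> z * (l * (\<alpha> * x powr (\<alpha> -
      1)))) (at x within S)"
    unfolding z_def using x
    by (intro DERIV_chain2[OF mlf_has_derivative[OF \<alpha>]] DERIV_cmult
        has_field_derivative_at_within[OF has_real_derivative_powr]) auto
  moreover have "((\<lambda>x. x powr (\<beta> - 1)) has_real_derivative (\<beta> - 1) * x powr (\<beta> - 1 - 1)) (at x
      within S)"
    using x by (intro has_field_derivative_at_within[OF has_real_derivative_powr])
  ultimately have "((\<lambda>x. x powr (\<beta> - 1) * mlf \<alpha> \<beta> (l * x powr \<alpha>)) has_real_derivative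
     ((\<beta> - 1) * x powr (\<beta> - 1 - 1)) * mlf \<alpha> \<beta> z + mlf_deriv \<alpha> \<beta> z * (l * (\<alpha> * x powr (\<alpha> - 1))) * x
         powr (\<beta> - 1)) (at x within S)"
    unfolding z_def by (rule DERIV_mult[rotated])
  moreover have "((\<beta> - 1) * x powr (\<beta> - 1 - 1)) * mlf \<alpha> \<beta> z + mlf_deriv \<alpha> \<beta> z * (l * (\<alpha> * x powr (\<alpha>
      - 1))) * x powr (\<beta> - 1) = x powr (\<beta> - 2) * mlf \<alpha> (\<beta> - 1) z"
  proof -
    have "x powr (\<alpha> - 1) * x powr (\<beta> - 1) = x powr (\<beta> - 2) * x powr \<alpha>"
      by (simp flip: powr_add add: algebra_simps)
    hence "mlf_deriv \<alpha> \<beta> z * (l * (\<alpha> * x powr (\<alpha> - 1))) * x powr (\<beta> - 1) = x powr (\<beta> - 2) * (\<alpha> * z *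
        mlf_deriv \<alpha> \<beta> z)"
      by (simp add: z_def mult_ac)
    thus ?thesis unfolding mlf_deriv_eq[OF \<alpha>] by (simp add: algebra_simps)
  qed
  ultimately show ?thesis by (simp add: z_def)
qed

text \<open>\<open>rGamma (s - j)\<close> is a polynomial of degree \<open>j\<close> in
  \<open>s\<close> times \<open>rGamma s\<close>, so x^(\<alpha>-1) times the function at z =
  x^\<alpha> is a \<open>gser\<close> with quadratic coefficients. Boundedness of that series is
  decay in \<open>z\<close>.\<close>

lemma mlf_decay:
  assumes \<alpha>: "1 < \<alpha>" "\<alpha> < 2" and j: "j \<le> (2::nat)"
  obtains B where "\<And>z. z > 0 \<Longrightarrow> \<bar>mlf \<alpha> (\<alpha> - real j) z\<bar> \<le> B * z powr (- ((\<alpha> - 1) / \<alpha>))"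
proof -
  define P where "P = (\<lambda>(c0, c1, c2) s. c0 + c1 * s + c2 * s\<^sup>2 :: real)"
  have "\<exists>c. \<forall>s. rGamma (s - real j) = P c s * rGamma s"
  proof -
    have r1: "rGamma (s - 1) = (s - 1) * rGamma s" for s :: real using rGamma_plus1[of "s - 1"] by
        simp
    have r2: "rGamma (s - 2) = (2 - 3 * s + s\<^sup>2) * rGamma s" for s :: real
      using r1[of "s - 1"] unfolding r1[of s] by (simp add: algebra_simps power2_eq_square)
    have "j = 0 \<or> j = 1 \<or> j = 2" using j by auto
    thus ?thesis
    proof (elim disjE)
      assume "j = 0" thus ?thesis by (intro exI[of _ "(1,0,0)"]) (simp add: P_def)
    next
      assume "j = 1" thus ?thesis by (intro exI[of _ "(-1,1,0)"]) (simp add: P_def r1)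
    next
      assume "j = 2" thus ?thesis by (intro exI[of _ "(2,-3,1)"]) (simp add: P_def r2)
    qed
  qed
  then obtain c0 c1 c2 where c: "\<And>s. rGamma (s - real j) = (c0 + c1 * s + c2 * s\<^sup>2) * rGamma s"
    by (auto simp: P_def)
  define a where "a = (\<lambda>m. (-1) ^ m * (c0 + (c1 * \<alpha>) * (real m + 1) + (c2 * \<alpha>\<^sup>2) * (real m + 1)\<^sup>2))"
  obtain B where B: "\<And>x. x > 0 \<Longrightarrow> \<bar>gser \<alpha> a x\<bar> \<le> B"
    unfolding a_def by (rule gser_quadratic_bounded[OF \<alpha>, where ?c0.0 = c0 and ?c1.0 = "c1 * \<alpha>" and
        ?c2.0 = "c2 * \<alpha>\<^sup>2"]) blast
  have "\<bar>mlf \<alpha> (\<alpha> - real j) z\<bar> \<le> B * z powr (- ((\<alpha> - 1) / \<alpha>))" if z: "z > 0" for z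
  proof -
    define x where "x = z powr (1 / \<alpha>)"
    have x: "x > 0" using z by (simp add: x_def)
    have zx: "z = x powr \<alpha>" using \<alpha> z by (simp add: x_def powr_powr)
    have "gser \<alpha> a x = x powr (\<alpha> - 1) * mlf \<alpha> (\<alpha> - real j) z"
    proof -
      have eq: "a m * (x powr (\<alpha> * (real m + 1) - 1) / Gamma (\<alpha> * (real m + 1))) = x powr (\<alpha> - 1) *
          (ml_coeff \<alpha> (\<alpha> - real j) m * z ^ m)" for m
      proof -
        define s where "s = \<alpha> * (real m + 1)"
        have "ml_coeff \<alpha> (\<alpha> - real j) m = (-1) ^ m * rGamma (s - real j)" by (simp add: ml_coeff_def
            s_def algebra_simps)
        also have "\<dots> = (-1) ^ m * ((c0 + c1 * s + c2 * s\<^sup>2) * rGamma s)" by (simp add: c)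
        also have "\<dots> = a m / Gamma s" by (simp add: a_def s_def rGamma_inverse_Gamma divide_inverse
            power_mult_distrib mult_ac)
        finally have m: "ml_coeff \<alpha> (\<alpha> - real j) m = a m / Gamma s" .
        have "z ^ m = x powr (\<alpha> * real m)" using x by (simp add: zx powr_powr flip: powr_realpow)
        hence "x powr (\<alpha> - 1) * z ^ m = x powr (s - 1)" by (simp add: s_def algebra_simps flip:
            powr_add)
        thus ?thesis unfolding m s_def by (simp add: mult_ac)
      qed
      show ?thesis unfolding gser_def eq mlf_def by (rule suminf_mult) (rule summable_mlf[OF \<alpha>(1)])
    qed
    hence "x powr (\<alpha> - 1) * \<bar>mlf \<alpha> (\<alpha> - real j) z\<bar> \<le> B" using B[OF x] by (simp add: abs_mult)
    moreover have "x powr (\<alpha> - 1) = z powr ((\<alpha> - 1) / \<alpha>)" by (simp add: x_def powr_powr)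
    ultimately show ?thesis using z by (simp add: powr_minus field_simps)
  qed
  thus ?thesis using that by blast
qed

lemma mlf_bounded:
  assumes \<alpha>: "1 < \<alpha>" "\<alpha> < 2" and j: "j \<le> (2::nat)"
  obtains B where "\<And>z. z \<ge> 0 \<Longrightarrow> \<bar>mlf \<alpha> (\<alpha> - real j) z\<bar> \<le> B"
proof -
  obtain B where B: "\<And>z. z > 0 \<Longrightarrow> \<bar>mlf \<alpha> (\<alpha> - real j) z\<bar> \<le> B * z powr (- ((\<alpha> - 1) / \<alpha>))"
    using mlf_decay[OF \<alpha> j] by blast
  have "compact (mlf \<alpha> (\<alpha> - real j) ` {0..1})"
    by (intro compact_continuous_image continuous_on_mlf \<alpha>) auto
  then obtain B' where "\<forall>y\<in>mlf \<alpha> (\<alpha> - real j) ` {0..1}. norm y \<le> B'"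
    using compact_imp_bounded bounded_iff by metis
  hence B': "\<And>z. z \<in> {0..1} \<Longrightarrow> \<bar>mlf \<alpha> (\<alpha> - real j) z\<bar> \<le> B'" by auto
  have "\<bar>mlf \<alpha> (\<alpha> - real j) z\<bar> \<le> max B B'" if "z \<ge> 0" for z
  proof (cases "z \<le> 1")
    case True thus ?thesis using B'[of z] that by simp
  next
    case False
    have "B \<ge> 0" using order_trans[OF abs_ge_zero B[of 1]] by simp
    hence "B * z powr (- ((\<alpha> - 1) / \<alpha>)) \<le> B * z powr 0" using False \<alpha>
      by (intro mult_left_mono powr_mono) auto
    thus ?thesis using B[of z] False by simp
  qed
  thus ?thesis using that by blast
qed

lemma mlf_tendsto_0:
  assumes \<alpha>: "1 < \<alpha>" "\<alpha> < 2" and j: "j \<le> (2::nat)"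
  shows "(mlf \<alpha> (\<alpha> - real j) \<longlongrightarrow> 0) at_top"
proof -
  obtain B where B: "\<And>z. z > 0 \<Longrightarrow> \<bar>mlf \<alpha> (\<alpha> - real j) z\<bar> \<le> B * z powr (- ((\<alpha> - 1) / \<alpha>))"
    using mlf_decay[OF \<alpha> j] by blast
  show ?thesis
  proof (rule Lim_null_comparison)
    show "\<forall>\<^sub>F z in at_top. norm (mlf \<alpha> (\<alpha> - real j) z) \<le> B * z powr (- ((\<alpha> - 1) / \<alpha>))"
      using eventually_gt_at_top[of 0] by eventually_elim (use B in auto)
    have "(\<alpha> - 1) / \<alpha> > 0" using \<alpha> by simp
    thus "((\<lambda>z. B * z powr (- ((\<alpha> - 1) / \<alpha>))) \<longlongrightarrow> 0) at_top"
      by (intro tendsto_mult_right_zero tendsto_neg_powr filterlim_ident) auto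
  qed
qed

text \<open>The indices 1 and 2 are not of the form \<alpha> - j, so decay is replaced by growth
  estimates. In the variable x = z^(1/\<alpha>) the function of index 1 has a bounded derivative and
  is the derivative of x times the function of index 2. The resulting linear growth in x is weak
  enough for \<open>joint_continuous_growth\<close>.\<close>

lemma mlf_one_two_growth:
  assumes \<alpha>: "1 < \<alpha>" "\<alpha> < 2"
  obtains B where "\<And>z. z \<ge> 0 \<Longrightarrow> \<bar>mlf \<alpha> 1 z\<bar> \<le> B * (1 + z powr (1 / \<alpha>))"
    "\<And>z. z \<ge> 0 \<Longrightarrow> \<bar>mlf \<alpha> 2 z\<bar> \<le> B * (1 + z powr (1 / \<alpha>))"
proof -
  obtain B where B: "\<And>z. z > 0 \<Longrightarrow> \<bar>mlf \<alpha> (\<alpha> - real 0) z\<bar> \<le> B * z powr (- ((\<alpha> - 1) / \<alpha>))"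
    using mlf_decay[OF \<alpha>, of 0] by auto
  have B0: "B \<ge> 0" using order_trans[OF abs_ge_zero B[of 1]] by simp
  have r0: "rGamma 0 = (0::real)" "rGamma 1 = (1::real)" "rGamma 2 = (1::real)"
    using rGamma_plus1[of "1::real"] by simp_all
  have d1: "((\<lambda>x. mlf \<alpha> 1 (x powr \<alpha>)) has_real_derivative - (x powr (\<alpha> - 1) * mlf \<alpha> \<alpha> (x powr \<alpha>)))
      (at x)" if x: "x > 0" for x
  proof -
    have "((\<lambda>x. x powr (1 - 1) * mlf \<alpha> 1 (1 * x powr \<alpha>)) has_real_derivative x powr (1 - 2) * mlf \<alpha>
        (1 - 1) (1 * x powr \<alpha>)) (at x)"
      by (rule powr_mlf_has_derivative[OF \<alpha>(1) x])
    \<comment> \<open>The derivative has index 0; \<open>mlf_shift\<close> raises it to \<alpha>,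
      and the constant term vanishes because \<open>rGamma 0 = 0\<close>.\<close>
    moreover have "x powr (1 - 2) * mlf \<alpha> (1 - 1) (1 * x powr \<alpha>) = - (x powr (\<alpha> - 1) * mlf \<alpha> \<alpha> (x
        powr \<alpha>))"
      using mlf_shift[OF \<alpha>(1), of 0 "x powr \<alpha>"] x by (simp add: r0 powr_diff powr_minus field_simps)
    ultimately have "((\<lambda>x. x powr (1 - 1) * mlf \<alpha> 1 (1 * x powr \<alpha>)) has_real_derivative - (x powr (\<alpha>
        - 1) * mlf \<alpha> \<alpha> (x powr \<alpha>))) (at x)" by simp
    thus ?thesis
      by (rule has_field_derivative_transform_within_open[of _ _ _ "{0<..}"]) (use x in auto)
  qed
  have d2: "((\<lambda>x. x * mlf \<alpha> 2 (x powr \<alpha>)) has_real_derivative mlf \<alpha> 1 (x powr \<alpha>)) (at x)" if x: "x >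
      0" for x
  proof -
    have "((\<lambda>x. x powr (2 - 1) * mlf \<alpha> 2 (1 * x powr \<alpha>)) has_real_derivative x powr (2 - 2) * mlf \<alpha>
        (2 - 1) (1 * x powr \<alpha>)) (at x)"
      by (rule powr_mlf_has_derivative[OF \<alpha>(1) x])
    hence "((\<lambda>x. x powr (2 - 1) * mlf \<alpha> 2 (1 * x powr \<alpha>)) has_real_derivative mlf \<alpha> 1 (x powr \<alpha>))
        (at x)" using x by simp
    thus ?thesis
      by (rule has_field_derivative_transform_within_open[of _ _ _ "{0<..}"]) (use x in auto)
  qed
  have cont: "continuous_on {0..x} (\<lambda>x. mlf \<alpha> \<beta> (x powr \<alpha>))" for \<beta> x
    using \<alpha> by (intro continuous_on_compose2[OF continuous_on_mlf[where S=UNIV]] continuous_on_powr'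
        continuous_intros) auto
  have b1: "\<bar>mlf \<alpha> 1 (x powr \<alpha>) - 1\<bar> \<le> B * x" if x: "x > 0" for x
  proof -
    obtain z where z: "0 < z" "z < x"
      "mlf \<alpha> 1 (x powr \<alpha>) - mlf \<alpha> 1 (0 powr \<alpha>) = - (z powr (\<alpha> - 1) * mlf \<alpha> \<alpha> (z powr \<alpha>)) * (x - 0)"
      by (rule mvt[OF x cont has_field_derivative_imp_has_derivative[OF d1]]) auto
    define l where "l = - (z powr (\<alpha> - 1) * mlf \<alpha> \<alpha> (z powr \<alpha>))"
    have l: "mlf \<alpha> 1 (x powr \<alpha>) - mlf \<alpha> 1 (0 powr \<alpha>) = l * x" using z by (simp add: l_def)
    note l_def
    moreover have "\<bar>z powr (\<alpha> - 1) * mlf \<alpha> \<alpha> (z powr \<alpha>)\<bar> \<le> z powr (\<alpha> - 1) * (B * (z powr \<alpha>) powr (-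
        ((\<alpha> - 1) / \<alpha>)))"
      using B[of "z powr \<alpha>"] z by (auto simp: abs_mult intro!: mult_left_mono)
    moreover have "z powr (\<alpha> - 1) * (B * (z powr \<alpha>) powr (- ((\<alpha> - 1) / \<alpha>))) = B"
      using \<alpha> z by (simp add: powr_powr flip: powr_add)
    ultimately have "\<bar>l\<bar> \<le> B" by simp
    thus ?thesis using l x by (simp add: mlf_0 r0 abs_mult mult_right_mono)
  qed
  have b2: "\<bar>x * mlf \<alpha> 2 (x powr \<alpha>)\<bar> \<le> x * (1 + B * x)" if x: "x > 0" for x
  proof -
    have c: "continuous_on {0..x} (\<lambda>x. x * mlf \<alpha> 2 (x powr \<alpha>))" by (intro continuous_intros cont)
    obtain z where z: "0 < z" "z < x"
      "x * mlf \<alpha> 2 (x powr \<alpha>) - 0 * mlf \<alpha> 2 (0 powr \<alpha>) = mlf \<alpha> 1 (z powr \<alpha>) * (x - 0)"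
      by (rule mvt[OF x c has_field_derivative_imp_has_derivative[OF d2]]) auto
    have "\<bar>mlf \<alpha> 1 (z powr \<alpha>)\<bar> \<le> 1 + B * z" using b1[OF z(1)] by linarith
    moreover have "B * z \<le> B * x" using z B0 by (intro mult_left_mono) auto
    ultimately have "\<bar>mlf \<alpha> 1 (z powr \<alpha>)\<bar> \<le> 1 + B * x" by simp
    moreover have "\<bar>x * mlf \<alpha> 2 (x powr \<alpha>)\<bar> = x * \<bar>mlf \<alpha> 1 (z powr \<alpha>)\<bar>" using z x by (simp add:
        abs_mult)
    ultimately show ?thesis using x by (simp add: mult_left_mono)
  qed
  have zz: "\<bar>mlf \<alpha> 1 z\<bar> \<le> (1 + B) * (1 + z powr (1 / \<alpha>)) \<and> \<bar>mlf \<alpha> 2 z\<bar> \<le> (1 + B) * (1 + z powr (1 /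
      \<alpha>))" if "z \<ge> 0" for z
  proof (cases "z = 0")
    case True thus ?thesis using B0 by (simp add: mlf_0 r0)
  next
    case False
    define x where "x = z powr (1 / \<alpha>)"
    have x: "x > 0" "z = x powr \<alpha>" using False that \<alpha> by (auto simp: x_def powr_powr)
    have "1 + B * x \<le> (1 + B) * (1 + x)" using B0 x by (simp add: algebra_simps)
    moreover have "\<bar>mlf \<alpha> 1 z\<bar> \<le> 1 + B * x" using b1[OF x(1)] x by simp
    moreover have "\<bar>mlf \<alpha> 2 z\<bar> \<le> 1 + B * x" using b2[OF x(1)] x by (simp add: abs_mult)
    ultimately show ?thesis unfolding x_def[symmetric] by linarith
  qed
  show ?thesis by (rule that[of "1 + B"]) (use zz in auto)
qed

section \<open>Riemann-Liouville integrals of Mittag-Leffler functions\<close>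

lemma Beta_integral_scaled:
  fixes a b x :: real
  assumes ab: "a > 0" "b > 0" and x: "x > 0"
  shows "has_bochner_integral lborel (\<lambda>t. indicator {0<..<x} t *\<^sub>R (t powr (a - 1) * (x - t) powr (b
      - 1)))
           (x powr (a + b - 1) * Beta a b)"
proof -
  define f where "f = (\<lambda>u::real. indicator {0<..<1} u *\<^sub>R (u powr (a - 1) * (1 - u) powr (b - 1)))"
  have [measurable]: "f \<in> borel_measurable borel" unfolding f_def by measurable
  have "((\<lambda>u. u powr (a - 1) * (1 - u) powr (b - 1)) has_integral Beta a b) {0<..<1}"
    using has_integral_Beta_real[OF ab] by (simp add: has_integral_Icc_iff_Ioo)
  moreover have "f = (\<lambda>u. if u \<in> {0<..<1} then u powr (a - 1) * (1 - u) powr (b - 1) else 0)"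
    by (auto simp: f_def)
  ultimately have fint: "(f has_integral Beta a b) UNIV"
    by (simp only: has_integral_restrict_UNIV)
  have "has_bochner_integral lborel f (Beta a b)"
  proof -
    have "(\<integral>\<^sup>+x. ennreal (f x) \<partial>lborel) = ennreal (Beta a b)"
      using nn_integral_has_integral_lborel[OF _ _ fint] by (auto simp: f_def)
    moreover have "Beta a b \<ge> 0" using ab by (simp add: Beta_def Gamma_real_nonneg)
    ultimately show ?thesis by (intro has_bochner_integral_nn_integral) (auto simp: f_def)
  qed
  hence "has_bochner_integral lborel (\<lambda>t. f (0 + inverse x * t)) (Beta a b /\<^sub>R \<bar>inverse x\<bar>)"
    using x lborel_has_bochner_integral_real_affine_iff[of "inverse x" f "Beta a b" 0] by simp
  hence "has_bochner_integral lborel (\<lambda>t. x powr (a + b - 2) * f (inverse x * t)) (x powr (a + b -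
      2) * (Beta a b * x))"
    using x by (intro has_bochner_integral_mult_right) (simp_all add: mult.commute)
  moreover have "x powr (a + b - 2) * (Beta a b * x) = x powr (a + b - 1) * Beta a b"
    using x by (simp add: powr_diff power2_eq_square field_simps)
  moreover have "x powr (a + b - 2) * f (inverse x * t) = indicator {0<..<x} t *\<^sub>R (t powr (a - 1) *
      (x - t) powr (b - 1))" for t
  proof (cases "t \<in> {0<..<x}")
    case True
    have "1 - inverse x * t = inverse x * (x - t)" using x by (simp add: field_simps)
    hence "(inverse x * t) powr (a - 1) * (1 - inverse x * t) powr (b - 1) = (inverse x powr (a - 1)
        * inverse x powr (b - 1)) * (t powr (a - 1) * (x - t) powr (b - 1))"
      using True x by (simp add: powr_mult)
    also have "inverse x powr (a - 1) * inverse x powr (b - 1) = inverse (x powr (a + b - 2))"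
    proof -
      have "x powr (a - 1) * x powr (b - 1) = x powr (a + b - 2)" by (simp add: algebra_simps flip:
          powr_add)
      thus ?thesis using x by (metis inverse_mult_distrib inverse_powr less_imp_le)
    qed
    finally show ?thesis using True x by (simp add: f_def field_simps)
  next
    case False
    hence "inverse x * t \<notin> {0<..<1}" using x by (auto simp: field_simps zero_less_mult_iff)
    thus ?thesis using False by (simp add: f_def)
  qed
  ultimately show ?thesis by simp
qed

lemma RL_kernel_powr_integrable:
  fixes \<alpha> \<beta> x :: real
  assumes \<alpha>: "1 < \<alpha>" "\<alpha> < 2" and b: "\<beta> > 0" and x: "x > 0"
  shows "integrable lborel (\<lambda>t. indicator {0<..<x} t *\<^sub>R (t powr (\<beta> - 1) / (x - t) powr (\<alpha> - 1)))"
proof -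
  have "integrable lborel (\<lambda>t. indicator {0<..<x} t *\<^sub>R (t powr (\<beta> - 1) * (x - t) powr ((2 - \<alpha>) -
      1)))"
    using Beta_integral_scaled[of \<beta> "2 - \<alpha>" x] b x \<alpha> by (simp add: has_bochner_integral_iff)
  moreover have "indicator {0<..<x} t *\<^sub>R (t powr (\<beta> - 1) * (x - t) powr ((2 - \<alpha>) - 1)) = indicator
      {0<..<x} t *\<^sub>R (t powr (\<beta> - 1) / (x - t) powr (\<alpha> - 1))" for t
    using powr_minus_divide[of "x - t" "\<alpha> - 1"] by (simp add: indicator_def)
  ultimately show ?thesis by simp
qed

text \<open>The Beta integral of each term turns \<open>rGamma a\<close> into
  \<open>Gamma (2 - \<alpha>) * rGamma (a + (2 - \<alpha>))\<close>. The factor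
  \<open>Gamma (2 - \<alpha>)\<close> stays because \<open>RL_integral\<close> carries no
  normalisation.\<close>

lemma RL_integral_mlf:
  assumes \<alpha>: "1 < \<alpha>" "\<alpha> < 2" and b: "\<beta> > 0" and x: "x > 0"
  shows "RL_integral \<alpha> (\<lambda>t. t powr (\<beta> - 1) * mlf \<alpha> \<beta> (l * t powr \<alpha>)) x
       = Gamma (2 - \<alpha>) * (x powr (\<beta> + 1 - \<alpha>) * mlf \<alpha> (\<beta> + 2 - \<alpha>) (l * x powr \<alpha>))"
proof -
  define K where "K = (\<lambda>t. indicator {0<..<x} t *\<^sub>R (t powr (\<beta> - 1) / (x - t) powr (\<alpha> - 1)))"
  define s where "s = (\<lambda>N t. K t * (\<Sum>m<N. ml_coeff \<alpha> \<beta> m * (l * t powr \<alpha>) ^ m))"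
  define f where "f = (\<lambda>t. K t * mlf \<alpha> \<beta> (l * t powr \<alpha>))"
  define z where "z = l * x powr \<alpha>"
  have [measurable]: "K \<in> borel_measurable borel" unfolding K_def by measurable
  have Kint: "integrable lborel K" unfolding K_def by (rule RL_kernel_powr_integrable[OF \<alpha> b x])
  have single: "has_bochner_integral lborel (\<lambda>t. K t * (ml_coeff \<alpha> \<beta> m * (l * t powr \<alpha>) ^ m))
       (Gamma (2 - \<alpha>) * x powr (\<beta> + 1 - \<alpha>) * (ml_coeff \<alpha> (\<beta> + 2 - \<alpha>) m * z ^ m))" for m
  proof -
    define a where "a = \<alpha> * real m + \<beta>"
    have a: "a > 0" using \<alpha> b by (simp add: a_def add_nonneg_pos)
    have "has_bochner_integral lborel (\<lambda>t. (ml_coeff \<alpha> \<beta> m * l ^ m) * (indicator {0<..<x} t *\<^sub>R (t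
        powr (a - 1) * (x - t) powr ((2 - \<alpha>) - 1))))
       ((ml_coeff \<alpha> \<beta> m * l ^ m) * (x powr (a + (2 - \<alpha>) - 1) * Beta a (2 - \<alpha>)))"
      using \<alpha> by (intro has_bochner_integral_mult_right Beta_integral_scaled a x) auto
    moreover have "(ml_coeff \<alpha> \<beta> m * l ^ m) * (indicator {0<..<x} t *\<^sub>R (t powr (a - 1) * (x - t)
        powr ((2 - \<alpha>) - 1))) = K t * (ml_coeff \<alpha> \<beta> m * (l * t powr \<alpha>) ^ m)" for t
    proof (cases "t \<in> {0<..<x}")
      case True
      have "(t powr \<alpha>) ^ m = t powr (\<alpha> * real m)" using True by (simp add: powr_powr flip:
          powr_realpow)
      hence "t powr (a - 1) = t powr (\<beta> - 1) * (t powr \<alpha>) ^ m" by (simp add: a_def algebra_simps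
          flip: powr_add)
      moreover have "(x - t) powr ((2 - \<alpha>) - 1) = 1 / (x - t) powr (\<alpha> - 1)" using
          powr_minus_divide[of "x - t" "\<alpha> - 1"] by simp
      ultimately show ?thesis using True by (simp add: K_def power_mult_distrib mult_ac)
    qed (simp add: K_def)
    moreover have "(ml_coeff \<alpha> \<beta> m * l ^ m) * (x powr (a + (2 - \<alpha>) - 1) * Beta a (2 - \<alpha>)) = Gamma (2
        - \<alpha>) * x powr (\<beta> + 1 - \<alpha>) * (ml_coeff \<alpha> (\<beta> + 2 - \<alpha>) m * z ^ m)"
    proof -
      have "(x powr \<alpha>) ^ m = x powr (\<alpha> * real m)" using x by (simp add: powr_powr flip:
          powr_realpow)
      hence "x powr (a + (2 - \<alpha>) - 1) = x powr (\<beta> + 1 - \<alpha>) * (x powr \<alpha>) ^ m" by (simp add: a_def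
          algebra_simps flip: powr_add)
      moreover have "rGamma a * Beta a (2 - \<alpha>) = Gamma (2 - \<alpha>) * rGamma (a + (2 - \<alpha>))"
        using Gamma_real_pos[OF a] by (simp add: Beta_def rGamma_inverse_Gamma field_simps)
      moreover have "rGamma (a + (2 - \<alpha>)) = rGamma (\<alpha> * real m + (\<beta> + 2 - \<alpha>))" by (simp add: a_def
          algebra_simps)
      ultimately show ?thesis by (simp add: ml_coeff_def z_def power_mult_distrib a_def[symmetric])
    qed
    ultimately show ?thesis by (simp only:)
  qed
  have hs: "has_bochner_integral lborel (s N) (\<Sum>m<N. Gamma (2 - \<alpha>) * x powr (\<beta> + 1 - \<alpha>) * (ml_coeff
      \<alpha> (\<beta> + 2 - \<alpha>) m * z ^ m))" for N
    unfolding s_def sum_distrib_left by (intro has_bochner_integral_sum single)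
  \<comment> \<open>A common bound of all partial sums for t < x: absolute convergence at the
    largest argument.\<close>
  define C where "C = (\<Sum>m. norm (ml_coeff \<alpha> \<beta> m * (\<bar>l\<bar> * x powr \<alpha>) ^ m))"
  have summ: "summable (\<lambda>m. norm (ml_coeff \<alpha> \<beta> m * (\<bar>l\<bar> * x powr \<alpha>) ^ m))"
    by (rule powser_insidea[OF summable_mlf[OF \<alpha>(1), where z = "\<bar>l\<bar> * x powr \<alpha> + 1"]]) simp
  have "(\<lambda>N. integral\<^sup>L lborel (s N)) \<longlonglongrightarrow> integral\<^sup>L lborel f"
  proof (rule integral_dominated_convergence[where w = "\<lambda>t. C * \<bar>K t\<bar>"])
    show "integrable lborel (\<lambda>t. C * \<bar>K t\<bar>)" using Kint by simp
    show lim: "AE t in lborel. (\<lambda>N. s N t) \<longlonglongrightarrow> f t"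
      unfolding s_def f_def using mlf_sums[OF \<alpha>(1)] by (intro AE_I2 tendsto_intros) (simp add:
          sums_def)
    show "s N \<in> borel_measurable lborel" for N unfolding s_def by measurable
    show "f \<in> borel_measurable lborel"
    proof -
      have [measurable]: "mlf \<alpha> \<beta> \<in> borel_measurable borel" by (intro
          borel_measurable_continuous_onI continuous_on_mlf \<alpha>)
      show ?thesis unfolding f_def by measurable
    qed
    show "AE t in lborel. norm (s N t) \<le> C * \<bar>K t\<bar>" for N
    proof (rule AE_I2)
      fix t :: real
      show "norm (s N t) \<le> C * \<bar>K t\<bar>"
      proof (cases "t \<in> {0<..<x}")
        case True
        have "\<bar>\<Sum>m<N. ml_coeff \<alpha> \<beta> m * (l * t powr \<alpha>) ^ m\<bar> \<le> (\<Sum>m<N. norm (ml_coeff \<alpha> \<beta> m * (\<bar>l\<bar> * x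
            powr \<alpha>) ^ m))"
        proof (rule order_trans[OF sum_abs sum_mono])
          fix m
          have "\<bar>l * t powr \<alpha>\<bar> \<le> \<bar>\<bar>l\<bar> * x powr \<alpha>\<bar>"
            using True \<alpha> by (auto simp: abs_mult intro!: mult_left_mono powr_mono2)
          thus "\<bar>ml_coeff \<alpha> \<beta> m * (l * t powr \<alpha>) ^ m\<bar> \<le> norm (ml_coeff \<alpha> \<beta> m * (\<bar>l\<bar> * x powr \<alpha>) ^
              m)"
            by (auto simp: abs_mult power_abs intro!: mult_left_mono power_mono)
        qed
        also have "\<dots> \<le> C" unfolding C_def by (rule sum_le_suminf[OF summ]) auto
        finally have "\<bar>K t\<bar> * \<bar>\<Sum>m<N. ml_coeff \<alpha> \<beta> m * (l * t powr \<alpha>) ^ m\<bar> \<le> \<bar>K t\<bar> * C"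
          by (rule mult_left_mono) simp
        thus ?thesis by (simp add: s_def abs_mult mult.commute)
      qed (simp add: s_def K_def)
    qed
  qed
  moreover have "(\<lambda>N. integral\<^sup>L lborel (s N)) \<longlonglongrightarrow> Gamma (2 - \<alpha>) * x powr (\<beta> + 1 - \<alpha>) * mlf \<alpha> (\<beta> + 2 -
      \<alpha>) z"
    using sums_mult[OF mlf_sums[OF \<alpha>(1)]] unfolding sums_def has_bochner_integral_integral_eq[OF hs]
        .
  ultimately have "integral\<^sup>L lborel f = Gamma (2 - \<alpha>) * x powr (\<beta> + 1 - \<alpha>) * mlf \<alpha> (\<beta> + 2 - \<alpha>) z"
    by (rule LIMSEQ_unique)
  moreover have "f = (\<lambda>t. indicator {0<..<x} t *\<^sub>R RL_kernel \<alpha> (\<lambda>t. t powr (\<beta> - 1) * mlf \<alpha> \<beta> (l * t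
      powr \<alpha>)) x t)"
    by (auto simp: f_def K_def RL_kernel_def)
  ultimately show ?thesis by (simp add: RL_integral_def set_lebesgue_integral_def z_def)
qed

section \<open>Functional calculus for positive contractions\<close>

text \<open>The forms in question, \<open>ip (bern_op N i f) g\<close> among them, may vanish on
  nonzero vectors. If \<open>b g g = 0\<close>, then
  \<open>b (f + c *\<^sub>R g) (f + c *\<^sub>R g)\<close> is affine in \<open>c\<close>, and
  nonnegativity forces \<open>b f g = 0\<close>.\<close>

lemma semidefinite_Cauchy_Schwarz:
  fixes b :: "'a::real_vector \<Rightarrow> 'a \<Rightarrow> real"
  assumes add: "\<And>f g h. b (f + g) h = b f h + b g h" and sc: "\<And>c f h. b (c *\<^sub>R f) h = c * b f h"
    and sym: "\<And>f g. b f g = b g f" and pos: "\<And>f. b f f \<ge> 0"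
  shows "\<bar>b f g\<bar> \<le> sqrt (b f f) * sqrt (b g g)"
proof -
  have add2: "b h (f + g) = b h f + b h g" and sc2: "b h (c *\<^sub>R f) = c * b h f" for f g h c using
      add sc sym by metis+
  have exp: "b f f + 2 * c * b f g + c\<^sup>2 * b g g \<ge> 0" for c
    using pos[of "f + c *\<^sub>R g"] sym[of g f] by (simp add: add sc add2 sc2 power2_eq_square
        algebra_simps)
  have "(b f g)\<^sup>2 \<le> b f f * b g g"
  proof (cases "b g g = 0")
    case True
    have "b f g = 0"
    proof (rule ccontr)
      assume n: "b f g \<noteq> 0"
      have "b f f + 2 * (- (b f f + 1) / (2 * b f g)) * b f g \<ge> 0" using exp[of "- (b f f + 1) / (2
          * b f g)"] True by simp
      thus False using n by (simp add: field_simps)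
    qed
    thus ?thesis by (simp add: True)
  next
    case False
    hence g: "b g g > 0" using pos[of g] by simp
    have "b f f + 2 * (- b f g / b g g) * b f g + (- b f g / b g g)\<^sup>2 * b g g \<ge> 0" by (rule exp)
    hence "b f f - (b f g)\<^sup>2 / b g g \<ge> 0" using g by (simp add: power2_eq_square field_simps)
    thus ?thesis using g by (simp add: field_simps)
  qed
  hence "sqrt ((b f g)\<^sup>2) \<le> sqrt (b f f * b g g)" by (rule real_sqrt_le_mono)
  thus ?thesis by (simp add: real_sqrt_mult)
qed

text \<open>This is the Gram--Schmidt process. Vectors of length zero do no harm, since the
  division by their squared length gives zero.\<close>

lemma projection_exists:
  fixes b :: "'a::real_vector \<Rightarrow> 'a \<Rightarrow> real" and p :: "nat \<Rightarrow> 'a"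
  assumes add: "\<And>f g h. b (f + g) h = b f h + b g h" and sc: "\<And>c f h. b (c *\<^sub>R f) h = c * b f h"
    and sym: "\<And>f g. b f g = b g f" and pos: "\<And>f. b f f \<ge> 0"
  shows "\<exists>d. \<forall>g. \<forall>j<n. b (g - (\<Sum>i<n. b g (d i) *\<^sub>R p i)) (p j) = 0"
proof (induction n)
  case (Suc n)
  then obtain d where d: "\<And>g j. j < n \<Longrightarrow> b (g - (\<Sum>i<n. b g (d i) *\<^sub>R p i)) (p j) = 0" by blast
  have add2: "b h (f + g) = b h f + b h g" and sc2: "b h (c *\<^sub>R f) = c * b h f" for f g h c using
      add sc sym by metis+
  have z: "b 0 h = 0" "b h 0 = 0" for h using sc[of 0 0 h] sc2[of h 0 0] by simp_all
  have diff: "b (f - g) h = b f h - b g h" and diff2: "b h (f - g) = b h f - b h g" for f g h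
    using add[of "f - g" g h] add2[of h "f - g" g] by simp_all
  have sm2: "b h (\<Sum>i\<in>I. F i) = (\<Sum>i\<in>I. b h (F i))" for h F and I :: "nat set"
    by (induction I rule: infinite_finite_induct) (simp_all add: add2 z)
  define pr where "pr = (\<lambda>g. \<Sum>i<n. b g (d i) *\<^sub>R p i)"
  define r where "r = p n - pr (p n)"
  \<comment> \<open>\<open>r\<close> is the part of \<open>p n\<close> orthogonal to the earlier
    vectors. The component of \<open>g\<close> along \<open>r\<close> is written with
    \<open>r = p n - pr (p n)\<close>, so \<open>p n\<close> gets the coefficient
    \<open>b g r / b r r\<close> and the earlier coefficients are corrected.\<close>
  define d' where "d' = (\<lambda>i. if i = n then (1 / b r r) *\<^sub>R r else d i - (b (p n) (d i) / b r r) *\<^sub>R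
      r)"
  have rj: "b r (p j) = 0" if "j < n" for j using d[OF that, of "p n"] by (simp add: r_def pr_def)
  \<comment> \<open>If \<open>b r r = 0\<close>, then \<open>b g r = 0\<close> by
    Cauchy-Schwarz.\<close>
  have brr: "b g r / b r r * b r r = b g r" for g
    using semidefinite_Cauchy_Schwarz[of b g r, OF add sc sym pos] by (cases "b r r = 0") simp_all
  have e: "(\<Sum>i<Suc n. b g (d' i) *\<^sub>R p i) = pr g + (b g r / b r r) *\<^sub>R r" for g
  proof -
    define c where "c = b g r / b r r"
    have "(\<Sum>i<n. b g (d' i) *\<^sub>R p i) = pr g - c *\<^sub>R pr (p n)"
      by (simp add: c_def d'_def pr_def diff2 sc2 scaleR_left_diff_distrib sum_subtractf
          scaleR_sum_right mult.commute)
    moreover have "b g (d' n) = c" by (simp add: d'_def sc2 c_def)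
    ultimately show ?thesis unfolding c_def[symmetric] by (simp add: r_def
        scaleR_right_diff_distrib)
  qed
  have j: "b (g - (pr g + (b g r / b r r) *\<^sub>R r)) (p j) = 0" if "j < n" for g j
    using d[OF that, of g] rj[OF that] by (simp add: diff add sc pr_def)
  have jn: "b (g - (pr g + (b g r / b r r) *\<^sub>R r)) (p n) = 0" for g
  proof -
    let ?v = "g - (pr g + (b g r / b r r) *\<^sub>R r)"
    have "b ?v (pr (p n)) = 0" by (subst pr_def) (simp add: sm2 sc2 j)
    moreover have "b r (pr g) = 0" by (subst pr_def) (simp add: sm2 sc2 rj)
    hence "b ?v r = 0" using brr[of g] by (simp add: diff add sc sym[of "pr g" r])
    moreover have "p n = r + pr (p n)" by (simp add: r_def)
    ultimately show ?thesis by (metis add2 add_0)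
  qed
  show ?case using e j jn by (intro exI[of _ d']) (auto simp: less_Suc_eq)
qed simp

text \<open>The form \<open>ip\<close> may be degenerate, so that \<open>nrm\<close> below is only a seminorm.\<close>

locale positive_contraction =
  fixes ip :: "'v::real_vector \<Rightarrow> 'v \<Rightarrow> real" and T :: "'v \<Rightarrow> 'v"
  assumes ip_add: "ip (f + g) h = ip f h + ip g h"
    and ip_scale: "ip (c *\<^sub>R f) h = c * ip f h"
    and ip_sym: "ip f g = ip g f"
    and ip_pos: "ip f f \<ge> 0"
    and linear_T: "linear T"
    and T_sym: "ip (T f) g = ip f (T g)"
    and T_pos: "ip (T f) f \<ge> 0"
    and T_le: "ip (T f) f \<le> ip f f"
begin

definition nrm :: "'v \<Rightarrow> real" where "nrm f = sqrt (ip f f)"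

definition Q :: "'v \<Rightarrow> 'v" where "Q f = f - T f"

definition bern_op :: "nat \<Rightarrow> nat \<Rightarrow> 'v \<Rightarrow> 'v" where
  "bern_op N i f = real (N choose i) *\<^sub>R (T ^^ i) ((Q ^^ (N - i)) f)"

definition bern :: "nat \<Rightarrow> (real \<Rightarrow> real) \<Rightarrow> 'v \<Rightarrow> 'v" where
  "bern N q f = (\<Sum>i\<le>N. q (real i / real N) *\<^sub>R bern_op N i f)"

lemma ip_add2: "ip h (f + g) = ip h f + ip h g" using ip_add ip_sym by metis
lemma ip_scale2: "ip h (c *\<^sub>R f) = c * ip h f" using ip_scale ip_sym by metis
lemma ip_0 [simp]: "ip 0 f = 0" "ip f 0 = 0" using ip_scale[of 0 0 f] ip_scale2[of f 0 0] by auto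
lemma ip_diff: "ip (f - g) h = ip f h - ip g h" using ip_add[of "f - g" g h] by simp
lemma ip_diff2: "ip h (f - g) = ip h f - ip h g" using ip_diff ip_sym by metis
lemma ip_sum: "ip (\<Sum>i\<in>I. F i) h = (\<Sum>i\<in>I. ip (F i) h)"
  by (induction I rule: infinite_finite_induct) (auto simp: ip_add)

lemmas T_lin = linear_add[OF linear_T] linear_diff[OF linear_T] linear_scale[OF linear_T]
    linear_sum[OF linear_T] linear_0[OF linear_T]

lemma linear_Q: "linear Q"
  by (rule linearI) (simp_all add: Q_def T_lin algebra_simps)

lemma Q_sym: "ip (Q f) g = ip f (Q g)" by (simp add: Q_def ip_diff ip_diff2 T_sym)
lemma Q_pos: "ip (Q f) f \<ge> 0" using T_le[of f] by (simp add: Q_def ip_diff)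
lemma TQ: "T (Q f) = Q (T f)" by (simp add: Q_def T_lin)

lemma linear_pow: "linear S \<Longrightarrow> linear (S ^^ n)" for S :: "'v \<Rightarrow> 'v"
  by (induction n) (simp_all add: linear_id[unfolded id_def] id_def linear_compose)

lemma linear_bern_op: "linear (bern_op N i)"
proof -
  have "linear ((T ^^ i) \<circ> (Q ^^ (N - i)))" by (intro linear_compose linear_pow linear_T linear_Q)
  thus ?thesis unfolding bern_op_def by (intro linear_compose_scale_right) (simp add: o_def)
qed

lemma T_Qpow: "T ((Q ^^ n) f) = (Q ^^ n) (T f)"
  by (induction n) (simp_all add: TQ)
lemma Tpow_Qpow: "(T ^^ i) ((Q ^^ n) f) = (Q ^^ n) ((T ^^ i) f)"
  by (induction i) (simp_all add: T_Qpow)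

lemma Tpow_Q: "(T ^^ i) (Q f) = Q ((T ^^ i) f)"
  using Tpow_Qpow[of i 1 f] by simp

lemma pow_sym: "ip ((S ^^ n) f) g = ip f ((S ^^ n) g)" if "\<And>f g. ip (S f) g = ip f (S g)"
  by (induction n arbitrary: f g) (simp_all add: that funpow_swap1)

text \<open>By symmetry an even power is shared between the two arguments. What remains is the form
  of the identity, \<open>T\<close>, \<open>Q\<close> or \<open>T\<close> after \<open>Q\<close> at
  one vector, according to the parities of \<open>i\<close> and \<open>j\<close>; only the last is
  not immediate from the assumptions.\<close>

lemma mono_pos: "ip ((T ^^ i) ((Q ^^ j) f)) f \<ge> 0"
proof -
  have T2: "ip ((T ^^ (2 * n)) f) g = ip ((T ^^ n) f) ((T ^^ n) g)" for n f g
    by (simp add: mult_2 funpow_add pow_sym[OF T_sym])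
  have Q2: "ip ((Q ^^ (2 * n)) f) g = ip ((Q ^^ n) f) ((Q ^^ n) g)" for n f g
    by (simp add: mult_2 funpow_add pow_sym[OF Q_sym])
  have key: "ip ((T ^^ (2 * a)) ((Q ^^ (2 * b)) (S f))) f = ip (S h) h"
    if S: "\<And>f. S (T f) = T (S f)" "\<And>f. S (Q f) = Q (S f)" and h: "h = (T ^^ a) ((Q ^^ b) f)" for S a
        b h
  proof -
    have ST: "S ((T ^^ n) f) = (T ^^ n) (S f)" for n f by (induction n) (simp_all add: S)
    have SQ: "S ((Q ^^ n) f) = (Q ^^ n) (S f)" for n f by (induction n) (simp_all add: S)
    have "ip ((T ^^ (2 * a)) ((Q ^^ (2 * b)) (S f))) f = ip ((T ^^ a) ((Q ^^ (2 * b)) (S f))) ((T ^^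
        a) f)"
      by (rule T2)
    also have "\<dots> = ip ((Q ^^ (2 * b)) ((T ^^ a) (S f))) ((T ^^ a) f)" by (simp add: Tpow_Qpow)
    also have "\<dots> = ip ((Q ^^ b) ((T ^^ a) (S f))) ((Q ^^ b) ((T ^^ a) f))" by (rule Q2)
    also have "\<dots> = ip (S h) h" by (simp add: h ST SQ Tpow_Qpow)
    finally show ?thesis .
  qed
  obtain a b where "(i = 2 * a \<or> i = 2 * a + 1) \<and> (j = 2 * b \<or> j = 2 * b + 1)"
    by (metis oddE evenE)
  then consider "i = 2 * a" "j = 2 * b" | "i = 2 * a + 1" "j = 2 * b" | "i = 2 * a" "j = 2 * b + 1"
      | "i = 2 * a + 1" "j = 2 * b + 1"
    by blast
  thus ?thesis
  proof cases
    case 1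
    have "ip ((T ^^ i) ((Q ^^ j) f)) f = ip ((T ^^ a) ((Q ^^ b) f)) ((T ^^ a) ((Q ^^ b) f))"
      using key[of "\<lambda>f. f" _ a b] 1 by simp
    thus ?thesis using ip_pos by simp
  next
    case 2
    have "(T ^^ i) ((Q ^^ j) f) = (T ^^ (2*a)) ((Q ^^ (2*b)) (T f))" by (simp add: 2
        T_Qpow[symmetric] funpow_swap1)
    thus ?thesis using key[of T _ a b] T_pos by (simp add: TQ)
  next
    case 3
    have "(T ^^ i) ((Q ^^ j) f) = (T ^^ (2*a)) ((Q ^^ (2*b)) (Q f))" by (simp add: 3 funpow_swap1)
    thus ?thesis using key[of Q _ a b] Q_pos by (simp add: TQ)
  next
    case 4
    have e: "(T ^^ i) ((Q ^^ j) f) = (T ^^ (2*a)) ((Q ^^ (2*b)) (T (Q f)))"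
      by (simp add: 4 T_Qpow[symmetric] funpow_swap1)
    have "ip (T (Q h)) h \<ge> 0" for h
    proof -
      \<comment> \<open>\<open>t (1 - t) = t (1 - t)\<^sup>2 + (1 - t) t\<^sup>2\<close>\<close>
      have "T (Q h) = T (Q (Q h)) + Q (T (T h))" by (simp add: Q_def T_lin algebra_simps)
      hence "ip (T (Q h)) h = ip (T (Q (Q h))) h + ip (Q (T (T h))) h" by (simp add: ip_add)
      also have "ip (T (Q (Q h))) h = ip (T (Q h)) (Q h)" by (simp add: TQ Q_sym)
      also have "ip (Q (T (T h))) h = ip (Q (T h)) (T h)" by (simp add: TQ[symmetric] T_sym)
      finally show ?thesis using T_pos[of "Q h"] Q_pos[of "T h"] by simp
    qed
    thus ?thesis unfolding e using key[of "\<lambda>f. T (Q f)" _ a b] by (simp add: TQ)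
  qed
qed

lemma bern_op_pos: "ip (bern_op N i f) f \<ge> 0"
  by (simp add: bern_op_def ip_scale mono_pos)

lemma bern_op_sym: "ip (bern_op N i f) g = ip f (bern_op N i g)"
  by (simp add: bern_op_def ip_scale ip_scale2 pow_sym[OF T_sym] pow_sym[OF Q_sym] Tpow_Qpow)

text \<open>The binomial theorem for the commuting operators \<open>T\<close> and \<open>Q\<close>,
  whose sum is the identity; the induction step is Pascal's rule.\<close>

lemma sum_bern_op: "(\<Sum>i\<le>N. bern_op N i f) = f"
proof (induction N arbitrary: f)
  case 0
  show ?case by (simp add: bern_op_def)
next
  case (Suc N)
  have T: "T (bern_op N i f) = real (N choose i) *\<^sub>R (T ^^ Suc i) ((Q ^^ (Suc N - Suc i)) f)" for i
    by (simp add: bern_op_def T_lin)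
  have Q: "Q (bern_op N i f) = real (N choose i) *\<^sub>R (T ^^ i) ((Q ^^ (Suc N - i)) f)" if "i \<le> N" for
      i
    using that by (simp add: bern_op_def linear_scale[OF linear_Q] Suc_diff_le Tpow_Q)
  have "f = T f + Q f" by (simp add: Q_def)
  also have "T f = (\<Sum>i\<le>N. T (bern_op N i f))" by (subst Suc.IH[of f, symmetric]) (simp add: T_lin)
  also have "Q f = (\<Sum>i\<le>N. Q (bern_op N i f))" by (subst Suc.IH[of f, symmetric]) (simp add:
      linear_sum[OF linear_Q])
  also have "(\<Sum>i\<le>N. T (bern_op N i f)) = (\<Sum>i\<le>Suc N. if i = 0 then 0 else real (N choose (i - 1)) *\<^sub>R
      (T ^^ i) ((Q ^^ (Suc N - i)) f))"
    by (subst sum.atMost_Suc_shift) (simp add: T)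
  also have "(\<Sum>i\<le>N. Q (bern_op N i f)) = (\<Sum>i\<le>Suc N. real (N choose i) *\<^sub>R (T ^^ i) ((Q ^^ (Suc N -
      i)) f))"
    by (simp add: Q)
  also have "(\<Sum>i\<le>Suc N. if i = 0 then 0 else real (N choose (i - 1)) *\<^sub>R (T ^^ i) ((Q ^^ (Suc N -
      i)) f)) + \<dots> = (\<Sum>i\<le>Suc N. bern_op (Suc N) i f)"
    unfolding sum.distrib[symmetric]
    by (intro sum.cong refl) (auto simp: bern_op_def gr0_conv_Suc algebra_simps not0_implies_Suc
        choose_reduce_nat)
  finally show ?case by simp
qed

section \<open>Norm bounds and convergence of Bernstein sums\<close>

lemma nrm_nonneg [simp]: "nrm f \<ge> 0" by (simp add: nrm_def ip_pos)
lemma nrm_sq: "(nrm f)\<^sup>2 = ip f f" by (simp add: nrm_def ip_pos)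

lemma ip_bound: "\<bar>ip f g\<bar> \<le> nrm f * nrm g"
  unfolding nrm_def by (rule semidefinite_Cauchy_Schwarz) (simp_all add: ip_add ip_scale ip_add2
      ip_scale2 ip_sym ip_pos)

lemma nrm_triangle: "nrm (f + g) \<le> nrm f + nrm g"
proof -
  have "(nrm (f + g))\<^sup>2 = (nrm f)\<^sup>2 + 2 * ip f g + (nrm g)\<^sup>2" by (simp add: nrm_sq ip_add ip_add2
      ip_sym[of g f])
  also have "\<dots> \<le> (nrm f + nrm g)\<^sup>2" using ip_bound[of f g] by (simp add: power2_sum)
  finally show ?thesis by (rule power2_le_imp_le) simp
qed

lemma nrm_scale: "nrm (c *\<^sub>R f) = \<bar>c\<bar> * nrm f"
  by (simp add: nrm_def ip_scale ip_scale2 real_sqrt_mult flip: mult.assoc power2_eq_square)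

lemma nrm_minus: "nrm (- f) = nrm f" using nrm_scale[of "-1" f] by simp
lemma nrm_diff: "nrm (f - g) \<le> nrm f + nrm g" using nrm_triangle[of f "- g"] by (simp add:
    nrm_minus)
text \<open>Let \<open>g\<close> be the sum and expand \<open>ip g g\<close>. Cauchy-Schwarz for
  each positive form \<open>ip (bern_op N i f) g\<close>, then for the sum over \<open>i\<close>,
  leaves \<open>M * nrm f * nrm g\<close>, because the numbers \<open>ip (bern_op N i h) h\<close>
  add up to \<open>ip h h\<close>.\<close>

lemma weighted_bern_bound:
  assumes \<theta>: "\<And>i. i \<le> N \<Longrightarrow> \<bar>\<theta> i\<bar> \<le> M"
  shows "nrm (\<Sum>i\<le>N. \<theta> i *\<^sub>R bern_op N i f) \<le> M * nrm f"
proof -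
  define g where "g = (\<Sum>i\<le>N. \<theta> i *\<^sub>R bern_op N i f)"
  have M: "M \<ge> 0" using \<theta>[of 0] by simp
  have tot: "(\<Sum>i\<le>N. ip (bern_op N i h) h) = ip h h" for h
    by (simp add: ip_sum[symmetric] sum_bern_op)
  have L2: "L2_set (\<lambda>i. sqrt (ip (bern_op N i h) h)) {..N} = nrm h" for h
    by (simp add: L2_set_def bern_op_pos tot nrm_def)
  have pt: "\<bar>\<theta> i * ip (bern_op N i f) g\<bar> \<le> M * (sqrt (ip (bern_op N i f) f) * sqrt (ip (bern_op N i
      g) g))" if "i \<le> N" for i
  proof -
    have "\<bar>ip (bern_op N i f) g\<bar> \<le> sqrt (ip (bern_op N i f) f) * sqrt (ip (bern_op N i g) g)"
      by (rule semidefinite_Cauchy_Schwarz[of "\<lambda>f g. ip (bern_op N i f) g"])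
         (simp_all add: linear_add[OF linear_bern_op] linear_scale[OF linear_bern_op] ip_add
             ip_scale bern_op_pos,
          metis bern_op_sym ip_sym)
    thus ?thesis unfolding abs_mult using \<theta>[OF that] M by (intro mult_mono) auto
  qed
  have "ip g g = (\<Sum>i\<le>N. \<theta> i * ip (bern_op N i f) g)"
    by (subst g_def) (simp add: ip_sum ip_scale)
  also have "\<dots> \<le> (\<Sum>i\<le>N. M * (sqrt (ip (bern_op N i f) f) * sqrt (ip (bern_op N i g) g)))"
    by (intro sum_mono order_trans[OF abs_ge_self pt]) auto
  also have "\<dots> = M * (\<Sum>i\<le>N. sqrt (ip (bern_op N i f) f) * sqrt (ip (bern_op N i g) g))"
    by (simp add: sum_distrib_left)
  also have "\<dots> \<le> M * (L2_set (\<lambda>i. sqrt (ip (bern_op N i f) f)) {..N} * L2_set (\<lambda>i. sqrt (ip (bern_op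
      N i g) g)) {..N})"
  proof (rule mult_left_mono[OF _ M])
    have "(\<Sum>i\<le>N. sqrt (ip (bern_op N i f) f) * sqrt (ip (bern_op N i g) g)) = (\<Sum>i\<le>N. \<bar>sqrt (ip
        (bern_op N i f) f)\<bar> * \<bar>sqrt (ip (bern_op N i g) g)\<bar>)"
      by (intro sum.cong refl) (simp add: bern_op_pos)
    also have "\<dots> \<le> L2_set (\<lambda>i. sqrt (ip (bern_op N i f) f)) {..N} * L2_set (\<lambda>i. sqrt (ip (bern_op N
        i g) g)) {..N}"
      by (rule L2_set_mult_ineq)
    finally show "(\<Sum>i\<le>N. sqrt (ip (bern_op N i f) f) * sqrt (ip (bern_op N i g) g)) \<le> \<dots>" .
  qed
  finally have "(nrm g)\<^sup>2 \<le> M * (nrm f * nrm g)" by (simp add: nrm_sq L2)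
  hence "nrm g * nrm g \<le> (M * nrm f) * nrm g" by (simp add: power2_eq_square mult_ac)
  hence "nrm g \<le> M * nrm f"
    using M by (cases "nrm g = 0") (auto simp: mult_le_cancel_right nrm_nonneg[of g] less_le)
  thus ?thesis by (simp add: g_def)
qed

lemma bern_bound:
  assumes "\<And>t. t \<in> {0..1} \<Longrightarrow> \<bar>q t\<bar> \<le> M"
  shows "nrm (bern N q f) \<le> M * nrm f"
  unfolding bern_def by (rule weighted_bern_bound) (rule assms, auto simp: divide_simps)

text \<open>\<open>T\<close> is the Bernstein sum of degree one with the weights 0 and 1.\<close>

lemma nrm_T: "nrm (T f) \<le> nrm f"
proof -
  have "T f = (\<Sum>i\<le>1. (if i = 0 then 0 else 1) *\<^sub>R bern_op 1 i f)" by (simp add: bern_op_def)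
  thus ?thesis using weighted_bern_bound[of 1 "\<lambda>i. if i = 0 then 0 else 1" 1 f] by simp
qed

lemma bern_add: "bern N (\<lambda>t. p t + q t) f = bern N p f + bern N q f"
  by (simp add: bern_def scaleR_left_distrib sum.distrib)
lemma bern_cmult: "bern N (\<lambda>t. c * q t) f = c *\<^sub>R bern N q f"
  by (simp add: bern_def scaleR_sum_right)
lemma bern_diff: "bern N (\<lambda>t. p t - q t) f = bern N p f - bern N q f"
  using bern_add[of N p "\<lambda>t. -1 * q t" f] unfolding bern_cmult by simp

lemma T_bern_op: "T (bern_op N i f) = ((real i + 1) / (real N + 1)) *\<^sub>R bern_op (Suc N) (Suc i) f"
proof -
  have "(real i + 1) * real (Suc N choose Suc i) = (real N + 1) * real (N choose i)"
    using arg_cong[OF Suc_times_binomial[of i N], of real]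
    by (simp only: of_nat_mult of_nat_Suc) (simp only: add.commute)
  hence "((real i + 1) / (real N + 1)) * real (Suc N choose Suc i) = real (N choose i)"
    by (simp add: divide_simps del: binomial_Suc_Suc)
  thus ?thesis by (simp add: bern_op_def T_lin del: binomial_Suc_Suc)
qed

text \<open>By \<open>T_bern_op\<close>, applying \<open>T\<close> raises the degree by one, with
  \<open>q\<close> sampled at (i-1)/N instead of i/(N+1). These nodes differ by at most 1/(N+1), so
  uniform continuity and \<open>weighted_bern_bound\<close> suffice. In the limit, multiplying the
  symbol by t amounts to applying \<open>T\<close>.\<close>

lemma bern_shift:
  assumes q: "continuous_on {0..1} q"
  shows "(\<lambda>N. nrm (bern (Suc N) (\<lambda>t. t * q t) f - T (bern N q f))) \<longlonglongrightarrow> 0"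
proof (rule LIMSEQ_I)
  fix e :: real assume e: "e > 0"
  define \<epsilon> where "\<epsilon> = e / (nrm f + 1) / 2"
  have n0: "nrm f + 1 > 0" by (simp add: add_nonneg_pos)
  have \<epsilon>: "\<epsilon> > 0" using e n0 by (simp add: \<epsilon>_def)
  have "uniformly_continuous_on {0..1} q" using q by (intro compact_uniformly_continuous) auto
  then obtain d where d: "d > 0" "\<And>s t. s \<in> {0..1} \<Longrightarrow> t \<in> {0..1} \<Longrightarrow> \<bar>s - t\<bar> < d \<Longrightarrow> \<bar>q s - q t\<bar> < \<epsilon>"
    using \<epsilon> unfolding uniformly_continuous_on_def dist_real_def by metis
  obtain M :: nat where M: "1 / d < real M" using reals_Archimedean2 by blast
  show "\<exists>no. \<forall>N\<ge>no. norm (nrm (bern (Suc N) (\<lambda>t. t * q t) f - T (bern N q f)) - 0) < e"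
  proof (intro exI allI impI)
    fix N assume N: "N \<ge> M + 1"
    define \<theta> where "\<theta> = (\<lambda>i. if i = 0 then 0 else (real i / real (Suc N)) * (q (real i / real (Suc
        N)) - q (real (i - 1) / real N)))"
    have "T (bern N q f) = (\<Sum>i\<le>N. q (real i / real N) *\<^sub>R (((real i + 1) / (real N + 1)) *\<^sub>R bern_op
        (Suc N) (Suc i) f))"
      by (simp add: bern_def T_lin T_bern_op)
    also have "\<dots> = (\<Sum>i\<le>Suc N. (if i = 0 then 0 else (real i / real (Suc N)) * q (real (i - 1) / real
        N)) *\<^sub>R bern_op (Suc N) i f)"
      by (subst sum.atMost_Suc_shift) (simp add: mult.commute add.commute)
    finally have "bern (Suc N) (\<lambda>t. t * q t) f - T (bern N q f) = (\<Sum>i\<le>Suc N. \<theta> i *\<^sub>R bern_op (Suc N)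
        i f)"
      unfolding bern_def by (simp only: sum_subtractf[symmetric]
          scaleR_left_diff_distrib[symmetric])
        (intro sum.cong refl, simp add: \<theta>_def algebra_simps)
    moreover have "nrm (\<Sum>i\<le>Suc N. \<theta> i *\<^sub>R bern_op (Suc N) i f) \<le> \<epsilon> * nrm f"
    proof (rule weighted_bern_bound)
      fix i assume i: "i \<le> Suc N"
      show "\<bar>\<theta> i\<bar> \<le> \<epsilon>"
      proof (cases "i = 0")
        case False
        then obtain j where j: "i = Suc j" "j \<le> N" using i by (cases i) auto
        have Np: "real N > 0" using N by simp
        have "real (Suc j) / real (Suc N) - real j / real N = (1 - real j / real N) / real (Suc N)"
          using Np by (simp add: field_simps)
        moreover have "0 \<le> 1 - real j / real N" "1 - real j / real N \<le> 1" using j Np by (simp_all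
            add: field_simps)
        ultimately have "\<bar>real (Suc j) / real (Suc N) - real j / real N\<bar> \<le> 1 / real (Suc N)"
          by (simp add: divide_right_mono del: divide_le_0_iff)
        also have "\<dots> < d"
        proof -
          have "1 < real M * d" using M d(1) by (simp add: pos_divide_less_eq)
          also have "\<dots> \<le> real (Suc N) * d" using N d(1) by (intro mult_right_mono) auto
          finally show ?thesis by (simp add: pos_divide_less_eq mult.commute)
        qed
        finally have "\<bar>q (real (Suc j) / real (Suc N)) - q (real j / real N)\<bar> < \<epsilon>"
          using j Np by (intro d(2)) (auto simp: field_simps)
        moreover have "\<bar>\<theta> i\<bar> = (real (Suc j) / real (Suc N)) * \<bar>q (real (Suc j) / real (Suc N)) - q
            (real j / real N)\<bar>"
          by (simp add: \<theta>_def j abs_mult)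
        moreover have "real (Suc j) / real (Suc N) \<le> 1" using j by simp
        ultimately have "\<bar>\<theta> i\<bar> \<le> 1 * \<epsilon>" by (simp only:) (intro mult_mono, auto)
        thus ?thesis by simp
      qed (use \<epsilon> in \<open>simp add: \<theta>_def\<close>)
    qed
    moreover have "\<epsilon> * nrm f < e"
    proof -
      have "\<epsilon> * nrm f \<le> \<epsilon> * (nrm f + 1)" using \<epsilon> by simp
      also have "\<dots> = e / 2" using n0 by (simp add: \<epsilon>_def field_simps)
      finally show ?thesis using e by simp
    qed
    ultimately show "norm (nrm (bern (Suc N) (\<lambda>t. t * q t) f - T (bern N q f)) - 0) < e" by simp
  qed
qed

text \<open>The space \<open>'v\<close> is not assumed complete for \<open>nrm\<close>, so
  convergence is expressed as a Cauchy property; limits first appear in \<open>calc\<close>, in a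
  Banach space.\<close>

definition nCauchy :: "(nat \<Rightarrow> 'v) \<Rightarrow> bool" where
  "nCauchy g \<longleftrightarrow> (\<forall>e>0. \<exists>n0. \<forall>m\<ge>n0. \<forall>n\<ge>n0. nrm (g m - g n) < e)"

lemma nCauchy_bern_mult:
  assumes q: "continuous_on {0..1} q" and c: "nCauchy (\<lambda>N. bern N q f)"
  shows "nCauchy (\<lambda>N. bern N (\<lambda>t. t * q t) f)"
  unfolding nCauchy_def
proof (intro allI impI)
  fix e :: real assume e: "e > 0"
  obtain n1 where n1: "\<And>N. N \<ge> n1 \<Longrightarrow> nrm (bern (Suc N) (\<lambda>t. t * q t) f - T (bern N q f)) < e / 3"
    using LIMSEQ_D[OF bern_shift[OF q], of "e/3"] e by auto
  obtain n2 where n2: "\<And>m n. m \<ge> n2 \<Longrightarrow> n \<ge> n2 \<Longrightarrow> nrm (bern m q f - bern n q f) < e / 3"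
    using c e unfolding nCauchy_def by (metis zero_less_divide_iff zero_less_numeral)
  show "\<exists>n0. \<forall>m\<ge>n0. \<forall>n\<ge>n0. nrm (bern m (\<lambda>t. t * q t) f - bern n (\<lambda>t. t * q t) f) < e"
  proof (intro exI allI impI)
    fix m n assume "m \<ge> Suc (max n1 n2)" "n \<ge> Suc (max n1 n2)"
    then obtain m' n' where mn: "m = Suc m'" "n = Suc n'" "m' \<ge> n1" "m' \<ge> n2" "n' \<ge> n1" "n' \<ge> n2"
      by (metis Suc_le_D Suc_le_mono max.bounded_iff)
    let ?p = "\<lambda>N. bern (Suc N) (\<lambda>t. t * q t) f - T (bern N q f)"
    have "bern m (\<lambda>t. t * q t) f - bern n (\<lambda>t. t * q t) f = (?p m' - ?p n') + T (bern m' q f - bern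
        n' q f)"
      by (simp add: mn T_lin)
    hence "nrm (bern m (\<lambda>t. t * q t) f - bern n (\<lambda>t. t * q t) f) \<le> (nrm (?p m') + nrm (?p n')) + nrm
        (bern m' q f - bern n' q f)"
      by (simp only:) (intro order_trans[OF nrm_triangle] add_mono nrm_diff nrm_T)
    thus "nrm (bern m (\<lambda>t. t * q t) f - bern n (\<lambda>t. t * q t) f) < e"
      using n1[of m'] n1[of n'] n2[of m' n'] mn by simp
  qed
qed

lemma nCauchy_add: "nCauchy g \<Longrightarrow> nCauchy h \<Longrightarrow> nCauchy (\<lambda>N. g N + h N)"
  unfolding nCauchy_def
proof (intro allI impI)
  fix e :: real assume g: "\<forall>e>0. \<exists>n0. \<forall>m\<ge>n0. \<forall>n\<ge>n0. nrm (g m - g n) < e" and h: "\<forall>e>0. \<exists>n0. \<forall>m\<ge>n0.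
      \<forall>n\<ge>n0. nrm (h m - h n) < e" and e: "e > 0"
  obtain a b where a: "\<And>m n. m \<ge> a \<Longrightarrow> n \<ge> a \<Longrightarrow> nrm (g m - g n) < e / 2" and b: "\<And>m n. m \<ge> b \<Longrightarrow> n \<ge> b \<Longrightarrow>
      nrm (h m - h n) < e / 2"
    using g h half_gt_zero[OF e] by metis
  show "\<exists>n0. \<forall>m\<ge>n0. \<forall>n\<ge>n0. nrm (g m + h m - (g n + h n)) < e"
  proof (intro exI allI impI)
    fix m n assume "m \<ge> max a b" "n \<ge> max a b"
    hence "nrm (g m - g n) < e / 2" "nrm (h m - h n) < e / 2" using a b by auto
    moreover have "nrm ((g m - g n) + (h m - h n)) \<le> nrm (g m - g n) + nrm (h m - h n)" by (rule
        nrm_triangle)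
    ultimately show "nrm (g m + h m - (g n + h n)) < e" by (simp add: algebra_simps)
  qed
qed

lemma nCauchy_scale: "nCauchy g \<Longrightarrow> nCauchy (\<lambda>N. c *\<^sub>R g N)"
  unfolding nCauchy_def
proof (intro allI impI)
  fix e :: real assume g: "\<forall>e>0. \<exists>n0. \<forall>m\<ge>n0. \<forall>n\<ge>n0. nrm (g m - g n) < e" and e: "e > 0"
  have "e / (\<bar>c\<bar> + 1) > 0" using e by (simp add: add_nonneg_pos)
  then obtain a where a: "\<And>m n. m \<ge> a \<Longrightarrow> n \<ge> a \<Longrightarrow> nrm (g m - g n) < e / (\<bar>c\<bar> + 1)" using g by metis
  have "nrm (c *\<^sub>R g m - c *\<^sub>R g n) < e" if "m \<ge> a" "n \<ge> a" for m n
  proof -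
    have "nrm (c *\<^sub>R g m - c *\<^sub>R g n) = \<bar>c\<bar> * nrm (g m - g n)" by (simp add: nrm_scale flip:
        scaleR_right_diff_distrib)
    also have "\<dots> \<le> (\<bar>c\<bar> + 1) * nrm (g m - g n)" by (intro mult_right_mono) auto
    also have "\<dots> < (\<bar>c\<bar> + 1) * (e / (\<bar>c\<bar> + 1))" by (intro mult_strict_left_mono a that) (simp add:
        add_nonneg_pos)
    also have "\<dots> = e" by (simp add: add_nonneg_eq_0_iff)
    finally show ?thesis .
  qed
  thus "\<exists>n0. \<forall>m\<ge>n0. \<forall>n\<ge>n0. nrm (c *\<^sub>R g m - c *\<^sub>R g n) < e" by blast
qed

text \<open>For the symbol 1 the sums are exactly \<open>f\<close>; \<open>nCauchy_bern_mult\<close>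
  multiplies the symbol by t, and a difference multiplies it by 1 - t. This settles all Bernstein
  polynomials, and \<open>bern_bound\<close> transfers the property to their uniform limits, the
  continuous functions.\<close>

lemma nCauchy_bern:
  assumes q: "continuous_on {0..1} q"
  shows "nCauchy (\<lambda>N. bern N q f)"
proof -
  have one: "nCauchy (\<lambda>N. bern N (\<lambda>t. 1) f)"
    by (simp add: bern_def sum_bern_op nCauchy_def nrm_def)
  have cpow: "nCauchy (\<lambda>N. bern N (\<lambda>t. t ^ i * (1 - t) ^ j) f)" for i j
  proof (induction i)
    case 0
    show ?case
    proof (induction j)
      case (Suc j)
      have "nCauchy (\<lambda>N. bern N (\<lambda>t. (1 - t) ^ j) f + (-1) *\<^sub>R bern N (\<lambda>t. t * (1 - t) ^ j) f)"
        using Suc by (intro nCauchy_add nCauchy_scale nCauchy_bern_mult continuous_intros) simp_all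
      moreover have "bern N (\<lambda>t. (1 - t) ^ j) f + (-1) *\<^sub>R bern N (\<lambda>t. t * (1 - t) ^ j) f = bern N
          (\<lambda>t. t ^ 0 * (1 - t) ^ Suc j) f" for N
        using bern_diff[of N "\<lambda>t. (1 - t) ^ j" "\<lambda>t. t * (1 - t) ^ j" f] by (simp add: algebra_simps)
      ultimately show ?case by simp
    qed (simp add: one)
  next
    case (Suc i)
    have "nCauchy (\<lambda>N. bern N (\<lambda>t. t * (t ^ i * (1 - t) ^ j)) f)"
      by (intro nCauchy_bern_mult Suc continuous_intros)
    thus ?case by (simp add: mult.assoc)
  qed
  have csum: "nCauchy (\<lambda>N. bern N (\<lambda>t. \<Sum>k\<in>I. c k * (t ^ k * (1 - t) ^ (n - k))) f)" if "finite I"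
      for I c n
    using that
  proof (induction I)
    case empty
    show ?case by (simp add: bern_def nCauchy_def nrm_def)
  next
    case (insert k I)
    have "nCauchy (\<lambda>N. c k *\<^sub>R bern N (\<lambda>t. t ^ k * (1 - t) ^ (n - k)) f + bern N (\<lambda>t. \<Sum>k\<in>I. c k * (t
        ^ k * (1 - t) ^ (n - k))) f)"
      by (intro nCauchy_add nCauchy_scale cpow insert.IH)
    thus ?case using insert by (simp add: bern_add bern_cmult)
  qed
  show ?thesis unfolding nCauchy_def
  proof (intro allI impI)
    fix e :: real assume e: "e > 0"
    define d where "d = e / (3 * (nrm f + 1))"
    have n0: "nrm f + 1 > 0" by (simp add: add_nonneg_pos)
    have d: "d > 0" using e n0 by (simp add: d_def)
    obtain n where n: "\<And>t. t \<in> {0..1} \<Longrightarrow> \<bar>q t - (\<Sum>k\<le>n. q (real k / real n) * Bernstein n k t)\<bar> < d"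
      using Bernstein_Weierstrass[OF q d] by blast
    define p where "p = (\<lambda>t. \<Sum>k\<le>n. (q (real k / real n) * real (n choose k)) * (t ^ k * (1 - t) ^ (n
        - k)))"
    have qp: "\<bar>q t - p t\<bar> \<le> d" if "t \<in> {0..1}" for t
      using n[OF that] by (simp add: p_def Bernstein_def mult.assoc)
    have dn: "d * nrm f < e / 3"
    proof -
      have "d * nrm f < d * (nrm f + 1)" using d by simp
      also have "\<dots> = e / 3" using n0 by (simp add: d_def field_simps)
      finally show ?thesis .
    qed
    have near: "nrm (bern N q f - bern N p f) < e / 3" for N
      using bern_bound[of "\<lambda>t. q t - p t" d N f] qp dn by (simp add: bern_diff)
    have "nCauchy (\<lambda>N. bern N p f)" unfolding p_def by (rule csum) simp
    then obtain a where a: "\<And>m n. m \<ge> a \<Longrightarrow> n \<ge> a \<Longrightarrow> nrm (bern m p f - bern n p f) < e / 3"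
      using e unfolding nCauchy_def by (metis zero_less_divide_iff zero_less_numeral)
    have "nrm (bern m q f - bern n q f) < e" if "m \<ge> a" "n \<ge> a" for m n
    proof -
      have "bern m q f - bern n q f = (bern m q f - bern m p f) - (bern n q f - bern n p f) + (bern
          m p f - bern n p f)" by simp
      hence "nrm (bern m q f - bern n q f) \<le> (nrm (bern m q f - bern m p f) + nrm (bern n q f - bern
          n p f)) + nrm (bern m p f - bern n p f)"
        by (simp only:) (intro order_trans[OF nrm_triangle] add_mono nrm_diff order_refl)
      thus ?thesis using near[of m] near[of n] a[OF that] by simp
    qed
    thus "\<exists>n0. \<forall>m\<ge>n0. \<forall>n\<ge>n0. nrm (bern m q f - bern n q f) < e" by blast
  qed
qed

end

section \<open>The calculus with values in a Banach space\<close>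

context positive_contraction
begin

text \<open>This stands for \<open>A\<close> applied to q(T) f. The operator \<open>A\<close> is
  built in because q(T) f itself need not exist in \<open>'v\<close>, whereas an \<open>A\<close>
  bounded for \<open>nrm\<close> carries the Cauchy sequence of Bernstein sums to a convergent
  one.\<close>

definition calc :: "('v \<Rightarrow> 'w::banach) \<Rightarrow> 'v \<Rightarrow> (real \<Rightarrow> real) \<Rightarrow> 'w" where
  "calc A f q = lim (\<lambda>N. A (bern N q f))"

definition nbounded :: "('v \<Rightarrow> 'w::real_normed_vector) \<Rightarrow> real \<Rightarrow> bool" where
  "nbounded A C \<longleftrightarrow> linear A \<and> C \<ge> 0 \<and> (\<forall>g. norm (A g) \<le> C * nrm g)"

lemma nboundedD:
  assumes "nbounded A C"
  shows "linear A" "C \<ge> 0" "norm (A g) \<le> C * nrm g"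
  using assms by (auto simp: nbounded_def)

lemma calc_tendsto:
  assumes A: "nbounded A C" and q: "continuous_on {0..1} q"
  shows "(\<lambda>N. A (bern N q f)) \<longlonglongrightarrow> calc A f q"
proof -
  have "Cauchy (\<lambda>N. A (bern N q f))"
  proof (rule CauchyI)
    fix e :: real assume e: "e > 0"
    have C: "C + 1 > 0" using nboundedD(2)[OF A] by simp
    hence "e / (C + 1) > 0" using e by simp
    then obtain n0 where n0: "\<And>m n. m \<ge> n0 \<Longrightarrow> n \<ge> n0 \<Longrightarrow> nrm (bern m q f - bern n q f) < e / (C + 1)"
      using nCauchy_bern[OF q, of f] unfolding nCauchy_def by metis
    have "norm (A (bern m q f) - A (bern n q f)) < e" if "m \<ge> n0" "n \<ge> n0" for m n
    proof -
      have "norm (A (bern m q f) - A (bern n q f)) \<le> C * nrm (bern m q f - bern n q f)"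
        using nboundedD(3)[OF A] by (simp flip: linear_diff[OF nboundedD(1)[OF A]])
      also have "\<dots> \<le> (C + 1) * nrm (bern m q f - bern n q f)" by (intro mult_right_mono) auto
      also have "\<dots> < (C + 1) * (e / (C + 1))" by (intro mult_strict_left_mono n0 that C)
      also have "\<dots> = e" using C by simp
      finally show ?thesis .
    qed
    thus "\<exists>M. \<forall>m\<ge>M. \<forall>n\<ge>M. norm (A (bern m q f) - A (bern n q f)) < e" by blast
  qed
  thus ?thesis unfolding calc_def by (simp add: Cauchy_convergent_iff convergent_LIMSEQ_iff)
qed

lemma calc_bound:
  assumes A: "nbounded A C" and q: "continuous_on {0..1} q" and M: "\<And>t. t \<in> {0..1} \<Longrightarrow> \<bar>q t\<bar> \<le> M"
  shows "norm (calc A f q) \<le> C * M * nrm f"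
proof (rule LIMSEQ_le_const2[OF tendsto_norm[OF calc_tendsto[OF A q]]], intro exI allI impI)
  fix N
  have "norm (A (bern N q f)) \<le> C * nrm (bern N q f)" by (rule nboundedD[OF A])
  also have "\<dots> \<le> C * (M * nrm f)" by (intro mult_left_mono bern_bound M nboundedD(2)[OF A])
  finally show "norm (A (bern N q f)) \<le> C * M * nrm f" by (simp add: mult.assoc)
qed

lemma calc_add:
  assumes A: "nbounded A C" and p: "continuous_on {0..1} p" and q: "continuous_on {0..1} q"
  shows "calc A f (\<lambda>t. p t + q t) = calc A f p + calc A f q"
proof (rule LIMSEQ_unique)
  show "(\<lambda>N. A (bern N (\<lambda>t. p t + q t) f)) \<longlonglongrightarrow> calc A f (\<lambda>t. p t + q t)"
    by (intro calc_tendsto[OF A] continuous_intros p q)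
  show "(\<lambda>N. A (bern N (\<lambda>t. p t + q t) f)) \<longlonglongrightarrow> calc A f p + calc A f q"
    unfolding bern_add linear_add[OF nboundedD(1)[OF A]] by (intro tendsto_add calc_tendsto[OF A] p
        q)
qed

lemma calc_cmult:
  assumes A: "nbounded A C" and q: "continuous_on {0..1} q"
  shows "calc A f (\<lambda>t. c * q t) = c *\<^sub>R calc A f q"
proof (rule LIMSEQ_unique)
  show "(\<lambda>N. A (bern N (\<lambda>t. c * q t) f)) \<longlonglongrightarrow> calc A f (\<lambda>t. c * q t)"
    by (intro calc_tendsto[OF A] continuous_intros q)
  show "(\<lambda>N. A (bern N (\<lambda>t. c * q t) f)) \<longlonglongrightarrow> c *\<^sub>R calc A f q"
    unfolding bern_cmult linear_scale[OF nboundedD(1)[OF A]] by (intro tendsto_intros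
        calc_tendsto[OF A] q)
qed

lemma calc_diff:
  assumes A: "nbounded A C" and p: "continuous_on {0..1} p" and q: "continuous_on {0..1} q"
  shows "calc A f (\<lambda>t. p t - q t) = calc A f p - calc A f q"
  using calc_add[OF A p, of "\<lambda>t. -1 * q t"] calc_cmult[OF A q, of f "-1"] q by (simp add:
      continuous_intros)

lemma calc_one:
  shows "calc A f (\<lambda>t. 1) = A f"
  unfolding calc_def bern_def by (simp add: sum_bern_op)

lemma nbounded_T: "nbounded A C \<Longrightarrow> nbounded (\<lambda>f. A (T f)) C"
  unfolding nbounded_def using linear_compose[OF linear_T, of A]
  by (auto simp: o_def intro: order_trans[OF _ mult_left_mono[OF nrm_T]])

text \<open>The limit form of \<open>bern_shift\<close>. It provides the one product of symbols that
  the equation requires, with c t, the symbol of A^-1.\<close>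

lemma calc_shift:
  assumes A: "nbounded A C" and q: "continuous_on {0..1} q"
  shows "calc A f (\<lambda>t. t * q t) = calc (\<lambda>f. A (T f)) f q"
proof (rule LIMSEQ_unique)
  have "(\<lambda>N. A (bern (Suc N) (\<lambda>t. t * q t) f)) \<longlonglongrightarrow> calc A f (\<lambda>t. t * q t)"
    by (intro LIMSEQ_Suc calc_tendsto[OF A] continuous_intros q)
  moreover have "(\<lambda>N. A (bern (Suc N) (\<lambda>t. t * q t) f) - A (T (bern N q f))) \<longlonglongrightarrow> 0"
  proof (rule Lim_null_comparison)
    show "\<forall>\<^sub>F N in sequentially. norm (A (bern (Suc N) (\<lambda>t. t * q t) f) - A (T (bern N q f))) \<le> C *
        nrm (bern (Suc N) (\<lambda>t. t * q t) f - T (bern N q f))"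
      using nboundedD(3)[OF A] by (simp flip: linear_diff[OF nboundedD(1)[OF A]])
    show "(\<lambda>N. C * nrm (bern (Suc N) (\<lambda>t. t * q t) f - T (bern N q f))) \<longlonglongrightarrow> 0"
      using tendsto_mult_left[OF bern_shift[OF q, of f], of C] by simp
  qed
  ultimately have "(\<lambda>N. A (bern (Suc N) (\<lambda>t. t * q t) f) - (A (bern (Suc N) (\<lambda>t. t * q t) f) - A (T
      (bern N q f)))) \<longlonglongrightarrow> calc A f (\<lambda>t. t * q t) - 0"
    by (rule tendsto_diff)
  thus "(\<lambda>N. A (T (bern N q f))) \<longlonglongrightarrow> calc A f (\<lambda>t. t * q t)" by simp
  show "(\<lambda>N. A (T (bern N q f))) \<longlonglongrightarrow> calc (\<lambda>f. A (T f)) f q"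
    by (rule calc_tendsto[OF nbounded_T[OF A] q])
qed

lemma calc_compose:
  assumes A: "nbounded A C" and M: "bounded_linear M" and q: "continuous_on {0..1} q"
  shows "calc (\<lambda>f. M (A f)) f q = M (calc A f q)"
  unfolding calc_def[of "\<lambda>f. M (A f)"]
  by (rule limI, rule bounded_linear.tendsto[OF M], rule calc_tendsto[OF A q])

text \<open>Since \<open>{0..1}\<close> is compact, joint continuity makes \<open>q x\<close> tend
  to \<open>q x0\<close> uniformly in \<open>t\<close>, as \<open>calc_bound\<close> demands. The
  summand 1 in \<open>D\<close> only avoids a division by zero.\<close>

lemma calc_continuous:
  fixes q :: "'x::metric_space \<Rightarrow> real \<Rightarrow> real"
  assumes A: "nbounded A C" and q: "continuous_on (X \<times> {0..1}) (\<lambda>(x, t). q x t)"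
  shows "continuous_on X (\<lambda>x. calc A f (q x))"
  unfolding continuous_on_iff
proof (intro ballI allI impI)
  fix x0 and e :: real assume x0: "x0 \<in> X" and e: "e > 0"
  have qc: "continuous_on {0..1} (q x)" if "x \<in> X" for x
    using continuous_on_compose2[OF q, of "{0..1}" "\<lambda>t. (x, t)"] that by (simp add:
        continuous_intros image_subset_iff)
  define D where "D = C * nrm f + 1"
  have D: "D > 0" using nboundedD(2)[OF A] by (simp add: D_def add_nonneg_pos)
  have "e / (2 * D) > 0" using e D by simp
  then obtain X0 where X0: "x0 \<in> X0" "open X0" "\<forall>x\<in>X0 \<inter> X. \<forall>t\<in>{0..1}. dist ((\<lambda>(x, t). q x t) (x, t))
      ((\<lambda>(x, t). q x t) (x0, t)) \<le> e / (2 * D)"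
    using continuous_on_prod_compactE[OF q _ x0, of "e / (2 * D)"] by (metis compact_Icc)
  obtain d where d: "d > 0" "ball x0 d \<subseteq> X0" using X0 open_contains_ball by blast
  have "dist (calc A f (q x)) (calc A f (q x0)) < e" if x: "x \<in> X" "dist x x0 < d" for x
  proof -
    have "x \<in> X0" using x d by (auto simp: dist_commute)
    hence "\<bar>q x t - q x0 t\<bar> \<le> e / (2 * D)" if "t \<in> {0..1}" for t using X0 x that by (auto simp:
        dist_real_def)
    hence "norm (calc A f (\<lambda>t. q x t - q x0 t)) \<le> C * (e / (2 * D)) * nrm f"
      by (intro calc_bound[OF A] continuous_intros qc x x0)
    hence "dist (calc A f (q x)) (calc A f (q x0)) \<le> (C * nrm f) * (e / (2 * D))"
      using calc_diff[OF A qc[OF x(1)] qc[OF x0], of f] by (simp add: dist_norm mult_ac)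
    also have "\<dots> \<le> D * (e / (2 * D))" using D e by (intro mult_right_mono) (auto simp: D_def)
    also have "\<dots> < e" using D e by simp
    finally show ?thesis .
  qed
  thus "\<exists>d>0. \<forall>x\<in>X. dist x x0 < d \<longrightarrow> dist (calc A f (q x)) (calc A f (q x0)) < e" using d(1) by blast
qed

text \<open>For fixed \<open>t\<close> the mean value inequality, applied to
  \<open>q x t - x * q' x0 t\<close>, bounds the remainder by the oscillation of \<open>q'\<close>
  near \<open>x0\<close>, which is uniformly small in \<open>t\<close> by compactness. A convex
  \<open>X\<close> admits one-sided derivatives at end points.\<close>

lemma calc_has_derivative:
  fixes q :: "real \<Rightarrow> real \<Rightarrow> real"
  assumes A: "nbounded A C" and X: "convex X"
    and qc: "\<And>x. x \<in> X \<Longrightarrow> continuous_on {0..1} (q x)"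
    and q': "continuous_on (X \<times> {0..1}) (\<lambda>(x, t). q' x t)"
    and d: "\<And>x t. x \<in> X \<Longrightarrow> t \<in> {0..1} \<Longrightarrow> ((\<lambda>x. q x t) has_real_derivative q' x t) (at x within X)"
    and x0: "x0 \<in> X"
  shows "((\<lambda>x. calc A f (q x)) has_vector_derivative calc A f (q' x0)) (at x0 within X)"
  unfolding has_vector_derivative_def has_derivative_within_alt
proof (intro conjI allI impI bounded_linear_scaleR_left)
  fix e :: real assume e: "e > 0"
  have q'c: "continuous_on {0..1} (q' x)" if "x \<in> X" for x
    using continuous_on_compose2[OF q', of "{0..1}" "\<lambda>t. (x, t)"] that by (simp add:
        continuous_intros image_subset_iff)
  define D where "D = C * nrm f + 1"
  have D: "D > 0" using nboundedD(2)[OF A] by (simp add: D_def add_nonneg_pos)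
  have eD: "e / D > 0" using e D by simp
  then obtain X0 where X0: "x0 \<in> X0" "open X0" "\<forall>x\<in>X0 \<inter> X. \<forall>t\<in>{0..1}. dist ((\<lambda>(x, t). q' x t) (x,
      t)) ((\<lambda>(x, t). q' x t) (x0, t)) \<le> e / D"
    using continuous_on_prod_compactE[OF q' _ x0, of "e / D"] by (metis compact_Icc)
  obtain r where r: "r > 0" "ball x0 r \<subseteq> X0" using X0 open_contains_ball by blast
  have "norm (calc A f (q y) - calc A f (q x0) - (y - x0) *\<^sub>R calc A f (q' x0)) \<le> e * norm (y - x0)"
    if y: "y \<in> X" "norm (y - x0) < r" for y
  proof -
    define S where "S = X \<inter> ball x0 r"
    have S: "convex S" "x0 \<in> S" "y \<in> S" using X x0 y r by (auto simp: S_def convex_Int dist_norm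
        norm_minus_commute)
    have le: "\<bar>q y t - q x0 t - (y - x0) * q' x0 t\<bar> \<le> e / D * \<bar>y - x0\<bar>" if t: "t \<in> {0..1}" for t
    proof -
      have "norm ((q y t - y * q' x0 t) - (q x0 t - x0 * q' x0 t)) \<le> e / D * norm (y - x0)"
      proof (rule field_differentiable_bound[OF S(1) _ _ S(3) S(2)])
        fix z assume z: "z \<in> S"
        have "((\<lambda>x. q x t) has_real_derivative q' z t) (at z within S)"
          using d[of z t] z t by (auto simp: S_def intro: DERIV_subset)
        thus "((\<lambda>x. q x t - x * q' x0 t) has_real_derivative (q' z t - 1 * q' x0 t)) (at z within
            S)"
          by (rule DERIV_diff[OF _ DERIV_cmult_right[OF DERIV_ident]])
        show "norm (q' z t - 1 * q' x0 t) \<le> e / D" using X0 r z t by (auto simp: S_def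
            dist_real_def)
      qed
      thus ?thesis by (simp add: algebra_simps)
    qed
    have "calc A f (q y) - calc A f (q x0) - (y - x0) *\<^sub>R calc A f (q' x0) = calc A f (\<lambda>t. (q y t -
        q x0 t) - (y - x0) * q' x0 t)"
      using y(1) x0 by (simp add: calc_diff[OF A] calc_cmult[OF A] qc q'c continuous_intros)
    also have "norm \<dots> \<le> C * (e / D * \<bar>y - x0\<bar>) * nrm f"
      using le y(1) x0 by (intro calc_bound[OF A] continuous_intros qc q'c)
    also have "\<dots> = (C * nrm f) * (e / D * \<bar>y - x0\<bar>)" by simp
    also have "\<dots> \<le> D * (e / D * \<bar>y - x0\<bar>)" using eD by (intro mult_right_mono mult_nonneg_nonneg)
        (auto simp: D_def)
    also have "\<dots> = e * norm (y - x0)" using D by simp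
    finally show ?thesis .
  qed
  thus "\<exists>d>0. \<forall>y\<in>X. norm (y - x0) < d \<longrightarrow> norm (calc A f (q y) - calc A f (q x0) - (y - x0) *\<^sub>R calc A
      f (q' x0)) \<le> e * norm (y - x0)"
    using r(1) by blast
qed

text \<open>A Bernstein sum involves \<open>q\<close> at finitely many nodes only, so it commutes
  with the integral by linearity. The majorant \<open>C * nrm f * w\<close> from
  \<open>bern_bound\<close> allows the passage to the limit.\<close>

lemma calc_integral:
  fixes A :: "'v \<Rightarrow> real" and q :: "'a \<Rightarrow> real \<Rightarrow> real"
  assumes A: "nbounded A C"
    and qc: "\<And>\<tau>. continuous_on {0..1} (q \<tau>)"
    and meas: "\<And>t. t \<in> {0..1} \<Longrightarrow> (\<lambda>\<tau>. q \<tau> t) \<in> borel_measurable M"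
    and w: "integrable M w" and le: "\<And>\<tau> t. t \<in> {0..1} \<Longrightarrow> \<bar>q \<tau> t\<bar> \<le> w \<tau>"
    and Q: "continuous_on {0..1} (\<lambda>t. \<integral>\<tau>. q \<tau> t \<partial>M)"
  shows "integrable M (\<lambda>\<tau>. calc A f (q \<tau>))"
    and "(\<integral>\<tau>. calc A f (q \<tau>) \<partial>M) = calc A f (\<lambda>t. \<integral>\<tau>. q \<tau> t \<partial>M)"
proof -
  define s where "s = (\<lambda>N \<tau>. A (bern N (q \<tau>) f))"
  have s: "s N \<tau> = (\<Sum>i\<le>N. q \<tau> (real i / real N) * A (bern_op N i f))" for N \<tau>
    by (simp add: s_def bern_def linear_sum[OF nboundedD(1)[OF A]] linear_scale[OF nboundedD(1)[OF
        A]])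
  have node: "real i / real N \<in> {0..1}" if "i \<le> N" for i N :: nat using that by (auto simp:
      divide_simps)
  have qint: "integrable M (\<lambda>\<tau>. q \<tau> t)" if "t \<in> {0..1}" for t
    by (rule Bochner_Integration.integrable_bound[OF w meas[OF that]]) (use le[OF that] in \<open>auto
        intro!: AE_I2 intro: order_trans[OF _ abs_ge_self]\<close>)
  have sm: "s N \<in> borel_measurable M" for N
    unfolding s by (intro borel_measurable_sum borel_measurable_times meas node) auto
  have lim: "(\<lambda>N. s N \<tau>) \<longlonglongrightarrow> calc A f (q \<tau>)" for \<tau> unfolding s_def by (rule calc_tendsto[OF A qc])
  have cm: "(\<lambda>\<tau>. calc A f (q \<tau>)) \<in> borel_measurable M"
    by (rule borel_measurable_LIMSEQ_real[OF lim sm])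
  have bnd: "norm (s N \<tau>) \<le> C * nrm f * w \<tau>" for N \<tau>
  proof -
    have "norm (s N \<tau>) \<le> C * nrm (bern N (q \<tau>) f)" unfolding s_def by (rule nboundedD[OF A])
    also have "\<dots> \<le> C * (w \<tau> * nrm f)" by (intro mult_left_mono bern_bound le nboundedD(2)[OF A])
    finally show ?thesis by (simp add: mult_ac)
  qed
  have wi: "integrable M (\<lambda>\<tau>. C * nrm f * w \<tau>)" using w by simp
  show "integrable M (\<lambda>\<tau>. calc A f (q \<tau>))"
    by (rule integrable_dominated_convergence[where s = s, OF cm sm wi]) (use lim bnd in auto)
  have "(\<lambda>N. \<integral>\<tau>. s N \<tau> \<partial>M) \<longlonglongrightarrow> (\<integral>\<tau>. calc A f (q \<tau>) \<partial>M)"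
    by (rule integral_dominated_convergence[where s = s, OF cm sm wi]) (use lim bnd in auto)
  moreover have "(\<integral>\<tau>. s N \<tau> \<partial>M) = A (bern N (\<lambda>t. \<integral>\<tau>. q \<tau> t \<partial>M) f)" for N
  proof -
    have "(\<integral>\<tau>. s N \<tau> \<partial>M) = (\<Sum>i\<le>N. (\<integral>\<tau>. q \<tau> (real i / real N) \<partial>M) * A (bern_op N i f))"
      unfolding s using qint[OF node] by (subst Bochner_Integration.integral_sum) auto
    thus ?thesis by (simp add: bern_def linear_sum[OF nboundedD(1)[OF A]] linear_scale[OF
        nboundedD(1)[OF A]])
  qed
  moreover have "(\<lambda>N. A (bern N (\<lambda>t. \<integral>\<tau>. q \<tau> t \<partial>M) f)) \<longlonglongrightarrow> calc A f (\<lambda>t. \<integral>\<tau>. q \<tau> t \<partial>M)"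
    by (rule calc_tendsto[OF A Q])
  ultimately show "(\<integral>\<tau>. calc A f (q \<tau>) \<partial>M) = calc A f (\<lambda>t. \<integral>\<tau>. q \<tau> t \<partial>M)"
    using LIMSEQ_unique by simp
qed

end

section \<open>The Dirichlet problem for the degenerate operator\<close>

type_synonym cfun = "(real, real) bcontfun"

text \<open>Functions on \<open>{0..1}\<close> are continued by constants on both sides, which
  places them in the Banach space type of bounded continuous functions on the line.\<close>

definition extend :: "(real \<Rightarrow> real) \<Rightarrow> cfun" where
  "extend g = Bcontfun (\<lambda>y. g (max 0 (min 1 y)))"

lemma extend_apply:
  assumes g: "continuous_on {0..1} g"
  shows "(extend g) y = g (max 0 (min 1 y))"
proof -
  have "(\<lambda>y. g (max 0 (min 1 y))) \<in> bcontfun"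
  proof -
    have "continuous_on UNIV (\<lambda>y. g (max 0 (min 1 y)))"
      by (intro continuous_on_compose2[OF g] continuous_intros) auto
    moreover have "compact (g ` {0..1})" using g by (intro compact_continuous_image) auto
    hence "bounded (g ` {0..1})" by (rule compact_imp_bounded)
    hence "bounded (range (\<lambda>y. g (max 0 (min 1 y))))" by (rule bounded_subset) auto
    ultimately show ?thesis by (simp add: bcontfun_def)
  qed
  thus ?thesis by (simp add: extend_def Bcontfun_inverse)
qed

lemma clamp01: "y \<in> {0..1} \<Longrightarrow> max 0 (min 1 y) = (y :: real)" by auto

lemma extend_eq: "continuous_on {0..1} g \<Longrightarrow> y \<in> {0..1} \<Longrightarrow> (extend g) y = g y"
  by (simp add: extend_apply clamp01)

lemma integrable_cfun [simp]:
  fixes F :: cfun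
  shows "F integrable_on {a..b}"
  by (rule integrable_continuous_real) simp

lemma continuous_on_apply_cfun [continuous_intros]:
  fixes F :: cfun
  shows "continuous_on S g \<Longrightarrow> continuous_on S (\<lambda>x. F (g x))"
  by (rule continuous_on_compose2[of UNIV "F"]) auto

definition IL :: "cfun \<Rightarrow> cfun" where
  "IL F = extend (\<lambda>y. integral {0..y} F)"

definition IR :: "cfun \<Rightarrow> cfun" where
  "IR F = const_bcontfun (integral {0..1} F) - IL F"

lemma IL_apply: "(IL F) y = integral {0..max 0 (min 1 y)} F"
  unfolding IL_def by (rule extend_apply) (intro indefinite_integral_continuous_1 integrable_cfun)

lemma IL_apply': "y \<in> {0..1} \<Longrightarrow> (IL F) y = integral {0..y} F"
  by (simp add: IL_apply clamp01)

lemma IR_apply: "(IR F) y = integral {max 0 (min 1 y)..1} F"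
proof -
  have "integral {0..max 0 (min 1 y)} F + integral {max 0 (min 1 y)..1} F = integral {0..1} F"
    by (intro Henstock_Kurzweil_Integration.integral_combine) auto
  thus ?thesis by (simp add: IR_def IL_apply)
qed

lemma IL_0: "(IL F) 0 = 0" by (simp add: IL_apply)
lemma IR_1: "(IR F) 1 = 0" by (simp add: IR_apply)

lemma IL_has_derivative:
  assumes y: "y \<in> {0..1}"
  shows "((IL F) has_real_derivative F y) (at y within {0..1})"
proof -
  have "((\<lambda>x. integral {0..x} F) has_real_derivative F y) (at y within {0..1})"
    using y by (intro integral_has_real_derivative) auto
  thus ?thesis
    by (rule has_field_derivative_transform_within[where d = 1]) (use y in \<open>simp_all add:
        IL_apply'\<close>)
qed

lemma IR_has_derivative:
  assumes y: "y \<in> {0..1}"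
  shows "(apply_bcontfun (IR F) has_real_derivative - apply_bcontfun F y) (at y within {0..1})"
proof -
  have "((\<lambda>y. integral {0..1} (apply_bcontfun F) - apply_bcontfun (IL F) y) has_real_derivative 0 -
      apply_bcontfun F y) (at y within {0..1})"
    by (intro derivative_intros IL_has_derivative y)
  moreover have "apply_bcontfun (IR F) = (\<lambda>y. integral {0..1} (apply_bcontfun F) - apply_bcontfun
      (IL F) y)"
    by (simp add: IR_def fun_eq_iff)
  ultimately show ?thesis by simp
qed

lemma norm_integral_cfun_le:
  fixes F :: cfun assumes "a \<le> b"
  shows "\<bar>integral {a..b} F\<bar> \<le> norm F * (b - a)"
proof -
  have "norm (integral {a..b} F) \<le> integral {a..b} (\<lambda>x. norm F)"
    by (rule integral_norm_bound_integral) (use norm_bounded[of F] in auto)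
  thus ?thesis using assms by (simp add: mult.commute)
qed

lemma linear_IL: "linear IL"
  by (rule linearI) (auto intro!: bcontfun_eqI simp: IL_apply integral_add)

lemma linear_IR: "linear IR"
  by (rule linearI) (auto intro!: bcontfun_eqI simp: IR_apply integral_add)

lemma norm_IL: "norm (IL F) \<le> norm F"
proof (rule norm_bound)
  fix y
  have "norm ((IL F) y) \<le> norm F * (max 0 (min 1 y) - 0)"
    using norm_integral_cfun_le[of 0 "max 0 (min 1 y)" F] by (simp add: IL_apply)
  also have "\<dots> \<le> norm F * 1" by (intro mult_left_mono) auto
  finally show "norm ((IL F) y) \<le> norm F" by simp
qed

lemma linear_funpow: "linear S \<Longrightarrow> linear (S ^^ n)" for S :: "'v::real_vector \<Rightarrow> 'v"
  by (induction n) (simp_all add: linear_id[unfolded id_def] id_def linear_compose)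

lemma funpow_pred: "n \<ge> 1 \<Longrightarrow> (f ^^ n) x = f ((f ^^ (n - 1)) x)"
  by (cases n) auto

lemma norm_IL_pow: "norm ((IL ^^ n) F) \<le> norm F"
  by (induction n) (auto intro: order_trans[OF norm_IL])

text \<open>Each integration from 0 raises the order of the zero at 0 by one. The order
  \<open>k\<close> of \<open>Sol F\<close> is what absorbs the division by y^m in
  \<open>K\<close>.\<close>

lemma IL_pow_le:
  assumes "y \<in> {0..1}"
  shows "\<bar>((IL ^^ n) F) y\<bar> \<le> norm F * y ^ n"
  using assms
proof (induction n arbitrary: y)
  case 0
  show ?case using norm_bounded[of F y] by simp
next
  case (Suc n)
  have "norm (integral {0..y} (((IL ^^ n) F))) \<le> integral {0..y} (\<lambda>s. norm F * y ^ n)"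
  proof (rule integral_norm_bound_integral)
    fix s assume s: "s \<in> {0..y}"
    hence "\<bar>((IL ^^ n) F) s\<bar> \<le> norm F * s ^ n" using Suc.prems by (intro Suc.IH) auto
    also have "\<dots> \<le> norm F * y ^ n" using s by (intro mult_left_mono power_mono) auto
    finally show "norm (((IL ^^ n) F) s) \<le> norm F * y ^ n" by simp
  qed auto
  thus ?case using Suc.prems by (simp add: IL_apply' mult_ac)
qed

definition ip0 :: "cfun \<Rightarrow> cfun \<Rightarrow> real" where
  "ip0 F H = integral {0..1} (\<lambda>y. F y * H y)"

lemma ip0_integrable [simp]:
  fixes F H :: cfun
  shows "(\<lambda>y. F y * H y) integrable_on {a..b}"
  by (intro integrable_continuous_real continuous_intros)

lemma ip0_add: "ip0 (f + g) h = ip0 f h + ip0 g h"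
  by (simp add: ip0_def distrib_right integral_add)
lemma ip0_scale: "ip0 (c *\<^sub>R f) h = c * ip0 f h"
  by (simp add: ip0_def mult.assoc)
lemma ip0_sym: "ip0 f g = ip0 g f" by (simp add: ip0_def mult.commute)
lemma ip0_pos: "ip0 f f \<ge> 0"
  unfolding ip0_def by (rule integral_nonneg) auto
lemma ip0_diff: "ip0 (f - g) h = ip0 f h - ip0 g h" using ip0_add[of "f - g" g h] by simp
lemma ip0_add2: "ip0 h (f + g) = ip0 h f + ip0 h g"
  by (simp only: ip0_sym[of h] ip0_add)
lemma ip0_diff2: "ip0 h (f - g) = ip0 h f - ip0 h g"
  by (simp only: ip0_sym[of h] ip0_diff)
lemma ip0_sum2: "ip0 h (\<Sum>i\<in>I. F i) = (\<Sum>i\<in>I. ip0 h (F i))"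
proof (induction I rule: infinite_finite_induct)
  case (insert i I)
  thus ?case by (simp add: ip0_add2)
qed (simp_all add: ip0_def)
lemma ip0_le: "\<bar>ip0 f g\<bar> \<le> norm f * norm g"
proof -
  have "norm (integral {0..1} (\<lambda>y. f y * g y)) \<le> integral {0..1} (\<lambda>y::real. norm f * norm g)"
  proof (rule integral_norm_bound_integral)
    fix y :: real
    show "norm (f y * g y) \<le> norm f * norm g"
      unfolding norm_mult by (intro mult_mono norm_bounded) auto
  qed auto
  thus ?thesis by (simp add: ip0_def)
qed

text \<open>Integration by parts; the boundary terms vanish since \<open>IL F\<close> is zero at 0
  and \<open>IR H\<close> is zero at 1.\<close>

lemma ip0_IL: "ip0 (IL F) H = ip0 F (IR H)"
proof -
  let ?f = "\<lambda>y. (IL F) y * (IR H) y"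
  have "((\<lambda>y. F y * (IR H) y - (IL F) y * H y) has_integral (?f 1 - ?f 0)) {0..1}"
  proof (rule fundamental_theorem_of_calculus)
    fix y :: real assume y: "y \<in> {0..1}"
    have "(?f has_real_derivative (F y * (IR H) y + - H y * (IL F) y)) (at y within {0..1})"
      by (intro DERIV_mult IL_has_derivative IR_has_derivative y)
    thus "(?f has_vector_derivative (F y * (IR H) y - (IL F) y * H y)) (at y within {0..1})"
      by (simp add: has_real_derivative_iff_has_vector_derivative mult.commute)
  qed simp
  hence "integral {0..1} (\<lambda>y. F y * (IR H) y - (IL F) y * H y) = 0"
    by (simp add: integral_unique IL_0 IR_1)
  thus ?thesis by (simp add: ip0_def integral_diff)
qed

lemma ip0_IL_pow: "ip0 ((IL ^^ n) F) H = ip0 F ((IR ^^ n) H)"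
proof (induction n arbitrary: H)
  case (Suc n)
  show ?case by (simp add: ip0_IL Suc.IH) (simp add: funpow_swap1)
qed simp

text \<open>The kernel (s - y)^(n-1) / (n-1)! of Cauchy's formula for repeated integrals is at most
  s^(n-1). This weight, small at 0, compensates for the degeneration of the weight y^m in
  \<open>ip\<close>.\<close>

lemma IR_pow_le:
  assumes n: "n \<ge> 1" and y: "y \<in> {0..1}"
  shows "\<bar>((IR ^^ n) F) y\<bar> \<le> integral {y..1} (\<lambda>s. s ^ (n - 1) * \<bar>F s\<bar>)"
proof -
  define G where "G = (\<lambda>n. extend (\<lambda>s. s ^ (n - 1) * \<bar>F s\<bar>))"
  have G: "(G n) s = s ^ (n - 1) * \<bar>F s\<bar>" if "s \<in> {0..1}" for n s
    unfolding G_def using that by (intro extend_eq continuous_intros)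
  have IRG: "(IR (G n)) y = integral {y..1} (\<lambda>s. s ^ (n - 1) * \<bar>F s\<bar>)" if "y \<in> {0..1}" for n y
    using that G by (auto simp: IR_apply clamp01 intro!: integral_cong)
  have "\<bar>((IR ^^ n) F) y\<bar> \<le> (IR (G n)) y"
    using n y
  proof (induction n arbitrary: y rule: dec_induct)
    case base
    have "norm (integral {y..1} F) \<le> integral {y..1} (\<lambda>s. \<bar>F s\<bar>)"
      by (rule integral_norm_bound_integral) (auto intro!: integrable_continuous_real
          continuous_intros)
    thus ?case using base IRG[of y 1] by (simp add: IR_apply clamp01)
  next
    case (step n)
    \<comment> \<open>\<open>D y\<close> is the integral of (s - y) s^(n-1) |F s| over
      \<open>{y..1}\<close>: an antiderivative of \<open>- IR (G n)\<close> that vanishes at 1 and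
      is at most \<open>IR (G (Suc n))\<close> because y >= 0.\<close>
    define D where "D = (\<lambda>y. (IR (G (Suc n))) y - y * (IR (G n)) y)"
    have "((\<lambda>y. - (IR (G n)) y) has_integral D 1 - D y) {y..1}"
    proof (rule fundamental_theorem_of_calculus)
      fix s assume s: "s \<in> {y..1}"
      hence s1: "s \<in> {0..1}" using step.prems by auto
      have "(D has_real_derivative (- (G (Suc n)) s - (1 * (IR (G n)) s + (- (G n) s) * s))) (at s
          within {0..1})"
        unfolding D_def by (intro DERIV_diff DERIV_mult DERIV_ident IR_has_derivative s1)
      moreover have "(G (Suc n)) s = s * (G n) s"
        using step.hyps by (cases n) (simp_all add: G[OF s1])
      ultimately have "(D has_real_derivative - (IR (G n)) s) (at s within {0..1})" by (simp add:
          mult.commute)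
      thus "(D has_vector_derivative - (IR (G n)) s) (at s within {y..1})"
        unfolding has_real_derivative_iff_has_vector_derivative[symmetric]
        by (rule DERIV_subset) (use step.prems in auto)
    qed (use step.prems in auto)
    hence I: "((IR (G n)) has_integral D y) {y..1}"
      by (drule_tac has_integral_neg) (simp add: D_def IR_1)
    have "norm (integral {y..1} (((IR ^^ n) F))) \<le> integral {y..1} ((IR (G n)))"
      by (rule integral_norm_bound_integral) (use step in auto)
    also have "\<dots> = D y" using I by (rule integral_unique)
    also have "\<dots> \<le> (IR (G (Suc n))) y"
    proof -
      have "(IR (G n)) y \<ge> 0"
        unfolding IRG[OF step.prems] using step.prems by (intro integral_nonneg
            integrable_continuous_real continuous_intros) auto
      thus ?thesis using step.prems by (simp add: D_def)
    qed
    finally show ?case using step.prems by (simp add: IR_apply clamp01)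
  qed
  thus ?thesis by (simp add: IRG[OF y])
qed

lemma rpow_continuous:
  assumes "0 \<le> m" shows "continuous_on {0..1} (\<lambda>y. rpow y m)"
proof (cases "m = 0")
  case False
  hence "m > 0" using assms by simp
  moreover have "rpow y m = y powr m" for y using False by (simp add: rpow_def)
  ultimately show ?thesis
    by (simp only:) (intro continuous_on_powr' continuous_on_id continuous_on_const, use \<open>m > 0\<close> in
        auto)
qed (simp add: rpow_def)

section \<open>The solution operator and its energy estimates\<close>

locale dirichlet_problem =
  fixes k :: nat and m :: real
  assumes k: "k \<ge> 1" and m0: "0 \<le> m" and mk: "m < real k"
begin

text \<open>On \<open>{0..1}\<close> this is (1 - y)^i / i!, so the first \<open>k\<close> of them
  span the polynomials of degree less than \<open>k\<close>. In terms of \<open>IR\<close> they fit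
  \<open>ip0_IL_pow\<close>, which turns values of repeated integrals at 1 into inner products with
  \<open>pol\<close>.\<close>

definition pol :: "nat \<Rightarrow> cfun" where "pol i = (IR ^^ i) (const_bcontfun 1)"

definition dual :: "nat \<Rightarrow> cfun" where
  "dual = (SOME d. \<forall>g. \<forall>j<k. ip0 (g - (\<Sum>i<k. ip0 g (d i) *\<^sub>R pol i)) (pol j) = 0)"

text \<open>The orthogonal projection of L^2(0,1) onto the complement of the polynomials of degree
  less than \<open>k\<close>, in the explicit form that \<open>projection_exists\<close>
  supplies.\<close>

definition P :: "cfun \<Rightarrow> cfun" where
  "P g = g - (\<Sum>i<k. ip0 g (dual i) *\<^sub>R pol i)"

text \<open>The \<open>k\<close>-th derivative of \<open>Sol F\<close> is orthogonal to all polynomials of degree less than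
  \<open>k\<close>. For a \<open>k\<close>-fold integral from the left end point, this amounts to the boundary
  conditions at \<open>1\<close>.\<close>

definition Sol :: "cfun \<Rightarrow> cfun" where
  "Sol F = (IL ^^ k) (P ((IR ^^ k) F))"

text \<open>The derivative of \<open>Sol F\<close> in y, as an operator of its own to which the
  calculus can be applied.\<close>

definition Sol' :: "cfun \<Rightarrow> cfun" where
  "Sol' F = (IL ^^ (k - 1)) (P ((IR ^^ k) F))"

text \<open>A function \<open>y\<^sup>m F\<close> is represented by \<open>F\<close>. In this form, \<open>A\<^sup>-\<^sup>1\<close> becomes \<open>K\<close>, and \<open>ip\<close>
  is the inner product with weight \<open>y\<^sup>-\<^sup>m\<close>.\<close>

definition K :: "cfun \<Rightarrow> cfun" where
  "K F = extend (\<lambda>y. (Sol F) y / rpow y m)"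

definition ip :: "cfun \<Rightarrow> cfun \<Rightarrow> real" where
  "ip F H = integral {0..1} (\<lambda>y. rpow y m * (F y * H y))"

text \<open>The integral of \<open>s powr (2 * real k - 2 - m)\<close> over (0,1), which arises from
  Cauchy-Schwarz in \<open>weighted_bound\<close>. It bounds the form of \<open>K\<close> and is
  thus the scale that turns \<open>K\<close> into a contraction.\<close>

definition c0 :: real where "c0 = 1 / (2 * real k - 1 - m)"

lemma c0_pos: "c0 > 0"
proof -
  have "real k \<ge> 1" using k by simp
  thus ?thesis using mk by (simp add: c0_def)
qed

lemma P_orth: "j < k \<Longrightarrow> ip0 (P g) (pol j) = 0"
proof -
  have "\<exists>d. \<forall>g. \<forall>j<k. ip0 (g - (\<Sum>i<k. ip0 g (d i) *\<^sub>R pol i)) (pol j) = 0"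
    by (rule projection_exists) (simp_all add: ip0_add ip0_scale ip0_pos, rule ip0_sym)
  hence "\<forall>g. \<forall>j<k. ip0 (g - (\<Sum>i<k. ip0 g (dual i) *\<^sub>R pol i)) (pol j) = 0"
    unfolding dual_def by (rule someI_ex)
  thus "j < k \<Longrightarrow> ip0 (P g) (pol j) = 0" by (simp add: P_def)
qed

text \<open>What \<open>P\<close> subtracts from \<open>h\<close> is a combination of the
  \<open>pol i\<close> with i < k, to which \<open>P g\<close> is orthogonal.\<close>

lemma ip0_P: "ip0 (P g) h = ip0 (P g) (P h)"
proof -
  have "ip0 (P g) (\<Sum>i<k. ip0 h (dual i) *\<^sub>R pol i) = 0"
    by (simp add: ip0_sum2 ip0_sym[of "P g"] ip0_scale) (simp add: ip0_sym[of _ "P g"] P_orth)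
  moreover have "ip0 (P g) (P h) = ip0 (P g) h - ip0 (P g) (\<Sum>i<k. ip0 h (dual i) *\<^sub>R pol i)"
    unfolding P_def[of h] by (subst (1 2 3) ip0_sym) (simp add: ip0_diff)
  ultimately show ?thesis by simp
qed

lemma linear_P: "linear P"
  by (rule linearI)
     (simp_all add: P_def ip0_add ip0_scale scaleR_left_distrib sum.distrib
         scaleR_right_diff_distrib scaleR_sum_right)

definition CP :: real where "CP = 1 + (\<Sum>i<k. norm (dual i) * norm (pol i))"

lemma CP_nonneg: "CP \<ge> 0" by (simp add: CP_def sum_nonneg add_nonneg_nonneg)

lemma norm_P: "norm (P g) \<le> CP * norm g"
proof -
  have "norm (P g) \<le> norm g + (\<Sum>i<k. norm (ip0 g (dual i) *\<^sub>R pol i))"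
    unfolding P_def by (rule order_trans[OF norm_triangle_ineq4]) (intro add_left_mono norm_sum)
  also have "(\<Sum>i<k. norm (ip0 g (dual i) *\<^sub>R pol i)) \<le> (\<Sum>i<k. (norm g * norm (dual i)) * norm (pol
      i))"
    unfolding norm_scaleR by (intro sum_mono mult_right_mono ip0_le) auto
  finally show ?thesis by (simp add: CP_def sum_distrib_left distrib_left mult_ac)
qed

lemma linear_Sol: "linear Sol"
proof -
  have "linear ((IL ^^ k) \<circ> (P \<circ> (IR ^^ k)))"
    by (intro linear_compose linear_P linear_funpow linear_IL linear_IR)
  thus ?thesis unfolding Sol_def by (simp add: o_def)
qed
lemma linear_Sol': "linear Sol'"
proof -
  have "linear ((IL ^^ (k - 1)) \<circ> (P \<circ> (IR ^^ k)))"
    by (intro linear_compose linear_P linear_funpow linear_IL linear_IR)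
  thus ?thesis unfolding Sol'_def by (simp add: o_def)
qed

lemma Sol_eq_IL: "Sol F = IL (Sol' F)"
  unfolding Sol_def Sol'_def by (rule funpow_pred[OF k])

lemma ip_integrable: "(\<lambda>y. rpow y m * (apply_bcontfun F y * apply_bcontfun H y)) integrable_on
    {0..1}"
  by (intro integrable_continuous_real continuous_intros rpow_continuous m0)

lemma ip_add: "ip (f + g) h = ip f h + ip g h"
  using integral_add[OF ip_integrable[of f h] ip_integrable[of g h]] by (simp add: ip_def
      distrib_right distrib_left)
lemma ip_scale: "ip (c *\<^sub>R f) h = c * ip f h"
  unfolding ip_def by (subst integral_mult_right[symmetric]) (simp add: mult_ac)
lemma ip_sym: "ip f g = ip g f" by (simp add: ip_def mult.commute)
lemma rpow_nonneg: "rpow y m \<ge> 0" by (simp add: rpow_def)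
lemma ip_pos: "ip f f \<ge> 0"
  unfolding ip_def by (rule integral_nonneg[OF ip_integrable]) (simp add: rpow_nonneg)

text \<open>Cauchy-Schwarz for the factors s^(k-1-m/2) and s^(m/2) |F s|, derived from 2ab <= l a^2
  + b^2 / l with the best \<open>l\<close>. If the energy vanishes, arbitrarily small
  \<open>l\<close> are used instead.\<close>

lemma weighted_bound: "integral {0..1} (\<lambda>s. s ^ (k - 1) * \<bar>apply_bcontfun F s\<bar>) \<le> sqrt c0 * sqrt (ip
    F F)"
proof -
  define I where "I = integral {0..1} (\<lambda>s. s ^ (k - 1) * \<bar>apply_bcontfun F s\<bar>)"
  define E where "E = ip F F"
  have E: "E \<ge> 0" by (simp add: E_def ip_pos)
  have hI: "((\<lambda>s. s ^ (k - 1) * \<bar>apply_bcontfun F s\<bar>) has_integral I) {0<..<1}"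
    unfolding I_def has_integral_Icc_iff_Ioo[symmetric]
    by (intro integrable_integral integrable_continuous_real continuous_intros)
  have hE: "((\<lambda>y. rpow y m * (apply_bcontfun F y * apply_bcontfun F y)) has_integral E) {0<..<1}"
    unfolding E_def ip_def has_integral_Icc_iff_Ioo[symmetric] by (rule integrable_integral[OF
        ip_integrable])
  have hc: "((\<lambda>s. s powr (2 * real k - 2 - m)) has_integral c0) {0<..<1}"
  proof -
    have "((\<lambda>s. s powr (2 * real k - 2 - m)) has_integral (1 powr ((2 * real k - 2 - m) + 1) / ((2 *
        real k - 2 - m) + 1))) {0..1}"
    proof (rule has_integral_powr_from_0)
      show "- 1 < 2 * real k - 2 - m" using c0_pos by (simp add: c0_def)
    qed simp
    thus ?thesis unfolding has_integral_Icc_iff_Ioo by (simp add: c0_def algebra_simps)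
  qed
  have le: "I \<le> l / 2 * c0 + 1 / (2 * l) * E" if l: "l > 0" for l
  proof (rule has_integral_le[OF hI has_integral_add[OF has_integral_mult_right[OF hc]
      has_integral_mult_right[OF hE]]])
    fix s :: real assume s: "s \<in> {0<..<1}"
    define a where "a = s powr (real k - 1 - m / 2)"
    define b where "b = s powr (m / 2) * \<bar>apply_bcontfun F s\<bar>"
    have rp: "rpow s m = s powr m" using s by (simp add: rpow_def)
    have "s ^ (k - 1) = s powr real (k - 1)" using s by (simp add: powr_realpow)
    also have "\<dots> = s powr (real k - 1 - m / 2) * s powr (m / 2)" using k by (simp add: of_nat_diff
        flip: powr_add)
    finally have ab: "s ^ (k - 1) * \<bar>apply_bcontfun F s\<bar> = a * b" by (simp add: a_def b_def)
    have a2: "s powr (2 * real k - 2 - m) = a\<^sup>2" unfolding a_def power2_eq_square by (simp add: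
        algebra_simps flip: powr_add)
    have b2: "rpow s m * (apply_bcontfun F s * apply_bcontfun F s) = b\<^sup>2"
    proof -
      have "s powr m = (s powr (m / 2))\<^sup>2" unfolding power2_eq_square by (simp flip: powr_add)
      thus ?thesis by (simp add: b_def rp power_mult_distrib power2_eq_square)
    qed
    have "0 \<le> (l * a - b)\<^sup>2" by simp
    hence "2 * l * (a * b) \<le> l\<^sup>2 * a\<^sup>2 + b\<^sup>2" by (simp add: power2_eq_square algebra_simps)
    hence "a * b \<le> (l\<^sup>2 * a\<^sup>2 + b\<^sup>2) / (2 * l)" using l by (simp add: pos_le_divide_eq mult_ac)
    also have "\<dots> = l / 2 * a\<^sup>2 + 1 / (2 * l) * b\<^sup>2" using l by (simp add: field_simps
        power2_eq_square)
    finally show "s ^ (k - 1) * \<bar>apply_bcontfun F s\<bar> \<le> l / 2 * s powr (2 * real k - 2 - m) + 1 / (2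
        * l) * (rpow s m * (apply_bcontfun F s * apply_bcontfun F s))"
      unfolding ab a2 b2 .
  qed
  have "I \<le> sqrt c0 * sqrt E"
  proof (cases "E = 0")
    case True
    have "I \<le> 0 + e" if e: "e > 0" for e
      using le[of "2 * e / c0"] e c0_pos True by simp
    hence "I \<le> 0" by (rule field_le_epsilon)
    thus ?thesis using True by simp
  next
    case False
    hence E0: "E > 0" using E by linarith
    define l where "l = sqrt E / sqrt c0"
    have l: "l > 0" using E0 c0_pos by (simp add: l_def)
    have 1: "l * c0 = sqrt c0 * sqrt E"
      using c0_pos real_sqrt_mult_self[of c0] unfolding l_def by (simp add: field_simps)
    have 2: "1 / l * E = sqrt c0 * sqrt E"
      using E0 real_sqrt_mult_self[of E] unfolding l_def by (simp add: field_simps)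
    have "I \<le> (l * c0) / 2 + (1 / l * E) / 2" using le[OF l] by (simp add: mult.commute)
    thus ?thesis unfolding 1 2 by (simp add: mult.commute)
  qed
  thus ?thesis by (simp add: I_def E_def)
qed

lemma norm_IR_pow: "norm ((IR ^^ k) F) \<le> sqrt c0 * sqrt (ip F F)"
proof (rule norm_bound)
  fix y :: real
  define z where "z = max 0 (min 1 y)"
  have z: "z \<in> {0..1}" by (auto simp: z_def)
  have "((IR ^^ k) F) y = ((IR ^^ k) F) z"
    unfolding funpow_pred[OF k] by (simp add: IR_apply z_def)
  hence "norm (((IR ^^ k) F) y) = \<bar>((IR ^^ k) F) z\<bar>" by simp
  also have "\<dots> \<le> integral {z..1} (\<lambda>s. s ^ (k - 1) * \<bar>F s\<bar>)" by (rule IR_pow_le[OF k z])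
  also have "\<dots> \<le> integral {0..1} (\<lambda>s. s ^ (k - 1) * \<bar>F s\<bar>)"
    using z by (intro integral_subset_le integrable_continuous_real continuous_intros) auto
  also have "\<dots> \<le> sqrt c0 * sqrt (ip F F)" by (rule weighted_bound)
  finally show "norm (((IR ^^ k) F) y) \<le> sqrt c0 * sqrt (ip F F)" .
qed

definition CS :: real where "CS = CP * sqrt c0"

lemma CS_nonneg: "CS \<ge> 0" using CP_nonneg c0_pos by (simp add: CS_def)

lemma norm_P_IR: "norm (P ((IR ^^ k) F)) \<le> CS * sqrt (ip F F)"
proof -
  have "norm (P ((IR ^^ k) F)) \<le> CP * norm ((IR ^^ k) F)" by (rule norm_P)
  also have "\<dots> \<le> CP * (sqrt c0 * sqrt (ip F F))" by (intro mult_left_mono norm_IR_pow CP_nonneg)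
  finally show ?thesis by (simp add: CS_def)
qed

lemma norm_Sol: "norm (Sol F) \<le> CS * sqrt (ip F F)"
  unfolding Sol_def by (rule order_trans[OF norm_IL_pow norm_P_IR])
lemma norm_Sol': "norm (Sol' F) \<le> CS * sqrt (ip F F)"
  unfolding Sol'_def by (rule order_trans[OF norm_IL_pow norm_P_IR])

lemma Sol_le: "y \<in> {0..1} \<Longrightarrow> \<bar>(Sol F) y\<bar> \<le> norm (P ((IR ^^ k) F)) * y ^ k"
  unfolding Sol_def by (rule IL_pow_le)

text \<open>\<open>Sol F\<close> has a zero of order \<open>k\<close> at 0, and since m < k a
  positive power remains after division by y^m. So the quotient tends to 0, which is also the value
  that the formal division gives at y = 0.\<close>

lemma Sol_div_le:
  assumes y: "y \<in> {0..1}"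
  shows "\<bar>(Sol F) y / rpow y m\<bar> \<le> norm (P ((IR ^^ k) F)) * y powr (real k - m)"
proof (cases "y = 0")
  case True
  thus ?thesis by (simp add: Sol_eq_IL IL_0)
next
  case False
  hence y0: "y > 0" using y by simp
  have "\<bar>(Sol F) y / rpow y m\<bar> \<le> norm (P ((IR ^^ k) F)) * y ^ k / rpow y m"
    using Sol_le[OF y, of F] rpow_nonneg[of y] by (simp add: divide_right_mono)
  also have "\<dots> = norm (P ((IR ^^ k) F)) * (y powr (real k) / y powr m)"
    using y0 by (simp add: rpow_def powr_realpow)
  finally show ?thesis by (simp add: powr_diff)
qed

lemma continuous_Sol_div: "continuous_on {0..1} (\<lambda>y. (Sol F) y / rpow y m)"
  unfolding continuous_on_def
proof
  fix y :: real assume y: "y \<in> {0..1}"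
  show "((\<lambda>y. (Sol F) y / rpow y m) \<longlongrightarrow> (Sol F) y / rpow y m) (at y within {0..1})"
  proof (cases "y = 0")
    case True
    have "((\<lambda>y. norm (P ((IR ^^ k) F)) * y powr (real k - m)) \<longlongrightarrow> norm (P ((IR ^^ k) F)) * 0 powr
        (real k - m)) (at 0 within {0..1})"
    proof -
      have "continuous_on {0..1} (\<lambda>y. norm (P ((IR ^^ k) F)) * y powr (real k - m))"
        using mk by (intro continuous_intros continuous_on_powr') auto
      thus ?thesis unfolding continuous_on_def by (rule bspec) simp
    qed
    hence "((\<lambda>y. norm (P ((IR ^^ k) F)) * y powr (real k - m)) \<longlongrightarrow> 0) (at 0 within {0..1})" by simp
    hence "((\<lambda>y. (Sol F) y / rpow y m) \<longlongrightarrow> 0) (at 0 within {0..1})"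
      by (rule Lim_null_comparison[rotated]) (use Sol_div_le in \<open>auto simp: eventually_at_filter\<close>)
    moreover have "(Sol F) 0 = 0" by (simp add: Sol_eq_IL IL_0)
    ultimately show ?thesis using True by simp
  next
    case False
    hence y0: "y > 0" using y by simp
    have "((\<lambda>y. rpow y m) \<longlongrightarrow> rpow y m) (at y within {0..1})"
      using rpow_continuous[OF m0] y by (auto simp: continuous_on_def)
    moreover have "((Sol F) \<longlongrightarrow> (Sol F) y) (at y within {0..1})"
      using continuous_on_apply_bcontfun[of "{0..1}" "Sol F"] y by (simp add: continuous_on_def)
    ultimately show ?thesis using y0 by (intro tendsto_divide) (auto simp: rpow_def)
  qed
qed

lemma K_apply_clamp: "(K F) y = (Sol F) (max 0 (min 1 y)) / rpow (max 0 (min 1 y)) m"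
  unfolding K_def by (rule extend_apply[OF continuous_Sol_div])

lemma K_apply: "y \<in> {0..1} \<Longrightarrow> (K F) y = (Sol F) y / rpow y m"
  unfolding K_def by (rule extend_eq[OF continuous_Sol_div])

lemma rpow_K: "y \<in> {0..1} \<Longrightarrow> rpow y m * (K F) y = (Sol F) y"
  by (cases "y = 0") (auto simp: K_apply rpow_def Sol_eq_IL IL_0)

lemma linear_K: "linear K"
  by (rule linearI; rule bcontfun_eqI)
     (simp_all add: K_apply_clamp linear_add[OF linear_Sol] linear_scale[OF linear_Sol]
         add_divide_distrib)

lemma norm_K: "norm (K F) \<le> CS * sqrt (ip F F)"
proof (rule norm_bound)
  fix y :: real
  define z where "z = max 0 (min 1 y)"
  have z: "z \<in> {0..1}" by (auto simp: z_def)
  have "norm ((K F) y) = \<bar>(Sol F) z / rpow z m\<bar>"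
    by (simp add: K_apply_clamp z_def)
  also have "\<dots> \<le> norm (P ((IR ^^ k) F)) * z powr (real k - m)" by (rule Sol_div_le[OF z])
  also have "\<dots> \<le> norm (P ((IR ^^ k) F)) * 1" using z mk by (intro mult_left_mono powr_le1) auto
  also have "\<dots> \<le> CS * sqrt (ip F F)" using norm_P_IR[of F] by simp
  finally show "norm ((K F) y) \<le> CS * sqrt (ip F F)" .
qed

text \<open>The weight y^m cancels the division in \<open>K\<close>, and the \<open>k\<close>
  integrations in \<open>Sol\<close> pass to the other side as \<open>IR ^^ k\<close>. From the
  right-hand side both symmetry and positivity of \<open>K\<close> can be read off.\<close>

lemma ip_K: "ip (K F) H = ip0 (P ((IR ^^ k) F)) (P ((IR ^^ k) H))"
proof -
  have "ip (K F) H = ip0 (Sol F) H"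
    unfolding ip_def ip0_def by (intro integral_cong) (simp add: rpow_K flip: mult.assoc)
  also have "\<dots> = ip0 (P ((IR ^^ k) F)) ((IR ^^ k) H)" unfolding Sol_def by (rule ip0_IL_pow)
  also have "\<dots> = ip0 (P ((IR ^^ k) F)) (P ((IR ^^ k) H))" by (rule ip0_P)
  finally show ?thesis .
qed

text \<open>The projection \<open>P\<close> does not increase the L^2 norm, and on the unit interval
  this norm is at most the maximum norm estimated in \<open>norm_IR_pow\<close>.\<close>

lemma ip_K_le: "ip (K F) F \<le> c0 * ip F F"
proof -
  define a where "a = (IR ^^ k) F"
  have "ip0 (P a) (P a) \<le> ip0 a a"
  proof -
    have "ip0 (a - P a) (a - P a) = ip0 a a - ip0 (P a) (P a)"
      using ip0_P[of a a] ip0_sym[of a "P a"] by (simp add: ip0_diff ip0_diff2)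
    thus ?thesis using ip0_pos[of "a - P a"] by simp
  qed
  also have "\<dots> \<le> norm a * norm a" using ip0_le[of a a] by simp
  also have "\<dots> \<le> (sqrt c0 * sqrt (ip F F)) * (sqrt c0 * sqrt (ip F F))"
    unfolding a_def using c0_pos ip_pos by (intro mult_mono norm_IR_pow) auto
  also have "\<dots> = (sqrt c0)\<^sup>2 * (sqrt (ip F F))\<^sup>2" by (simp only: power2_eq_square mult_ac)
  also have "\<dots> = c0 * ip F F" using c0_pos ip_pos[of F] by simp
  finally show ?thesis by (simp add: ip_K a_def)
qed

sublocale positive_contraction ip "\<lambda>F. (1 / c0) *\<^sub>R K F"
proof (rule positive_contraction.intro)
  show "linear (\<lambda>F. (1 / c0) *\<^sub>R K F)" by (intro linear_compose_scale_right linear_K)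
  show "ip ((1 / c0) *\<^sub>R K f) g = ip f ((1 / c0) *\<^sub>R K g)" for f g
    unfolding ip_scale ip_sym[of f] ip_K by (simp only: ip0_sym)
  show "0 \<le> ip ((1 / c0) *\<^sub>R K f) f" for f
    using ip_K[of f f] ip0_pos c0_pos by (simp add: ip_scale)
  show "ip ((1 / c0) *\<^sub>R K f) f \<le> ip f f" for f
    using ip_K_le[of f] c0_pos by (simp add: ip_scale field_simps)
qed (simp_all add: ip_add ip_scale ip_pos, rule ip_sym)

end

section \<open>Iterated one-sided derivatives and uniqueness for the Dirichlet problem\<close>

lemma nderiv_within_Suc: "nderiv_within (Suc n) f S = (\<lambda>y. vector_derivative (nderiv_within n f S)
    (at y within S))"
  by (simp add: nderiv_within_def)

lemma nderiv_within_0: "nderiv_within 0 f S = f"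
  by (simp add: nderiv_within_def)

lemma nderiv_chain:
  assumes d: "\<And>j y. j < n \<Longrightarrow> y \<in> {0..1} \<Longrightarrow> (d j has_real_derivative d (Suc j) y) (at y within {0..1})"
    and f: "\<And>y. y \<in> {0..1} \<Longrightarrow> f y = d 0 y"
  shows nderiv_chain_eq: "j \<le> n \<Longrightarrow> y \<in> {0..1} \<Longrightarrow> nderiv_within j f {0..1} y = d j y"
    and nderiv_chain_differentiable: "times_differentiable_on n f {0..1}"
proof -
  have trans: "(nderiv_within j f {0..1} has_real_derivative d (Suc j) y) (at y within {0..1})"
    if "\<And>y. y \<in> {0..1} \<Longrightarrow> nderiv_within j f {0..1} y = d j y" "j < n" "y \<in> {0..1}" for j y
    by (rule has_field_derivative_transform_within[OF d[OF that(2,3)], where d = 1]) (use that in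
        auto)
  have eq: "nderiv_within j f {0..1} y = d j y" if "j \<le> n" "y \<in> {0..1}" for j y
    using that
  proof (induction j arbitrary: y)
    case 0
    thus ?case using f by (simp add: nderiv_within_0)
  next
    case (Suc j)
    have "(nderiv_within j f {0..1} has_real_derivative d (Suc j) y) (at y within {0..1})"
      by (rule trans) (use Suc in auto)
    hence "vector_derivative (nderiv_within j f {0..1}) (at y within cbox 0 1) = d (Suc j) y"
      unfolding has_real_derivative_iff_has_vector_derivative using Suc.prems
      by (intro vector_derivative_within_cbox) auto
    thus ?case by (simp add: nderiv_within_Suc)
  qed
  show "j \<le> n \<Longrightarrow> y \<in> {0..1} \<Longrightarrow> nderiv_within j f {0..1} y = d j y" by (rule eq)
  show "times_differentiable_on n f {0..1}"
    unfolding times_differentiable_on_def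
    using trans eq by (meson less_imp_le_nat real_differentiable_def)
qed

lemma times_differentiable_on_imp_derivative:
  assumes "times_differentiable_on n f {0..1}" "j < n" "y \<in> {0..1}"
  shows "(nderiv_within j f {0..1} has_real_derivative nderiv_within (Suc j) f {0..1} y) (at y
      within {0..1})"
  using assms unfolding times_differentiable_on_def nderiv_within_Suc
      has_real_derivative_iff_has_vector_derivative
  by (simp add: vector_derivative_works)

text \<open>The energy method: \<open>k\<close> integrations by parts turn the integral of
  \<open>d 0\<close> times \<open>d (2 * k)\<close>, which is zero, into that of the square of
  \<open>d k\<close> up to sign. So \<open>d k\<close> vanishes, and the conditions at 0 give the
  same for \<open>d (k - 1)\<close> down to \<open>d 0\<close>.\<close>

lemma dirichlet_unique:
  fixes d :: "nat \<Rightarrow> real \<Rightarrow> real"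
  assumes k: "k \<ge> 1"
    and d: "\<And>j y. j < 2 * k \<Longrightarrow> y \<in> {0..1} \<Longrightarrow> (d j has_real_derivative d (Suc j) y) (at y within
        {0..1})"
    and z: "\<And>y. y \<in> {0..1} \<Longrightarrow> d (2 * k) y = 0"
    and bc: "\<And>s. s < k \<Longrightarrow> d s 0 = 0" "\<And>s. s < k \<Longrightarrow> d s 1 = 0"
    and y: "y \<in> {0..1}"
  shows "d 0 y = 0"
proof -
  have cont: "continuous_on {0..1} (d j)" if "j < 2 * k" for j
    using d[OF that] by (meson DERIV_continuous_on)
  define I where "I = (\<lambda>j. integral {0..1} (\<lambda>y. d (k - j) y * d (k + j) y))"
  \<comment> \<open>The boundary terms contain \<open>d (k - Suc j)\<close>, which vanishes at both
    ends.\<close>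
  have step: "I (Suc j) = - I j" if j: "j < k" for j
  proof -
    let ?f = "\<lambda>y. d (k - Suc j) y * d (k + j) y"
    have e: "Suc (k - Suc j) = k - j" using j by simp
    have "((\<lambda>y. d (k - j) y * d (k + j) y + d (k + Suc j) y * d (k - Suc j) y) has_integral (?f 1 -
        ?f 0)) {0..1}"
    proof (rule fundamental_theorem_of_calculus)
      fix y :: real assume y: "y \<in> {0..1}"
      have "(?f has_real_derivative (d (Suc (k - Suc j)) y * d (k + j) y + d (Suc (k + j)) y * d (k
          - Suc j) y)) (at y within {0..1})"
        using j by (intro DERIV_mult d y) auto
      thus "(?f has_vector_derivative (d (k - j) y * d (k + j) y + d (k + Suc j) y * d (k - Suc j)
          y)) (at y within {0..1})"
        by (simp add: has_real_derivative_iff_has_vector_derivative e)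
    qed simp
    moreover have "((\<lambda>y. d (k - j) y * d (k + j) y) has_integral I j) {0..1}"
      unfolding I_def using j by (intro integrable_integral integrable_continuous_real
          continuous_intros cont) auto
    ultimately have "((\<lambda>y. (d (k - j) y * d (k + j) y + d (k + Suc j) y * d (k - Suc j) y) - d (k -
        j) y * d (k + j) y) has_integral (?f 1 - ?f 0) - I j) {0..1}"
      by (rule has_integral_diff)
    hence "((\<lambda>y. d (k - Suc j) y * d (k + Suc j) y) has_integral - I j) {0..1}"
      using bc[of "k - Suc j"] k by (simp add: mult.commute)
    thus ?thesis unfolding I_def by (rule integral_unique)
  qed
  have "j \<le> k \<Longrightarrow> \<bar>I j\<bar> = \<bar>I 0\<bar>" for j by (induction j) (auto simp: step)
  from this[of k] have "\<bar>I k\<bar> = \<bar>I 0\<bar>" by simp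
  moreover have "I k = integral {0..1} (\<lambda>y::real. 0)"
    unfolding I_def by (rule Henstock_Kurzweil_Integration.integral_cong) (use z in \<open>simp add:
        mult_2\<close>)
  ultimately have "integral {0..1} (\<lambda>y. d k y * d k y) = 0" by (simp add: I_def)
  hence dk: "\<forall>y\<in>{0..1}. d k y * d k y = 0"
    using k by (subst (asm) integral_eq_0_iff) (auto intro!: continuous_intros cont)
  have "j \<le> k \<Longrightarrow> y \<in> {0..1} \<Longrightarrow> d (k - j) y = 0" for j y
  proof (induction j arbitrary: y)
    case 0
    thus ?case using dk by simp
  next
    case (Suc j)
    have e: "Suc (k - Suc j) = k - j" using Suc by simp
    have "\<exists>c. \<forall>x\<in>{0..1}. d (k - Suc j) x = c"
    proof (rule has_field_derivative_zero_constant)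
      fix x :: real assume x: "x \<in> {0..1}"
      show "(d (k - Suc j) has_real_derivative 0) (at x within {0..1})"
        using d[of "k - Suc j" x] x k Suc by (simp add: e)
    qed simp
    then obtain c where c: "\<And>x. x \<in> {0..1} \<Longrightarrow> d (k - Suc j) x = c" by blast
    moreover have "d (k - Suc j) 0 = 0" using Suc k by (intro bc) auto
    ultimately show ?case using Suc.prems by (metis atLeastAtMost_iff order_refl zero_le_one)
  qed
  from this[of k y] y show ?thesis by simp
qed

context dirichlet_problem
begin

definition pol_deriv :: "nat \<Rightarrow> nat \<Rightarrow> real \<Rightarrow> real" where
  "pol_deriv i n y = (if n \<le> i then (-1) ^ n * (pol (i - n)) y else 0)"

definition upper_deriv :: "cfun \<Rightarrow> nat \<Rightarrow> real \<Rightarrow> real" where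
  "upper_deriv F n y = (-1) ^ n * ((IR ^^ (k - n)) F) y
     - (\<Sum>i<k. ip0 ((IR ^^ k) F) (dual i) * pol_deriv i n y)"

text \<open>Up to order \<open>k\<close> differentiation removes integrations \<open>IL\<close>;
  beyond, it acts on \<open>P ((IR ^^ k) F)\<close>, where it removes \<open>IR\<close> with a sign
  each time and lowers the degree of the polynomial part. At order 2k the polynomials are gone and
  (-1)^k F is left.\<close>

definition Sol_deriv :: "cfun \<Rightarrow> nat \<Rightarrow> real \<Rightarrow> real" where
  "Sol_deriv F j = (if j \<le> k then apply_bcontfun ((IL ^^ (k - j)) (P ((IR ^^ k) F))) else
      upper_deriv F (j - k))"

lemma IR_pow_has_derivative:
  assumes "y \<in> {0..1}"
  shows "(((IR ^^ Suc n) F) has_real_derivative - ((IR ^^ n) F) y) (at y within {0..1})"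
  using IR_has_derivative[OF assms, of "(IR ^^ n) F"] by simp

lemma pol_deriv_has_derivative:
  assumes y: "y \<in> {0..1}"
  shows "(pol_deriv i n has_real_derivative pol_deriv i (Suc n) y) (at y within {0..1})"
proof -
  consider "n < i" | "n = i" | "n > i" by linarith
  thus ?thesis
  proof cases
    case 1
    hence e: "i - n = Suc (i - Suc n)" by simp
    have "((\<lambda>y. (-1) ^ n * (pol (i - n)) y) has_real_derivative (-1) ^ n * - (pol (i - Suc n)) y)
        (at y within {0..1})"
      unfolding pol_def e by (intro DERIV_cmult IR_pow_has_derivative y)
    thus ?thesis using 1 by (simp add: pol_deriv_def[abs_def])
  next
    case 2
    thus ?thesis by (simp add: pol_deriv_def[abs_def] pol_def)
  next
    case 3
    thus ?thesis by (simp add: pol_deriv_def[abs_def])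
  qed
qed

lemma upper_deriv_has_derivative:
  assumes y: "y \<in> {0..1}" and n: "n < k"
  shows "(upper_deriv F n has_real_derivative upper_deriv F (Suc n) y) (at y within {0..1})"
proof -
  have e: "k - n = Suc (k - Suc n)" using n by simp
  have "((\<lambda>y. (-1) ^ n * ((IR ^^ (k - n)) F) y - (\<Sum>i<k. ip0 ((IR ^^ k) F) (dual i) * pol_deriv i n
      y)) has_real_derivative
     ((-1) ^ n * - ((IR ^^ (k - Suc n)) F) y - (\<Sum>i<k. ip0 ((IR ^^ k) F) (dual i) * pol_deriv i (Suc
         n) y))) (at y within {0..1})"
    unfolding e by (intro DERIV_diff DERIV_sum DERIV_cmult IR_pow_has_derivative
        pol_deriv_has_derivative y)
  thus ?thesis by (simp add: upper_deriv_def[abs_def])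
qed

lemma upper_deriv_0: "upper_deriv F 0 y = (P ((IR ^^ k) F)) y"
proof -
  have "(\<Sum>i\<in>I. c i *\<^sub>R p i) y = (\<Sum>i\<in>I. c i * (p i) y)" for I and c :: "nat \<Rightarrow> real" and p :: "nat \<Rightarrow>
      cfun"
    by (induction I rule: infinite_finite_induct) auto
  thus ?thesis by (simp add: upper_deriv_def pol_deriv_def P_def)
qed

lemma Sol_deriv_has_derivative:
  assumes y: "y \<in> {0..1}" and j: "j < 2 * k"
  shows "(Sol_deriv F j has_real_derivative Sol_deriv F (Suc j) y) (at y within {0..1})"
proof (cases "j < k")
  case True
  hence e: "k - j = Suc (k - Suc j)" by simp
  show ?thesis using True IL_has_derivative[OF y, of "(IL ^^ (k - Suc j)) (P ((IR ^^ k) F))"]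
    unfolding Sol_deriv_def by (simp add: e)
next
  case False
  have "Sol_deriv F j = upper_deriv F (j - k)"
    using False by (cases "j = k") (auto simp: Sol_deriv_def upper_deriv_0 fun_eq_iff)
  moreover have "Sol_deriv F (Suc j) = upper_deriv F (Suc (j - k))"
    using False by (simp add: Sol_deriv_def Suc_diff_le)
  ultimately show ?thesis using upper_deriv_has_derivative[OF y, of "j - k" F] False j by simp
qed

lemma Sol_deriv_top: "Sol_deriv F (2 * k) y = (-1) ^ k * F y"
  using k by (simp add: Sol_deriv_def upper_deriv_def pol_deriv_def)

text \<open>At 1 the value is an integral over the whole interval, which \<open>ip0_IL_pow\<close>
  rewrites as the inner product of \<open>P ((IR ^^ k) F)\<close> with
  \<open>pol (k - Suc s)\<close>; it is zero by \<open>P_orth\<close>.\<close>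

lemma Sol_deriv_boundary:
  assumes s: "s < k"
  shows "Sol_deriv F s 0 = 0" "Sol_deriv F s 1 = 0"
proof -
  define G where "G = P ((IR ^^ k) F)"
  have e: "k - s = Suc (k - Suc s)" using s by simp
  have D: "Sol_deriv F s = (IL ((IL ^^ (k - Suc s)) G))"
    using s unfolding Sol_deriv_def G_def by (simp add: e)
  show "Sol_deriv F s 0 = 0" unfolding D by (rule IL_0)
  have "(IL ((IL ^^ (k - Suc s)) G)) 1 = ip0 ((IL ^^ (k - Suc s)) G) (const_bcontfun 1)"
    by (simp add: IL_apply ip0_def)
  also have "\<dots> = ip0 G (pol (k - Suc s))" by (simp add: ip0_IL_pow pol_def)
  also have "\<dots> = 0" unfolding G_def using s by (intro P_orth) auto
  finally show "Sol_deriv F s 1 = 0" unfolding D .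
qed

lemma Sol_deriv_0: "Sol_deriv F 0 = (Sol F)"
  by (simp add: Sol_deriv_def Sol_def)

lemma
  shows Sol_times_differentiable: "times_differentiable_on (2 * k) ((Sol F)) {0..1}"
    and Sol_nderiv: "j \<le> 2 * k \<Longrightarrow> y \<in> {0..1} \<Longrightarrow> nderiv_within j ((Sol F)) {0..1} y = Sol_deriv F j y"
  using nderiv_chain[of "2 * k" "Sol_deriv F" "(Sol F)"] Sol_deriv_has_derivative
  by (simp_all add: Sol_deriv_0)

lemma Sol_unique:
  assumes diff: "times_differentiable_on (2 * k) \<tau> {0..1}"
    and bc: "\<And>s. s < k \<Longrightarrow> nderiv_within s \<tau> {0..1} 0 = 0 \<and> nderiv_within s \<tau> {0..1} 1 = 0"
    and G: "\<And>y. y \<in> {0..1} \<Longrightarrow> apply_bcontfun G y = (-1) ^ k * nderiv_within (2 * k) \<tau> {0..1} y"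
    and y: "y \<in> {0..1}"
  shows "\<tau> y = apply_bcontfun (Sol G) y"
proof -
  define d where "d = (\<lambda>j y. nderiv_within j \<tau> {0..1} y - Sol_deriv G j y)"
  have "d 0 y = 0"
  proof (rule dirichlet_unique[of k d])
    show "(d j has_real_derivative d (Suc j) y) (at y within {0..1})" if "j < 2 * k" "y \<in> {0..1}"
        for j y
      unfolding d_def by (intro DERIV_diff times_differentiable_on_imp_derivative[OF diff]
          Sol_deriv_has_derivative that)
    show "d (2 * k) y = 0" if "y \<in> {0..1}" for y
      using G[OF that] by (simp add: d_def Sol_deriv_top flip: mult.assoc power_add)
    show "d s 0 = 0" "d s 1 = 0" if "s < k" for s
      using bc[OF that] Sol_deriv_boundary[OF that] by (simp_all add: d_def)
  qed (use k y in auto)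
  thus ?thesis by (simp add: d_def Sol_deriv_0 nderiv_within_0)
qed

text \<open>In \<open>data_representation\<close> two functions are compared after multiplication by
  y^m, which for m > 0 says nothing about the point 0; integrals do not see that point.\<close>

lemma Sol_cong:
  assumes "\<And>y. y \<in> {0<..1} \<Longrightarrow> apply_bcontfun F y = apply_bcontfun G y"
  shows "Sol F = Sol G"
proof -
  have "IR F = IR G"
    by (rule bcontfun_eqI, unfold IR_apply, rule integral_spike[of "{0}"]) (use assms in auto)
  hence "(IR ^^ k) F = (IR ^^ k) G"
    using k by (metis funpow_swap1 funpow_pred)
  thus ?thesis by (simp add: Sol_def)
qed

text \<open>Uniqueness is applied twice: to \<open>\<tau>\<close> with right-hand side
  \<open>G\<close>, and to y^m times the derivative of \<open>\<tau>\<close> of order 2k, whose own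
  derivative of that order is \<open>f\<close>. The two signs (-1)^k cancel, so y^m f is A^2 applied
  to \<open>\<tau>\<close>.\<close>

lemma data_representation:
  assumes \<tau>: "Ck_on (2 * k) \<tau> {0..1}"
    and bc: "\<And>s. s < k \<Longrightarrow> nderiv_within s \<tau> {0..1} 0 = 0 \<and> nderiv_within s \<tau> {0..1} 1 = 0"
    and w: "Ck_on (2 * k) (\<lambda>y. rpow y m * nderiv_within (2 * k) \<tau> {0..1} y) {0..1}"
    and bc': "\<And>s. s < k \<Longrightarrow> nderiv_within s (\<lambda>y. rpow y m * nderiv_within (2 * k) \<tau> {0..1} y) {0..1} 0
        = 0 \<and>
                nderiv_within s (\<lambda>y. rpow y m * nderiv_within (2 * k) \<tau> {0..1} y) {0..1} 1 = 0"
  obtains f where "\<And>y. y \<in> {0..1} \<Longrightarrow> \<tau> y = (Sol (K f)) y"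
proof -
  define w where "w = (\<lambda>y. rpow y m * nderiv_within (2 * k) \<tau> {0..1} y)"
  define G where "G = extend (\<lambda>y. (-1) ^ k * nderiv_within (2 * k) \<tau> {0..1} y)"
  define f where "f = extend (nderiv_within (2 * k) w {0..1})"
  have c1: "continuous_on {0..1} (nderiv_within (2 * k) \<tau> {0..1})" using \<tau> by (simp add: Ck_on_def)
  have c2: "continuous_on {0..1} (nderiv_within (2 * k) w {0..1})" using w by (simp add: Ck_on_def
      w_def)
  have G: "G y = (-1) ^ k * nderiv_within (2 * k) \<tau> {0..1} y" if "y \<in> {0..1}" for y
    unfolding G_def by (rule extend_eq[OF _ that]) (intro continuous_intros c1)
  have f: "f y = nderiv_within (2 * k) w {0..1} y" if "y \<in> {0..1}" for y
    unfolding f_def by (rule extend_eq[OF c2 that])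
  have \<tau>G: "\<tau> y = (Sol G) y" if "y \<in> {0..1}" for y
    by (rule Sol_unique[OF _ bc G that]) (use \<tau> in \<open>simp_all add: Ck_on_def\<close>)
  have wf: "w y = (Sol ((-1) ^ k *\<^sub>R f)) y" if "y \<in> {0..1}" for y
    by (rule Sol_unique[OF _ _ _ that]) (use w bc' f in \<open>simp_all add: Ck_on_def w_def\<close>)
  have "(K f) y = G y" if y: "y \<in> {0<..1}" for y
  proof -
    have y1: "y \<in> {0..1}" using y by simp
    have r: "rpow y m \<noteq> 0" using y by (simp add: rpow_def)
    have "rpow y m * (K f) y = (-1) ^ k * (Sol ((-1) ^ k *\<^sub>R f)) y"
      unfolding rpow_K[OF y1] linear_scale[OF linear_Sol] by (simp flip: mult.assoc power_add)
    also have "\<dots> = (-1) ^ k * w y" by (simp add: wf[OF y1])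
    also have "\<dots> = rpow y m * G y" by (simp add: G[OF y1] w_def)
    finally show ?thesis using r by simp
  qed
  hence "Sol (K f) = Sol G" by (rule Sol_cong)
  thus ?thesis using \<tau>G by (intro that[of f]) simp
qed

end

section \<open>Scalar solutions\<close>

lemma powr_has_derivative_at_0:
  fixes \<alpha> :: real
  assumes \<alpha>: "1 < \<alpha>" and x: "x \<in> {0..1}"
  shows "((\<lambda>x. x powr \<alpha>) has_real_derivative \<alpha> * x powr (\<alpha> - 1)) (at x within {0..1})"
proof (cases "x = 0")
  case False
  thus ?thesis using x by (intro has_field_derivative_at_within[OF has_real_derivative_powr]) auto
next
  case True
  have "((\<lambda>y. y powr (\<alpha> - 1)) \<longlongrightarrow> 0) (at 0 within {0..1})"
  proof -
    have "((\<lambda>y. y powr (\<alpha> - 1)) \<longlongrightarrow> 0 powr (\<alpha> - 1)) (at 0 within {0..1})"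
      using \<alpha> by (intro tendsto_powr' tendsto_ident_at tendsto_const) (auto simp:
          eventually_at_filter)
    thus ?thesis by simp
  qed
  moreover have "eventually (\<lambda>y. y powr (\<alpha> - 1) = (y powr \<alpha> - 0 powr \<alpha>) / (y - 0)) (at 0 within
      {0..1})"
    unfolding eventually_at_filter by (auto intro!: always_eventually simp: powr_diff)
  ultimately have "((\<lambda>y. (y powr \<alpha> - 0 powr \<alpha>) / (y - 0)) \<longlongrightarrow> 0) (at 0 within {0..1})"
    using tendsto_cong by fast
  thus ?thesis using True \<alpha> by (simp add: has_field_derivative_iff)
qed

text \<open>For the index \<alpha> - 1, \<open>mlf_deriv_eq\<close> expresses z times the derivative
  by the functions of index \<alpha> - 2 and \<alpha> - 1. Both are bounded, hence decay like
  1/z.\<close>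

lemma mlf_deriv_decay:
  assumes \<alpha>: "1 < \<alpha>" "\<alpha> < 2"
  obtains B where "\<And>z. z \<ge> 0 \<Longrightarrow> \<bar>mlf_deriv \<alpha> (\<alpha> - 1) z\<bar> \<le> B" "(mlf_deriv \<alpha> (\<alpha> - 1) \<longlongrightarrow> 0) at_top"
proof -
  obtain B1 where B1: "\<And>z. z \<ge> 0 \<Longrightarrow> \<bar>mlf \<alpha> (\<alpha> - real 1) z\<bar> \<le> B1" using mlf_bounded[OF \<alpha>, of 1] by
      auto
  obtain B2 where B2: "\<And>z. z \<ge> 0 \<Longrightarrow> \<bar>mlf \<alpha> (\<alpha> - real 2) z\<bar> \<le> B2" using mlf_bounded[OF \<alpha>, of 2] by
      auto
  define C where "C = (B2 + (2 - \<alpha>) * B1) / \<alpha>"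
  have le: "\<bar>mlf_deriv \<alpha> (\<alpha> - 1) z\<bar> \<le> C / z" if z: "z > 0" for z
  proof -
    have "\<alpha> * z * mlf_deriv \<alpha> (\<alpha> - 1) z = mlf \<alpha> (\<alpha> - 2) z + (2 - \<alpha>) * mlf \<alpha> (\<alpha> - 1) z"
      using mlf_deriv_eq[OF \<alpha>(1), of z "\<alpha> - 1"] by (simp add: algebra_simps)
    hence "\<alpha> * z * \<bar>mlf_deriv \<alpha> (\<alpha> - 1) z\<bar> = \<bar>mlf \<alpha> (\<alpha> - 2) z + (2 - \<alpha>) * mlf \<alpha> (\<alpha> - 1) z\<bar>"
      using z \<alpha> by (metis abs_mult abs_of_pos less_trans zero_less_one mult_pos_pos)
    also have "\<dots> \<le> \<bar>mlf \<alpha> (\<alpha> - 2) z\<bar> + (2 - \<alpha>) * \<bar>mlf \<alpha> (\<alpha> - 1) z\<bar>"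
      using \<alpha> by (intro order_trans[OF abs_triangle_ineq]) (simp add: abs_mult)
    also have "\<dots> \<le> B2 + (2 - \<alpha>) * B1"
      using B1[of z] B2[of z] z \<alpha> by (intro add_mono mult_left_mono) auto
    finally show ?thesis using z \<alpha> by (simp add: C_def field_simps)
  qed
  have "compact (mlf_deriv \<alpha> (\<alpha> - 1) ` {0..1})"
    by (intro compact_continuous_image continuous_on_mlf_deriv \<alpha>) auto
  then obtain B' where "\<forall>y\<in>mlf_deriv \<alpha> (\<alpha> - 1) ` {0..1}. norm y \<le> B'"
    using compact_imp_bounded bounded_iff by metis
  hence B': "\<And>z. z \<in> {0..1} \<Longrightarrow> \<bar>mlf_deriv \<alpha> (\<alpha> - 1) z\<bar> \<le> B'" by auto
  have "\<bar>mlf_deriv \<alpha> (\<alpha> - 1) z\<bar> \<le> max B' \<bar>C\<bar>" if z: "z \<ge> 0" for z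
  proof (cases "z \<le> 1")
    case True thus ?thesis using B'[of z] z by simp
  next
    case False
    have "C / z \<le> \<bar>C\<bar> / 1" using False by (intro frac_le) auto
    thus ?thesis using le[of z] False by simp
  qed
  moreover have "(mlf_deriv \<alpha> (\<alpha> - 1) \<longlongrightarrow> 0) at_top"
  proof (rule Lim_null_comparison)
    show "\<forall>\<^sub>F z in at_top. norm (mlf_deriv \<alpha> (\<alpha> - 1) z) \<le> C / z"
      using eventually_gt_at_top[of 0] by eventually_elim (use le in auto)
    show "((\<lambda>z. C / z) \<longlongrightarrow> 0) at_top" by real_asymp
  qed
  ultimately show ?thesis using that by blast
qed

section \<open>Joint continuity in x and the spectral variable t\<close>

context
  fixes \<alpha> c :: real
  assumes \<alpha>: "1 < \<alpha>" "\<alpha> < 2" and c: "c > 0"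
begin

lemma tendsto_scaled_arg:
  fixes M :: "real \<Rightarrow> real"
  assumes M: "continuous_on UNIV M" and p: "x0 \<in> {0..1}" "t0 > 0" and S: "S \<subseteq> {0..1} \<times> {0..1}"
  shows "((\<lambda>p. M (fst p powr \<alpha> / (c * snd p))) \<longlongrightarrow> M (x0 powr \<alpha> / (c * t0))) (at (x0, t0) within S)"
proof -
  have "(fst \<longlongrightarrow> x0) (at (x0, t0) within S)" "(snd \<longlongrightarrow> t0) (at (x0, t0) within S)"
    by (auto intro!: tendsto_eq_intros)
  moreover have "eventually (\<lambda>p. fst p \<ge> 0) (at (x0, t0) within S)"
    using S by (auto simp: eventually_at_filter subset_iff intro!: always_eventually)
  ultimately have "((\<lambda>p. fst p powr \<alpha> / (c * snd p)) \<longlongrightarrow> x0 powr \<alpha> / (c * t0)) (at (x0, t0) within S)"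
    using \<alpha> c p by (intro tendsto_divide tendsto_powr' tendsto_mult tendsto_const) auto
  moreover have "isCont M (x0 powr \<alpha> / (c * t0))" using M by (simp add:
      continuous_on_eq_continuous_at)
  ultimately show ?thesis by (rule isCont_tendsto_compose[rotated])
qed

text \<open>At z = x^\<alpha> / (c t), growth like z^(1/\<alpha>) costs a factor t^(-1/\<alpha>).
  With the factor t there remains t^(1 - 1/\<alpha>), which tends to 0 uniformly in x because
  \<alpha> > 1.\<close>

lemma joint_continuous_growth:
  fixes M :: "real \<Rightarrow> real"
  assumes M: "continuous_on UNIV M" and B: "\<And>z. z \<ge> 0 \<Longrightarrow> \<bar>M z\<bar> \<le> B * (1 + z powr (1 / \<alpha>))"
  shows "continuous_on ({0..1} \<times> {0..1}) (\<lambda>(x, t). t * M (x powr \<alpha> / (c * t)))"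
  unfolding continuous_on_def
proof (rule ballI)
  fix p :: "real \<times> real" assume p: "p \<in> {0..1} \<times> {0..1}"
  obtain x0 t0 where p0: "p = (x0, t0)" by (cases p)
  show "((\<lambda>(x, t). t * M (x powr \<alpha> / (c * t))) \<longlongrightarrow> (case p of (x, t) \<Rightarrow> t * M (x powr \<alpha> / (c * t))))
      (at p within {0..1} \<times> {0..1})"
  proof (cases "t0 = 0")
    case False
    hence "t0 > 0" "x0 \<in> {0..1}" using p p0 by auto
    hence "((\<lambda>p. snd p * M (fst p powr \<alpha> / (c * snd p))) \<longlongrightarrow> t0 * M (x0 powr \<alpha> / (c * t0))) (at p
        within {0..1} \<times> {0..1})"
      unfolding p0 by (intro tendsto_mult tendsto_scaled_arg M) (auto intro!: tendsto_eq_intros)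
    thus ?thesis by (simp add: p0 case_prod_unfold)
  next
    case True
    define b where "b = (\<lambda>t. B * (t + (1 / c) powr (1 / \<alpha>) * t powr (1 - 1 / \<alpha>)))"
    have a1: "1 - 1 / \<alpha> > 0" using \<alpha> by simp
    have Bn: "B \<ge> 0" using order_trans[OF abs_ge_zero B[of 0]] by simp
    have le: "\<bar>t * M (x powr \<alpha> / (c * t))\<bar> \<le> b t" if x: "x \<in> {0..1}" and t: "t \<in> {0..1}" for x t
    proof (cases "t = 0")
      case True
      thus ?thesis using Bn by (simp add: b_def)
    next
      case False
      hence t0: "t > 0" using t by simp
      have "\<bar>t * M (x powr \<alpha> / (c * t))\<bar> \<le> t * (B * (1 + (x powr \<alpha> / (c * t)) powr (1 / \<alpha>)))"
        using t0 c by (simp add: abs_mult B)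
      also have "(x powr \<alpha> / (c * t)) powr (1 / \<alpha>) = x * ((1 / c) powr (1 / \<alpha>) * t powr (- (1 /
          \<alpha>)))"
        using t0 c x \<alpha> by (simp add: powr_divide powr_mult powr_powr powr_minus divide_inverse
            inverse_powr)
      also have "t * (B * (1 + x * ((1 / c) powr (1 / \<alpha>) * t powr (- (1 / \<alpha>))))) \<le> t * (B * (1 + 1 *
          ((1 / c) powr (1 / \<alpha>) * t powr (- (1 / \<alpha>)))))"
        using t0 x Bn c by (intro mult_left_mono add_left_mono mult_right_mono) auto
      also have "\<dots> = b t"
      proof -
        have "t * t powr (- (1 / \<alpha>)) = t powr (1 - 1 / \<alpha>)" using t0 powr_add[of t 1 "- (1 / \<alpha>)"] by
            simp
        hence "t * ((1 / c) powr (1 / \<alpha>) * t powr (- (1 / \<alpha>))) = (1 / c) powr (1 / \<alpha>) * t powr (1 -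
            1 / \<alpha>)"
          by (metis mult.left_commute)
        thus ?thesis unfolding b_def by (simp add: distrib_left mult.left_commute[of t])
      qed
      finally show ?thesis .
    qed
    have "((\<lambda>p. snd p) \<longlongrightarrow> 0) (at p within {0..1} \<times> {0..1})"
      unfolding p0 True by (auto intro!: tendsto_eq_intros)
    moreover have "eventually (\<lambda>p. snd p \<ge> 0) (at p within {0..1} \<times> {0..1})"
      by (auto simp: eventually_at_filter intro!: always_eventually)
    ultimately have "((\<lambda>p. b (snd p)) \<longlongrightarrow> B * (0 + (1 / c) powr (1 / \<alpha>) * 0 powr (1 - 1 / \<alpha>))) (at p
        within {0..1} \<times> {0..1})"
      unfolding b_def using a1 by (intro tendsto_intros tendsto_powr') auto
    hence "((\<lambda>p. b (snd p)) \<longlongrightarrow> 0) (at p within {0..1} \<times> {0..1})" by simp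
    hence "((\<lambda>p. snd p * M (fst p powr \<alpha> / (c * snd p))) \<longlongrightarrow> 0) (at p within {0..1} \<times> {0..1})"
    proof (rule Lim_null_comparison[rotated])
      show "\<forall>\<^sub>F p in at p within {0..1} \<times> {0..1}. norm (snd p * M (fst p powr \<alpha> / (c * snd p))) \<le> b
          (snd p)"
        unfolding eventually_at_filter using le by (auto intro!: always_eventually)
    qed
    thus ?thesis by (simp add: p0 True case_prod_unfold)
  qed
qed

text \<open>For x near x0 > 0 the argument is at least a constant over t, so it tends to infinity as
  t tends to 0. The value at t = 0 is set by cases, since division by zero would yield M 0 there. At
  x = 0 the argument stays 0, hence the restriction to x > 0.\<close>

lemma joint_continuous_vanishing:
  fixes M :: "real \<Rightarrow> real"
  assumes M: "continuous_on UNIV M" and lim: "(M \<longlongrightarrow> 0) at_top"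
  shows "continuous_on ({0<..1} \<times> {0..1}) (\<lambda>(x, t). if t = 0 then 0 else M (x powr \<alpha> / (c * t)))"
  unfolding continuous_on_def
proof (rule ballI)
  fix p :: "real \<times> real" assume p: "p \<in> {0<..1} \<times> {0..1}"
  let ?F = "at p within {0<..1} \<times> {0..1}"
  obtain x0 t0 where p0: "p = (x0, t0)" by (cases p)
  have x0: "x0 \<in> {0..1}" "x0 > 0" using p p0 by auto
  have sub: "{0<..1::real} \<times> {0..1} \<subseteq> {0..1} \<times> {0..(1::real)}" by (auto simp: less_imp_le)
  have f: "(fst \<longlongrightarrow> x0) ?F" "(snd \<longlongrightarrow> t0) ?F" unfolding p0 by (auto intro!: tendsto_eq_intros)
  show "((\<lambda>(x, t). if t = 0 then 0 else M (x powr \<alpha> / (c * t))) \<longlongrightarrow> (case p of (x, t) \<Rightarrow> if t = 0 then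
      0 else M (x powr \<alpha> / (c * t)))) ?F"
  proof (cases "t0 = 0")
    case False
    hence t0: "t0 > 0" using p p0 by auto
    have "((\<lambda>p. M (fst p powr \<alpha> / (c * snd p))) \<longlongrightarrow> M (x0 powr \<alpha> / (c * t0))) ?F"
      unfolding p0 by (rule tendsto_scaled_arg[OF M x0(1) t0 sub])
    moreover have "eventually (\<lambda>p. M (fst p powr \<alpha> / (c * snd p)) = (\<lambda>(x, t). if t = 0 then 0 else M
        (x powr \<alpha> / (c * t))) p) ?F"
      using order_tendstoD(1)[OF f(2) t0] by eventually_elim (simp add: case_prod_unfold)
    ultimately have "((\<lambda>(x, t). if t = 0 then 0 else M (x powr \<alpha> / (c * t))) \<longlongrightarrow> M (x0 powr \<alpha> / (c *
        t0))) ?F"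
      using tendsto_cong by fast
    thus ?thesis using t0 by (simp add: p0)
  next
    case True
    have "((\<lambda>(x, t). if t = 0 then 0 else M (x powr \<alpha> / (c * t))) \<longlongrightarrow> 0) ?F"
    proof (rule tendstoI)
      fix e :: real assume e: "e > 0"
      obtain Z where Z: "\<And>z. z \<ge> Z \<Longrightarrow> \<bar>M z\<bar> < e"
        using tendstoD[OF lim e] by (auto simp: eventually_at_top_linorder dist_real_def)
      define a where "a = (x0 / 2) powr \<alpha> / c"
      have a: "a > 0" using x0 c by (simp add: a_def)
      define d where "d = a / (\<bar>Z\<bar> + 1)"
      have d: "d > 0" using a by (simp add: d_def add_nonneg_pos)
      have "eventually (\<lambda>p. fst p > x0 / 2) ?F" using x0 by (intro order_tendstoD(1)[OF f(1)]) simp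
      moreover have "eventually (\<lambda>p. snd p < d) ?F" using order_tendstoD(2)[OF f(2)] True d by simp
      moreover have "eventually (\<lambda>p. snd p \<ge> 0) ?F" by (auto simp: eventually_at_filter intro!:
          always_eventually)
      ultimately show "\<forall>\<^sub>F p in ?F. dist (case p of (x, t) \<Rightarrow> if t = 0 then 0 else M (x powr \<alpha> / (c *
          t))) 0 < e"
      proof eventually_elim
        case (elim p)
        show ?case
        proof (cases "snd p = 0")
          case False
          hence t: "snd p > 0" using elim by simp
          have "Z \<le> \<bar>Z\<bar> + 1" by simp
          also have "\<dots> = a / d" using a by (simp add: d_def)
          also have "\<dots> \<le> a / snd p" using elim t a by (intro divide_left_mono) auto
          also have "\<dots> = (x0 / 2) powr \<alpha> / (c * snd p)" by (simp add: a_def)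
          also have "\<dots> \<le> fst p powr \<alpha> / (c * snd p)" using elim x0 t c \<alpha> by (intro divide_right_mono
              powr_mono2) auto
          finally show ?thesis using Z False by (simp add: case_prod_unfold)
        qed (simp add: case_prod_unfold e)
      qed
    qed
    thus ?thesis by (simp add: p0 True)
  qed
qed

text \<open>Only the edge x = 0 is new: there \<open>M\<close> is merely bounded, and the factor
  \<open>x powr \<delta>\<close> provides the limit.\<close>

lemma joint_continuous_vanishing_powr:
  fixes M :: "real \<Rightarrow> real"
  assumes M: "continuous_on UNIV M" and lim: "(M \<longlongrightarrow> 0) at_top" and B: "\<And>z. z \<ge> 0 \<Longrightarrow> \<bar>M z\<bar> \<le> B" and \<delta>:
      "\<delta> > 0"
  shows "continuous_on ({0..1} \<times> {0..1}) (\<lambda>(x, t). x powr \<delta> * (if t = 0 then 0 else M (x powr \<alpha> / (c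
      * t))))"
  unfolding continuous_on_def
proof (rule ballI)
  fix p :: "real \<times> real" assume p: "p \<in> {0..1} \<times> {0..1}"
  let ?G = "\<lambda>(x, t). if t = 0 then 0 else M (x powr \<alpha> / (c * t))"
  let ?g = "\<lambda>(x, t). x powr \<delta> * (if t = 0 then 0 else M (x powr \<alpha> / (c * t)))"
  let ?F = "at p within {0..1} \<times> {0..1}"
  obtain x0 t0 where p0: "p = (x0, t0)" by (cases p)
  have f: "(fst \<longlongrightarrow> x0) ?F" unfolding p0 by (auto intro!: tendsto_eq_intros)
  have nn: "eventually (\<lambda>p. fst p \<ge> 0) ?F" by (auto simp: eventually_at_filter intro!:
      always_eventually)
  have px: "((\<lambda>p. fst p powr \<delta>) \<longlongrightarrow> x0 powr \<delta>) ?F"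
    using f nn \<delta> by (intro tendsto_powr' tendsto_const) auto
  show "(?g \<longlongrightarrow> ?g p) ?F"
  proof (cases "x0 = 0")
    case True
    have "((\<lambda>p. fst p powr \<delta> * B) \<longlongrightarrow> 0 powr \<delta> * B) ?F" using px True by (intro tendsto_mult
        tendsto_const) simp
    hence "((\<lambda>p. fst p powr \<delta> * B) \<longlongrightarrow> 0) ?F" by simp
    hence "(?g \<longlongrightarrow> 0) ?F"
    proof (rule Lim_null_comparison[rotated])
      have "B \<ge> 0" using order_trans[OF abs_ge_zero B[of 0]] by simp
      thus "\<forall>\<^sub>F p in ?F. norm (?g p) \<le> fst p powr \<delta> * B"
        unfolding eventually_at_filter using B c
        by (auto intro!: always_eventually mult_left_mono simp: abs_mult)
    qed
    thus ?thesis by (simp add: p0 True)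
  next
    case False
    hence x0: "x0 > 0" "p \<in> {0<..1} \<times> {0..1}" using p p0 by auto
    have "(?G \<longlongrightarrow> ?G p) (at p within {0<..1} \<times> {0..1})"
      using joint_continuous_vanishing[OF M lim] x0(2) unfolding continuous_on_def by blast
    moreover have "at p within {0<..1} \<times> {0..1} = ?F"
    proof (rule at_within_nhd[of p "{0<..} \<times> UNIV"])
      show "p \<in> {0<..} \<times> UNIV" using x0 by auto
      show "open ({0<..} \<times> (UNIV :: real set) :: (real \<times> real) set)" by (intro open_Times) auto
    qed auto
    ultimately have "(?G \<longlongrightarrow> ?G p) ?F" by simp
    hence "((\<lambda>p. fst p powr \<delta> * ?G p) \<longlongrightarrow> fst p powr \<delta> * ?G p) ?F"
      using px p0 by (intro tendsto_mult) auto
    thus ?thesis by (simp add: case_prod_unfold)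
  qed
qed


end

text \<open>A solution \<open>r x t\<close> of the scalar equation \<open>D\<^sup>\<alpha> r = - \<lambda> r\<close> with \<open>\<lambda> = 1 / (c t)\<close>,
  together with the functions derived from \<open>c t r\<close>: \<open>v = x\<^sup>2\<^sup>-\<^sup>\<alpha> c t r\<close> and \<open>v' = \<partial>v/\<partial>x\<close>,
  the fractional integral \<open>q\<close> and \<open>q' = \<partial>q/\<partial>x\<close>.\<close>

locale scalar_family =
  fixes \<alpha> c :: real and r v v' q q' :: "real \<Rightarrow> real \<Rightarrow> real"
  assumes r_cont: "continuous_on ({0<..1} \<times> {0..1}) (\<lambda>(x, t). r x t)"
    and v_cont: "continuous_on ({0..1} \<times> {0..1}) (\<lambda>(x, t). v x t)"
    and v'_cont: "continuous_on ({0..1} \<times> {0..1}) (\<lambda>(x, t). v' x t)"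
    and v_deriv: "\<And>x t. x \<in> {0..1} \<Longrightarrow> t \<in> {0..1} \<Longrightarrow> ((\<lambda>x. v x t) has_real_derivative v' x t) (at x
        within {0..1})"
    and v_eq: "\<And>x t. x \<in> {0<..1} \<Longrightarrow> t \<in> {0..1} \<Longrightarrow> c * t * r x t = x powr (\<alpha> - 2) * v x t"
    and q_eq: "\<And>x t. x \<in> {0<..<1} \<Longrightarrow> t \<in> {0..1} \<Longrightarrow> RL_integral \<alpha> (\<lambda>\<tau>. c * t * r \<tau> t) x = q x t"
    and q_cont: "\<And>x. x \<in> {0<..<1} \<Longrightarrow> continuous_on {0..1} (q x)"
    and q'_cont: "continuous_on ({0<..<1} \<times> {0..1}) (\<lambda>(x, t). q' x t)"
    and q_deriv: "\<And>x t. x \<in> {0<..<1} \<Longrightarrow> t \<in> {0..1} \<Longrightarrow> ((\<lambda>x. q x t) has_real_derivative q' x t) (at x)"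
    and q'_deriv: "\<And>x t. x \<in> {0<..<1} \<Longrightarrow> t \<in> {0..1} \<Longrightarrow> ((\<lambda>x. q' x t) has_real_derivative - Gamma (2 -
        \<alpha>) * r x t) (at x)"

lemma joint_continuous_slice:
  assumes "continuous_on (X \<times> Y) (\<lambda>(x, t). f x t)" "x \<in> X"
  shows "continuous_on Y (f x)"
  using continuous_on_compose2[OF assms(1), of Y "\<lambda>t. (x, t)"] assms(2)
  by (simp add: continuous_intros image_subset_iff)

lemma RL_integral_cmult: "RL_integral \<alpha> (\<lambda>t. a * f t) x = a * RL_integral \<alpha> f x"
  unfolding RL_integral_def RL_kernel_def times_divide_eq_right[symmetric]
  by (rule set_integral_mult_right)

section \<open>The two scalar families, one for each initial value\<close>

context
  fixes \<alpha> c :: real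
  assumes \<alpha>: "1 < \<alpha>" "\<alpha> < 2" and c: "c > 0"
begin

private abbreviation arg where "arg x t \<equiv> x powr \<alpha> / (c * t)"

private lemma growth_bounded:
  assumes "\<And>z. z \<ge> 0 \<Longrightarrow> \<bar>M z\<bar> \<le> B" "z \<ge> 0"
  shows "\<bar>M z\<bar> \<le> B * (1 + z powr (1 / \<alpha>))"
proof -
  have "B \<ge> 0" using order_trans[OF abs_ge_zero assms(1)[of 0]] by simp
  hence "B * 1 \<le> B * (1 + z powr (1 / \<alpha>))" by (intro mult_left_mono) auto
  thus ?thesis using assms by fastforce
qed

private lemma mlf_cont: "continuous_on UNIV (mlf \<alpha> \<beta>)" by (rule continuous_on_mlf[OF \<alpha>(1)])

private lemma mlf1_deriv:
  assumes "x \<in> {0<..<1}" "t > 0"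
  shows "((\<lambda>x. mlf \<alpha> 1 (arg x t)) has_real_derivative - (1 / (c * t) * x powr (\<alpha> - 1) * mlf \<alpha> \<alpha> (arg
      x t))) (at x)"
proof -
  have x: "x > 0" using assms by simp
  have "((\<lambda>x. x powr (1 - 1) * mlf \<alpha> 1 (1 / (c * t) * x powr \<alpha>)) has_real_derivative x powr (1 - 2)
      * mlf \<alpha> (1 - 1) (1 / (c * t) * x powr \<alpha>)) (at x)"
    by (rule powr_mlf_has_derivative[OF \<alpha>(1) x])
  moreover have "x powr (1 - 2) * mlf \<alpha> (1 - 1) (1 / (c * t) * x powr \<alpha>) = - (1 / (c * t) * x powr
      (\<alpha> - 1) * mlf \<alpha> \<alpha> (arg x t))"
    using mlf_shift[OF \<alpha>(1), of 0 "arg x t"] x by (simp add: powr_diff powr_minus field_simps)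
  ultimately have "((\<lambda>x. x powr (1 - 1) * mlf \<alpha> 1 (1 / (c * t) * x powr \<alpha>)) has_real_derivative - (1
      / (c * t) * x powr (\<alpha> - 1) * mlf \<alpha> \<alpha> (arg x t))) (at x)" by simp
  thus ?thesis
    by (rule has_field_derivative_transform_within_open[of _ _ _ "{0<..}"]) (use x in auto)
qed

private lemma mlf_alpha_deriv:
  assumes "x \<in> {0<..<1}"
  shows "((\<lambda>x. x powr (\<alpha> - 1) * mlf \<alpha> \<alpha> (arg x t)) has_real_derivative x powr (\<alpha> - 2) * mlf \<alpha> (\<alpha> -
      1) (arg x t)) (at x)"
  using powr_mlf_has_derivative[OF \<alpha>(1), of x \<alpha> "1 / (c * t)" UNIV] assms by simp

private lemma mlf2_deriv:
  assumes "x \<in> {0<..<1}"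
  shows "((\<lambda>x. x * mlf \<alpha> 2 (arg x t)) has_real_derivative mlf \<alpha> 1 (arg x t)) (at x)"
proof -
  have x: "x > 0" using assms by simp
  have "((\<lambda>x. x powr (2 - 1) * mlf \<alpha> 2 (1 / (c * t) * x powr \<alpha>)) has_real_derivative x powr (2 - 2)
      * mlf \<alpha> (2 - 1) (1 / (c * t) * x powr \<alpha>)) (at x)"
    by (rule powr_mlf_has_derivative[OF \<alpha>(1) x])
  hence "((\<lambda>x. x powr (2 - 1) * mlf \<alpha> 2 (1 / (c * t) * x powr \<alpha>)) has_real_derivative mlf \<alpha> 1 (arg x
      t)) (at x)" using x by simp
  thus ?thesis
    by (rule has_field_derivative_transform_within_open[of _ _ _ "{0<..}"]) (use x in auto)
qed

private lemma mlf_chain: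
  assumes "x \<in> {0..1}"
  shows "((\<lambda>x. mlf \<alpha> \<beta> (arg x t)) has_real_derivative mlf_deriv \<alpha> \<beta> (arg x t) * (\<alpha> * x powr (\<alpha> - 1)
      / (c * t))) (at x within {0..1})"
  by (intro DERIV_chain2[OF mlf_has_derivative[OF \<alpha>(1)]] DERIV_cdivide powr_has_derivative_at_0 \<alpha>
      assms)

text \<open>\<open>Gamma (\<alpha> - 1)\<close> normalises \<open>v\<close> to c t at x = 0, while
  \<open>v'\<close> vanishes there. In \<open>v'\<close> and \<open>q'\<close> the chain rule
  produces 1/t, which uses up the factor t, so continuity at t = 0 rests on decay through
  \<open>joint_continuous_vanishing_powr\<close>.\<close>

lemma scalar_family_psi:
  "scalar_family \<alpha> c
     (\<lambda>x t. if t = 0 then 0 else Gamma (\<alpha> - 1) * (x powr (\<alpha> - 2) * mlf \<alpha> (\<alpha> - 1) (arg x t)))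
     (\<lambda>x t. c * Gamma (\<alpha> - 1) * (t * mlf \<alpha> (\<alpha> - 1) (arg x t)))
     (\<lambda>x t. Gamma (\<alpha> - 1) * \<alpha> * (x powr (\<alpha> - 1) * (if t = 0 then 0 else mlf_deriv \<alpha> (\<alpha> - 1) (arg x
         t))))
     (\<lambda>x t. c * Gamma (\<alpha> - 1) * Gamma (2 - \<alpha>) * (t * mlf \<alpha> 1 (arg x t)))
     (\<lambda>x t. - Gamma (\<alpha> - 1) * Gamma (2 - \<alpha>) * (x powr (\<alpha> - 1) * (if t = 0 then 0 else mlf \<alpha> \<alpha> (arg x
         t))))"
proof
  obtain B1 where B1: "\<And>z. z \<ge> 0 \<Longrightarrow> \<bar>mlf \<alpha> (\<alpha> - 1) z\<bar> \<le> B1" using mlf_bounded[OF \<alpha>, of 1] by auto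
  have l1: "(mlf \<alpha> (\<alpha> - 1) \<longlongrightarrow> 0) at_top" "(mlf \<alpha> \<alpha> \<longlongrightarrow> 0) at_top"
    using mlf_tendsto_0[OF \<alpha>, of 1] mlf_tendsto_0[OF \<alpha>, of 0] by simp_all
  obtain B0 where B0: "\<And>z. z \<ge> 0 \<Longrightarrow> \<bar>mlf \<alpha> \<alpha> z\<bar> \<le> B0" using mlf_bounded[OF \<alpha>, of 0] by auto
  obtain Bd where Bd: "\<And>z. z \<ge> 0 \<Longrightarrow> \<bar>mlf_deriv \<alpha> (\<alpha> - 1) z\<bar> \<le> Bd" "(mlf_deriv \<alpha> (\<alpha> - 1) \<longlongrightarrow> 0) at_top"
    using mlf_deriv_decay[OF \<alpha>] by blast
  obtain Bg where Bg: "\<And>z. z \<ge> 0 \<Longrightarrow> \<bar>mlf \<alpha> 1 z\<bar> \<le> Bg * (1 + z powr (1 / \<alpha>))" "\<And>z. z \<ge> 0 \<Longrightarrow> \<bar>mlf \<alpha> 2 z\<bar>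
      \<le> Bg * (1 + z powr (1 / \<alpha>))"
    using mlf_one_two_growth[OF \<alpha>] by blast
  have "continuous_on ({0<..1} \<times> {0..1}) (\<lambda>p. Gamma (\<alpha> - 1) * (fst p powr (\<alpha> - 2) * (case p of (x,
      t) \<Rightarrow> if t = 0 then 0 else mlf \<alpha> (\<alpha> - 1) (arg x t))))"
    by (intro continuous_on_mult continuous_on_const joint_continuous_vanishing[OF \<alpha> c mlf_cont
        l1(1)] continuous_on_powr continuous_on_fst continuous_on_id) auto
  thus "continuous_on ({0<..1} \<times> {0..1}) (\<lambda>(x, t). if t = 0 then 0 else Gamma (\<alpha> - 1) * (x powr (\<alpha> -
      2) * mlf \<alpha> (\<alpha> - 1) (arg x t)))"
    by (rule continuous_on_eq) auto
  have "continuous_on ({0..1} \<times> {0..1}) (\<lambda>p. c * Gamma (\<alpha> - 1) * (case p of (x, t) \<Rightarrow> t * mlf \<alpha> (\<alpha> -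
      1) (arg x t)))"
    by (intro continuous_on_mult continuous_on_const joint_continuous_growth[OF \<alpha> c mlf_cont
        growth_bounded[where M = "mlf \<alpha> (\<alpha> - 1)", OF B1]])
  thus "continuous_on ({0..1} \<times> {0..1}) (\<lambda>(x, t). c * Gamma (\<alpha> - 1) * (t * mlf \<alpha> (\<alpha> - 1) (arg x
      t)))"
    by (rule continuous_on_eq) auto
  have "continuous_on ({0..1} \<times> {0..1}) (\<lambda>p. Gamma (\<alpha> - 1) * \<alpha> * (case p of (x, t) \<Rightarrow> x powr (\<alpha> - 1)
      * (if t = 0 then 0 else mlf_deriv \<alpha> (\<alpha> - 1) (arg x t))))"
    using \<alpha> by (intro continuous_on_mult continuous_on_const joint_continuous_vanishing_powr[OF \<alpha> c
        _ Bd(2) Bd(1)] continuous_on_mlf_deriv) auto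
  thus "continuous_on ({0..1} \<times> {0..1}) (\<lambda>(x, t). Gamma (\<alpha> - 1) * \<alpha> * (x powr (\<alpha> - 1) * (if t = 0
      then 0 else mlf_deriv \<alpha> (\<alpha> - 1) (arg x t))))"
    by (rule continuous_on_eq) auto
  have "continuous_on ({0..1} \<times> {0..1}) (\<lambda>p. c * Gamma (\<alpha> - 1) * Gamma (2 - \<alpha>) * (case p of (x, t) \<Rightarrow>
      t * mlf \<alpha> 1 (arg x t)))"
    by (intro continuous_on_mult continuous_on_const joint_continuous_growth[OF \<alpha> c mlf_cont Bg(1)])
  hence "continuous_on ({0..1} \<times> {0..1}) (\<lambda>(x, t). c * Gamma (\<alpha> - 1) * Gamma (2 - \<alpha>) * (t * mlf \<alpha> 1
      (arg x t)))"
    by (rule continuous_on_eq) auto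
  thus "continuous_on {0..1} (\<lambda>t. c * Gamma (\<alpha> - 1) * Gamma (2 - \<alpha>) * (t * mlf \<alpha> 1 (arg x t)))" if
      "x \<in> {0<..<1}" for x
    by (rule joint_continuous_slice) (use that in auto)
  have "continuous_on ({0..1} \<times> {0..1}) (\<lambda>p. - Gamma (\<alpha> - 1) * Gamma (2 - \<alpha>) * (case p of (x, t) \<Rightarrow> x
      powr (\<alpha> - 1) * (if t = 0 then 0 else mlf \<alpha> \<alpha> (arg x t))))"
    using \<alpha> by (intro continuous_on_mult continuous_on_const joint_continuous_vanishing_powr[OF \<alpha> c
        mlf_cont l1(2) B0]) auto
  hence "continuous_on ({0<..<1} \<times> {0..1}) (\<lambda>p. - Gamma (\<alpha> - 1) * Gamma (2 - \<alpha>) * (case p of (x, t)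
      \<Rightarrow> x powr (\<alpha> - 1) * (if t = 0 then 0 else mlf \<alpha> \<alpha> (arg x t))))"
    by (rule continuous_on_subset) auto
  thus "continuous_on ({0<..<1} \<times> {0..1}) (\<lambda>(x, t). - Gamma (\<alpha> - 1) * Gamma (2 - \<alpha>) * (x powr (\<alpha> -
      1) * (if t = 0 then 0 else mlf \<alpha> \<alpha> (arg x t))))"
    by (rule continuous_on_eq) auto
next
  fix x t :: real assume x: "x \<in> {0..1}" and t: "t \<in> {0..1}"
  show "((\<lambda>x. c * Gamma (\<alpha> - 1) * (t * mlf \<alpha> (\<alpha> - 1) (arg x t))) has_real_derivative
      Gamma (\<alpha> - 1) * \<alpha> * (x powr (\<alpha> - 1) * (if t = 0 then 0 else mlf_deriv \<alpha> (\<alpha> - 1) (arg x t))))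
          (at x within {0..1})"
  proof (cases "t = 0")
    case False
    have "((\<lambda>x. c * Gamma (\<alpha> - 1) * (t * mlf \<alpha> (\<alpha> - 1) (arg x t))) has_real_derivative
      c * Gamma (\<alpha> - 1) * (t * (mlf_deriv \<alpha> (\<alpha> - 1) (arg x t) * (\<alpha> * x powr (\<alpha> - 1) / (c * t)))))
          (at x within {0..1})"
      by (intro DERIV_cmult mlf_chain x)
    thus ?thesis using False c by (simp add: mult_ac)
  qed simp
next
  fix x t :: real assume x: "x \<in> {0<..1}" and t: "t \<in> {0..1}"
  show "c * t * (if t = 0 then 0 else Gamma (\<alpha> - 1) * (x powr (\<alpha> - 2) * mlf \<alpha> (\<alpha> - 1) (arg x t))) =
      x powr (\<alpha> - 2) * (c * Gamma (\<alpha> - 1) * (t * mlf \<alpha> (\<alpha> - 1) (arg x t)))"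
    by simp
next
  fix x t :: real assume x: "x \<in> {0<..<1}" and t: "t \<in> {0..1}"
  show "RL_integral \<alpha> (\<lambda>x. c * t * (if t = 0 then 0 else Gamma (\<alpha> - 1) * (x powr (\<alpha> - 2) * mlf \<alpha> (\<alpha>
      - 1) (arg x t)))) x =
      c * Gamma (\<alpha> - 1) * Gamma (2 - \<alpha>) * (t * mlf \<alpha> 1 (arg x t))"
  proof (cases "t = 0")
    case True
    thus ?thesis by (simp add: RL_integral_def RL_kernel_def)
  next
    case False
    have "RL_integral \<alpha> (\<lambda>\<tau>. \<tau> powr ((\<alpha> - 1) - 1) * mlf \<alpha> (\<alpha> - 1) (1 / (c * t) * \<tau> powr \<alpha>)) x
       = Gamma (2 - \<alpha>) * (x powr ((\<alpha> - 1) + 1 - \<alpha>) * mlf \<alpha> ((\<alpha> - 1) + 2 - \<alpha>) (1 / (c * t) * x powr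
           \<alpha>))"
      by (rule RL_integral_mlf[OF \<alpha>]) (use \<alpha> x in auto)
    hence "RL_integral \<alpha> (\<lambda>\<tau>. \<tau> powr (\<alpha> - 2) * mlf \<alpha> (\<alpha> - 1) (arg \<tau> t)) x = Gamma (2 - \<alpha>) * mlf \<alpha> 1
        (arg x t)"
      using x by simp
    moreover have "(\<lambda>x. c * t * (if t = 0 then 0 else Gamma (\<alpha> - 1) * (x powr (\<alpha> - 2) * mlf \<alpha> (\<alpha> -
        1) (arg x t))))
        = (\<lambda>\<tau>. c * t * Gamma (\<alpha> - 1) * (\<tau> powr (\<alpha> - 2) * mlf \<alpha> (\<alpha> - 1) (arg \<tau> t)))"
      using False by (simp add: fun_eq_iff)
    ultimately show ?thesis by (simp only: RL_integral_cmult) simp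
  qed
  show "((\<lambda>x. c * Gamma (\<alpha> - 1) * Gamma (2 - \<alpha>) * (t * mlf \<alpha> 1 (arg x t))) has_real_derivative
      - Gamma (\<alpha> - 1) * Gamma (2 - \<alpha>) * (x powr (\<alpha> - 1) * (if t = 0 then 0 else mlf \<alpha> \<alpha> (arg x t))))
          (at x)"
  proof (cases "t = 0")
    case False
    hence "((\<lambda>x. c * Gamma (\<alpha> - 1) * Gamma (2 - \<alpha>) * (t * mlf \<alpha> 1 (arg x t))) has_real_derivative
      c * Gamma (\<alpha> - 1) * Gamma (2 - \<alpha>) * (t * - (1 / (c * t) * x powr (\<alpha> - 1) * mlf \<alpha> \<alpha> (arg x
          t)))) (at x)"
      using t by (intro DERIV_cmult mlf1_deriv x) auto
    thus ?thesis using False c by (simp add: mult_ac)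
  qed simp
  show "((\<lambda>x. - Gamma (\<alpha> - 1) * Gamma (2 - \<alpha>) * (x powr (\<alpha> - 1) * (if t = 0 then 0 else mlf \<alpha> \<alpha> (arg
      x t)))) has_real_derivative
      - Gamma (2 - \<alpha>) * (if t = 0 then 0 else Gamma (\<alpha> - 1) * (x powr (\<alpha> - 2) * mlf \<alpha> (\<alpha> - 1) (arg x
          t)))) (at x)"
  proof (cases "t = 0")
    case False
    have "((\<lambda>x. - Gamma (\<alpha> - 1) * Gamma (2 - \<alpha>) * (x powr (\<alpha> - 1) * mlf \<alpha> \<alpha> (arg x t)))
        has_real_derivative
      - Gamma (\<alpha> - 1) * Gamma (2 - \<alpha>) * (x powr (\<alpha> - 2) * mlf \<alpha> (\<alpha> - 1) (arg x t))) (at x)"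
      by (intro DERIV_cmult mlf_alpha_deriv x)
    thus ?thesis using False by (simp add: mult_ac)
  qed simp
qed

text \<open>\<open>Gamma \<alpha>\<close> normalises \<open>v'\<close> to c t at x = 0, because
  \<open>Gamma \<alpha> = (\<alpha> - 1) * Gamma (\<alpha> - 1)\<close> and (\<alpha> - 1) + (2 -
  \<alpha>) = 1, while \<open>v\<close> vanishes there. Here \<open>v\<close>, \<open>v'\<close>,
  \<open>q\<close> and \<open>q'\<close> all keep a factor t, so growth bounds suffice for
  them.\<close>

lemma scalar_family_phi:
  "scalar_family \<alpha> c
     (\<lambda>x t. if t = 0 then 0 else Gamma \<alpha> * (x powr (\<alpha> - 1) * mlf \<alpha> \<alpha> (arg x t)))
     (\<lambda>x t. c * Gamma \<alpha> * (x * (t * mlf \<alpha> \<alpha> (arg x t))))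
     (\<lambda>x t. c * Gamma \<alpha> * (t * (mlf \<alpha> (\<alpha> - 1) (arg x t) + (2 - \<alpha>) * mlf \<alpha> \<alpha> (arg x t))))
     (\<lambda>x t. c * Gamma \<alpha> * Gamma (2 - \<alpha>) * (x * (t * mlf \<alpha> 2 (arg x t))))
     (\<lambda>x t. c * Gamma \<alpha> * Gamma (2 - \<alpha>) * (t * mlf \<alpha> 1 (arg x t)))"
proof
  obtain B1 where B1: "\<And>z. z \<ge> 0 \<Longrightarrow> \<bar>mlf \<alpha> (\<alpha> - 1) z\<bar> \<le> B1" using mlf_bounded[OF \<alpha>, of 1] by auto
  have l0: "(mlf \<alpha> \<alpha> \<longlongrightarrow> 0) at_top"
    using mlf_tendsto_0[OF \<alpha>, of 0] by simp
  obtain B0 where B0: "\<And>z. z \<ge> 0 \<Longrightarrow> \<bar>mlf \<alpha> \<alpha> z\<bar> \<le> B0" using mlf_bounded[OF \<alpha>, of 0] by auto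
  obtain Bg where Bg: "\<And>z. z \<ge> 0 \<Longrightarrow> \<bar>mlf \<alpha> 1 z\<bar> \<le> Bg * (1 + z powr (1 / \<alpha>))" "\<And>z. z \<ge> 0 \<Longrightarrow> \<bar>mlf \<alpha> 2 z\<bar>
      \<le> Bg * (1 + z powr (1 / \<alpha>))"
    using mlf_one_two_growth[OF \<alpha>] by blast
  have "continuous_on ({0..1} \<times> {0..1}) (\<lambda>p. Gamma \<alpha> * (case p of (x, t) \<Rightarrow> x powr (\<alpha> - 1) * (if t =
      0 then 0 else mlf \<alpha> \<alpha> (arg x t))))"
    using \<alpha> by (intro continuous_on_mult continuous_on_const joint_continuous_vanishing_powr[OF \<alpha> c
        mlf_cont l0 B0]) auto
  hence "continuous_on ({0<..1} \<times> {0..1}) (\<lambda>p. Gamma \<alpha> * (case p of (x, t) \<Rightarrow> x powr (\<alpha> - 1) * (if t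
      = 0 then 0 else mlf \<alpha> \<alpha> (arg x t))))"
    by (rule continuous_on_subset) (auto simp: less_imp_le)
  thus "continuous_on ({0<..1} \<times> {0..1}) (\<lambda>(x, t). if t = 0 then 0 else Gamma \<alpha> * (x powr (\<alpha> - 1) *
      mlf \<alpha> \<alpha> (arg x t)))"
    by (rule continuous_on_eq) auto
  have "continuous_on ({0..1} \<times> {0..1}) (\<lambda>p. c * Gamma \<alpha> * (fst p * (case p of (x, t) \<Rightarrow> t * mlf \<alpha> \<alpha>
      (arg x t))))"
    by (intro continuous_on_mult continuous_on_const continuous_on_fst continuous_on_id
        joint_continuous_growth[OF \<alpha> c mlf_cont growth_bounded[where M = "mlf \<alpha> \<alpha>", OF B0]])
  thus "continuous_on ({0..1} \<times> {0..1}) (\<lambda>(x, t). c * Gamma \<alpha> * (x * (t * mlf \<alpha> \<alpha> (arg x t))))"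
    by (rule continuous_on_eq) auto
  have "continuous_on ({0..1} \<times> {0..1}) (\<lambda>p. c * Gamma \<alpha> * ((case p of (x, t) \<Rightarrow> t * mlf \<alpha> (\<alpha> - 1)
      (arg x t)) + (2 - \<alpha>) * (case p of (x, t) \<Rightarrow> t * mlf \<alpha> \<alpha> (arg x t))))"
    by (intro continuous_on_mult continuous_on_add continuous_on_const joint_continuous_growth[OF \<alpha>
        c mlf_cont growth_bounded[where M = "mlf \<alpha> \<alpha>", OF B0]]
         joint_continuous_growth[OF \<alpha> c mlf_cont growth_bounded[where M = "mlf \<alpha> (\<alpha> - 1)", OF B1]])
  thus "continuous_on ({0..1} \<times> {0..1}) (\<lambda>(x, t). c * Gamma \<alpha> * (t * (mlf \<alpha> (\<alpha> - 1) (arg x t) + (2 -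
      \<alpha>) * mlf \<alpha> \<alpha> (arg x t))))"
    by (rule continuous_on_eq) (auto simp: algebra_simps)
  have "continuous_on ({0..1} \<times> {0..1}) (\<lambda>p. c * Gamma \<alpha> * Gamma (2 - \<alpha>) * (fst p * (case p of (x,
      t) \<Rightarrow> t * mlf \<alpha> 2 (arg x t))))"
    by (intro continuous_on_mult continuous_on_const continuous_on_fst continuous_on_id
        joint_continuous_growth[OF \<alpha> c mlf_cont Bg(2)])
  hence "continuous_on ({0..1} \<times> {0..1}) (\<lambda>(x, t). c * Gamma \<alpha> * Gamma (2 - \<alpha>) * (x * (t * mlf \<alpha> 2
      (arg x t))))"
    by (rule continuous_on_eq) auto
  thus "continuous_on {0..1} (\<lambda>t. c * Gamma \<alpha> * Gamma (2 - \<alpha>) * (x * (t * mlf \<alpha> 2 (arg x t))))" if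
      "x \<in> {0<..<1}" for x
    by (rule joint_continuous_slice) (use that in auto)
  have "continuous_on ({0..1} \<times> {0..1}) (\<lambda>p. c * Gamma \<alpha> * Gamma (2 - \<alpha>) * (case p of (x, t) \<Rightarrow> t *
      mlf \<alpha> 1 (arg x t)))"
    by (intro continuous_on_mult continuous_on_const joint_continuous_growth[OF \<alpha> c mlf_cont Bg(1)])
  hence "continuous_on ({0<..<1} \<times> {0..1}) (\<lambda>p. c * Gamma \<alpha> * Gamma (2 - \<alpha>) * (case p of (x, t) \<Rightarrow> t
      * mlf \<alpha> 1 (arg x t)))"
    by (rule continuous_on_subset) auto
  thus "continuous_on ({0<..<1} \<times> {0..1}) (\<lambda>(x, t). c * Gamma \<alpha> * Gamma (2 - \<alpha>) * (t * mlf \<alpha> 1 (arg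
      x t)))"
    by (rule continuous_on_eq) auto
next
  fix x t :: real assume x: "x \<in> {0..1}" and t: "t \<in> {0..1}"
  show "((\<lambda>x. c * Gamma \<alpha> * (x * (t * mlf \<alpha> \<alpha> (arg x t)))) has_real_derivative
      c * Gamma \<alpha> * (t * (mlf \<alpha> (\<alpha> - 1) (arg x t) + (2 - \<alpha>) * mlf \<alpha> \<alpha> (arg x t)))) (at x within
          {0..1})"
  proof -
    have "((\<lambda>x. c * Gamma \<alpha> * (x * (t * mlf \<alpha> \<alpha> (arg x t)))) has_real_derivative
      c * Gamma \<alpha> * (1 * (t * mlf \<alpha> \<alpha> (arg x t)) + (t * (mlf_deriv \<alpha> \<alpha> (arg x t) * (\<alpha> * x powr (\<alpha> -
          1) / (c * t)))) * x)) (at x within {0..1})"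
      by (intro DERIV_cmult DERIV_mult DERIV_ident mlf_chain x)
    \<comment> \<open>On functions of z = x^\<alpha> / (c t), x d/dx is \<alpha> z d/dz, and
      \<open>mlf_deriv_eq\<close> eliminates the derivative.\<close>
    moreover have "x * (mlf_deriv \<alpha> \<alpha> (arg x t) * (\<alpha> * x powr (\<alpha> - 1) / (c * t))) = \<alpha> * arg x t *
        mlf_deriv \<alpha> \<alpha> (arg x t)"
    proof -
      have "x * x powr (\<alpha> - 1) = x powr \<alpha>" using x by (cases "x = 0") (simp_all add: powr_diff)
      thus ?thesis by (simp add: mult_ac)
    qed
    hence e: "x * (mlf_deriv \<alpha> \<alpha> (arg x t) * (\<alpha> * x powr (\<alpha> - 1) / (c * t))) = mlf \<alpha> (\<alpha> - 1) (arg x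
        t) - (\<alpha> - 1) * mlf \<alpha> \<alpha> (arg x t)"
      unfolding mlf_deriv_eq[OF \<alpha>(1)] .
    have r: "1 * (t * a) + (t * d) * x = t * (a + x * d)" for a d :: real by (simp add:
        algebra_simps)
    have "1 * (t * mlf \<alpha> \<alpha> (arg x t)) + (t * (mlf_deriv \<alpha> \<alpha> (arg x t) * (\<alpha> * x powr (\<alpha> - 1) / (c *
        t)))) * x
       = t * (mlf \<alpha> (\<alpha> - 1) (arg x t) + (2 - \<alpha>) * mlf \<alpha> \<alpha> (arg x t))"
      unfolding r e by (simp add: algebra_simps)
    ultimately show ?thesis by (simp only:)
  qed
next
  fix x t :: real assume x: "x \<in> {0<..1}" and t: "t \<in> {0..1}"
  have "x powr (\<alpha> - 1) = x powr (\<alpha> - 2) * x" using x powr_add[of x "\<alpha> - 2" 1] by simp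
  thus "c * t * (if t = 0 then 0 else Gamma \<alpha> * (x powr (\<alpha> - 1) * mlf \<alpha> \<alpha> (arg x t))) =
      x powr (\<alpha> - 2) * (c * Gamma \<alpha> * (x * (t * mlf \<alpha> \<alpha> (arg x t))))"
    by simp
next
  fix x t :: real assume x: "x \<in> {0<..<1}" and t: "t \<in> {0..1}"
  show "RL_integral \<alpha> (\<lambda>x. c * t * (if t = 0 then 0 else Gamma \<alpha> * (x powr (\<alpha> - 1) * mlf \<alpha> \<alpha> (arg x
      t)))) x =
      c * Gamma \<alpha> * Gamma (2 - \<alpha>) * (x * (t * mlf \<alpha> 2 (arg x t)))"
  proof (cases "t = 0")
    case True
    thus ?thesis by (simp add: RL_integral_def RL_kernel_def)
  next
    case False
    have "RL_integral \<alpha> (\<lambda>\<tau>. \<tau> powr (\<alpha> - 1) * mlf \<alpha> \<alpha> (1 / (c * t) * \<tau> powr \<alpha>)) x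
       = Gamma (2 - \<alpha>) * (x powr (\<alpha> + 1 - \<alpha>) * mlf \<alpha> (\<alpha> + 2 - \<alpha>) (1 / (c * t) * x powr \<alpha>))"
      by (rule RL_integral_mlf[OF \<alpha>]) (use \<alpha> x in auto)
    hence "RL_integral \<alpha> (\<lambda>\<tau>. \<tau> powr (\<alpha> - 1) * mlf \<alpha> \<alpha> (arg \<tau> t)) x = Gamma (2 - \<alpha>) * (x * mlf \<alpha> 2
        (arg x t))"
      using x by simp
    moreover have "(\<lambda>x. c * t * (if t = 0 then 0 else Gamma \<alpha> * (x powr (\<alpha> - 1) * mlf \<alpha> \<alpha> (arg x
        t))))
        = (\<lambda>\<tau>. c * t * Gamma \<alpha> * (\<tau> powr (\<alpha> - 1) * mlf \<alpha> \<alpha> (arg \<tau> t)))"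
      using False by (simp add: fun_eq_iff)
    ultimately show ?thesis by (simp only: RL_integral_cmult) simp
  qed
  have "((\<lambda>x. (c * Gamma \<alpha> * Gamma (2 - \<alpha>) * t) * (x * mlf \<alpha> 2 (arg x t))) has_real_derivative
      (c * Gamma \<alpha> * Gamma (2 - \<alpha>) * t) * mlf \<alpha> 1 (arg x t)) (at x)"
    by (intro DERIV_cmult mlf2_deriv x)
  thus "((\<lambda>x. c * Gamma \<alpha> * Gamma (2 - \<alpha>) * (x * (t * mlf \<alpha> 2 (arg x t)))) has_real_derivative
      c * Gamma \<alpha> * Gamma (2 - \<alpha>) * (t * mlf \<alpha> 1 (arg x t))) (at x)"
    by (simp add: mult_ac)
  show "((\<lambda>x. c * Gamma \<alpha> * Gamma (2 - \<alpha>) * (t * mlf \<alpha> 1 (arg x t))) has_real_derivative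
      - Gamma (2 - \<alpha>) * (if t = 0 then 0 else Gamma \<alpha> * (x powr (\<alpha> - 1) * mlf \<alpha> \<alpha> (arg x t)))) (at
          x)"
  proof (cases "t = 0")
    case False
    hence "((\<lambda>x. c * Gamma \<alpha> * Gamma (2 - \<alpha>) * (t * mlf \<alpha> 1 (arg x t))) has_real_derivative
      c * Gamma \<alpha> * Gamma (2 - \<alpha>) * (t * - (1 / (c * t) * x powr (\<alpha> - 1) * mlf \<alpha> \<alpha> (arg x t)))) (at
          x)"
      using t by (intro DERIV_cmult mlf1_deriv x) auto
    thus ?thesis using False c by (simp add: mult_ac)
  qed simp
qed

end

section \<open>Solutions of Problem A\<close>

context positive_contraction
begin

lemma calc_cong:
  assumes "\<And>t. t \<in> {0..1} \<Longrightarrow> p t = q t"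
  shows "calc A f p = calc A f q"
proof -
  have "bern N p f = bern N q f" for N
    unfolding bern_def by (intro sum.cong refl) (auto intro!: assms arg_cong2[where f = scaleR]
        simp: divide_simps)
  thus ?thesis by (simp add: calc_def)
qed

end

instance bcontfun :: (metric_space, banach) banach ..

lemma bounded_linear_apply_bcontfun: "bounded_linear (\<lambda>F :: cfun. F y)"
  by (rule bounded_linear_intro[of _ 1]) (use norm_bounded[where 'b = real] in auto)

text \<open>Convergence in the supremum norm is uniform in y, and each \<open>w x0\<close> is
  continuous. This yields the joint regularity that Problem A demands.\<close>

lemma continuous_on_apply_joint:
  fixes w :: "real \<Rightarrow> cfun"
  assumes w: "continuous_on X w"
  shows "continuous_on (X \<times> Y) (\<lambda>(x, y). (w x) y)"
  unfolding continuous_on_def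
proof
  fix p :: "real \<times> real" assume p: "p \<in> X \<times> Y"
  obtain x0 y0 where p0: "p = (x0, y0)" by (cases p)
  let ?F = "at p within X \<times> Y"
  have "continuous_on (X \<times> Y) (\<lambda>p. w (fst p))"
    by (rule continuous_on_compose2[OF w]) (auto intro!: continuous_intros)
  hence "((\<lambda>p. w (fst p)) \<longlongrightarrow> w x0) ?F" using p p0 by (auto simp: continuous_on_def)
  hence "((\<lambda>p. norm (w (fst p) - w x0)) \<longlongrightarrow> 0) ?F" by (simp add: LIM_zero tendsto_norm_zero)
  hence "((\<lambda>p. (w (fst p) - w x0) (snd p)) \<longlongrightarrow> 0) ?F"
  proof (rule Lim_null_comparison[rotated])
    have "norm ((w (fst p) - w x0) (snd p)) \<le> norm (w (fst p) - w x0)" for p by (rule norm_bounded)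
    thus "\<forall>\<^sub>F p in ?F. norm ((w (fst p) - w x0) (snd p)) \<le> norm (w (fst p) - w x0)"
      by (intro always_eventually allI)
  qed
  moreover have "continuous_on (X \<times> Y) (\<lambda>p. (w x0) (snd p))" by (intro continuous_intros)
  hence "((\<lambda>p. (w x0) (snd p)) \<longlongrightarrow> (w x0) y0) ?F" using p p0 by (auto simp: continuous_on_def)
  ultimately have "((\<lambda>p. (w (fst p) - w x0) (snd p) + (w x0) (snd p)) \<longlongrightarrow> 0 + (w x0) y0) ?F"
    by (rule tendsto_add)
  thus "((\<lambda>(x, y). (w x) y) \<longlongrightarrow> (case p of (x, y) \<Rightarrow> (w x) y)) ?F"
    by (simp add: p0 case_prod_unfold)
qed

text \<open>The solution is u(x,y) = \<open>Sol (w x) y\<close>, so y^m \<open>w\<close> is A u.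
  \<open>V\<close>, \<open>V\<^sub>x\<close>, \<open>V\<^sub>y\<close> are x^(2-\<alpha>) u and its
  partial derivatives, \<open>R\<close> is the unnormalised fractional integral of u and
  \<open>R'\<close> its derivative; the last condition is then the equation. Initial values are left
  free so that such solutions can be added.\<close>

locale partial_solution = dirichlet_problem +
  fixes \<alpha> :: real and w V V\<^sub>x V\<^sub>y R R' :: "real \<Rightarrow> cfun"
  assumes \<alpha>: "1 < \<alpha>" "\<alpha> < 2"
    and w_cont: "continuous_on {0<..1} w"
    and V_cont: "continuous_on {0..1} V" "continuous_on {0..1} V\<^sub>x" "continuous_on {0..1} V\<^sub>y"
    and V_deriv_x: "\<And>x y. x \<in> {0..1} \<Longrightarrow> y \<in> {0..1} \<Longrightarrow> ((\<lambda>x. (V x) y) has_real_derivative (V\<^sub>x x) y)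
        (at x within {0..1})"
    and V_deriv_y: "\<And>x y. x \<in> {0..1} \<Longrightarrow> y \<in> {0..1} \<Longrightarrow> ((V x) has_real_derivative (V\<^sub>y x) y) (at y
        within {0..1})"
    and V_eq: "\<And>x y. x \<in> {0<..1} \<Longrightarrow> y \<in> {0..1} \<Longrightarrow> (V x) y = x powr (2 - \<alpha>) * (Sol (w x)) y"
    and RL_int: "\<And>x y. x \<in> {0<..<1} \<Longrightarrow> y \<in> {0..1} \<Longrightarrow> set_integrable lborel {0<..<x} (RL_kernel \<alpha> (\<lambda>\<tau>.
        (Sol (w \<tau>)) y) x)"
    and RL_eq: "\<And>x y. x \<in> {0<..<1} \<Longrightarrow> y \<in> {0..1} \<Longrightarrow> RL_integral \<alpha> (\<lambda>\<tau>. (Sol (w \<tau>)) y) x = (R x) y"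
    and R_deriv: "\<And>x y. x \<in> {0<..<1} \<Longrightarrow> y \<in> {0..1} \<Longrightarrow> ((\<lambda>x. (R x) y) has_real_derivative (R' x) y) (at
        x)"
    and R'_deriv: "\<And>x y. x \<in> {0<..<1} \<Longrightarrow> y \<in> {0..1} \<Longrightarrow> ((\<lambda>x. (R' x) y) has_real_derivative - Gamma (2
        - \<alpha>) * (rpow y m * (w x) y)) (at x)"

lemma partial_solution_add:
  assumes "partial_solution k m \<alpha> w1 V1 Vx1 Vy1 R1 R1'" "partial_solution k m \<alpha> w2 V2 Vx2 Vy2 R2
      R2'"
  shows "partial_solution k m \<alpha> (\<lambda>x. w1 x + w2 x) (\<lambda>x. V1 x + V2 x) (\<lambda>x. Vx1 x + Vx2 x) (\<lambda>x. Vy1 x +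
      Vy2 x) (\<lambda>x. R1 x + R2 x) (\<lambda>x. R1' x + R2' x)"
proof -
  interpret A: partial_solution k m \<alpha> w1 V1 Vx1 Vy1 R1 R1' by fact
  interpret B: partial_solution k m \<alpha> w2 V2 Vx2 Vy2 R2 R2' by fact
  have kern: "RL_kernel \<alpha> (\<lambda>\<tau>. (A.Sol (w1 \<tau> + w2 \<tau>)) y) x = (\<lambda>\<tau>. RL_kernel \<alpha> (\<lambda>\<tau>. (A.Sol (w1 \<tau>)) y)
      x \<tau> + RL_kernel \<alpha> (\<lambda>\<tau>. (A.Sol (w2 \<tau>)) y) x \<tau>)" for x y
    by (simp add: RL_kernel_def linear_add[OF A.linear_Sol] add_divide_distrib fun_eq_iff)
  show ?thesis
  proof
    fix x y :: real assume x: "x \<in> {0<..<1}" and y: "y \<in> {0..1}"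
    show "set_integrable lborel {0<..<x} (RL_kernel \<alpha> (\<lambda>\<tau>. (A.Sol (w1 \<tau> + w2 \<tau>)) y) x)"
      unfolding kern by (intro set_integral_add A.RL_int B.RL_int x y)
    show "RL_integral \<alpha> (\<lambda>\<tau>. (A.Sol (w1 \<tau> + w2 \<tau>)) y) x = (R1 x + R2 x) y"
      using A.RL_eq[OF x y] B.RL_eq[OF x y] set_integral_add(2)[OF A.RL_int[OF x y] B.RL_int[OF x
          y]]
      unfolding RL_integral_def kern by simp
    show "((\<lambda>x. (R1 x + R2 x) y) has_real_derivative (R1' x + R2' x) y) (at x)"
      unfolding plus_bcontfun.rep_eq by (intro DERIV_add A.R_deriv B.R_deriv x y)
    have "((\<lambda>x. (R1' x) y + (R2' x) y) has_real_derivative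
        - Gamma (2 - \<alpha>) * (rpow y m * (w1 x) y) + - Gamma (2 - \<alpha>) * (rpow y m * (w2 x) y)) (at x)"
      by (intro DERIV_add A.R'_deriv B.R'_deriv x y)
    thus "((\<lambda>x. (R1' x + R2' x) y) has_real_derivative - Gamma (2 - \<alpha>) * (rpow y m * (w1 x + w2 x)
        y)) (at x)"
      by (simp add: algebra_simps)
  next
    fix x y :: real assume x: "x \<in> {0..1}" and y: "y \<in> {0..1}"
    show "((\<lambda>x. (V1 x + V2 x) y) has_real_derivative (Vx1 x + Vx2 x) y) (at x within {0..1})"
      unfolding plus_bcontfun.rep_eq by (intro DERIV_add A.V_deriv_x B.V_deriv_x x y)
    have "((\<lambda>y. (V1 x) y + (V2 x) y) has_real_derivative (Vy1 x) y + (Vy2 x) y) (at y within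
        {0..1})"
      by (intro DERIV_add A.V_deriv_y B.V_deriv_y x y)
    thus "((V1 x + V2 x) has_real_derivative (Vy1 x + Vy2 x) y) (at y within {0..1})"
      by (simp add: plus_bcontfun.rep_eq[abs_def])
  next
    fix x y :: real assume x: "x \<in> {0<..1}" and y: "y \<in> {0..1}"
    show "(V1 x + V2 x) y = x powr (2 - \<alpha>) * (A.Sol (w1 x + w2 x)) y"
      using A.V_eq[OF x y] B.V_eq[OF x y] by (simp add: linear_add[OF A.linear_Sol] distrib_left)
  qed (intro continuous_on_add A.w_cont B.w_cont A.V_cont B.V_cont A.\<alpha>)+
qed

section \<open>From partial solutions to Problem A\<close>

context partial_solution
begin

lemma RL_deriv_eq:
  assumes x: "x \<in> {0<..<1}" and y: "y \<in> {0..1}"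
  shows RL_differentiable: "RL_integral \<alpha> (\<lambda>\<tau>. (Sol (w \<tau>)) y) differentiable (at x)"
      "deriv (RL_integral \<alpha> (\<lambda>\<tau>. (Sol (w \<tau>)) y)) differentiable (at x)"
    and "RL_deriv \<alpha> (\<lambda>\<tau>. (Sol (w \<tau>)) y) x = - (rpow y m * (w x) y)"
proof -
  let ?I = "RL_integral \<alpha> (\<lambda>\<tau>. (Sol (w \<tau>)) y)"
  have d1: "(?I has_real_derivative (R' x) y) (at x)" if "x \<in> {0<..<1}" for x
    by (rule has_field_derivative_transform_within_open[OF R_deriv[OF that y], of "{0<..<1}"])
       (use that y in \<open>auto simp: RL_eq\<close>)
  have d2: "(deriv ?I has_real_derivative - Gamma (2 - \<alpha>) * (rpow y m * (w x) y)) (at x)"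
    by (rule has_field_derivative_transform_within_open[OF R'_deriv[OF x y], of "{0<..<1}"])
       (use x in \<open>auto intro!: DERIV_imp_deriv[symmetric] d1\<close>)
  show "?I differentiable (at x)" "deriv ?I differentiable (at x)"
    using d1[OF x] d2 real_differentiable_def by blast+
  have "Gamma (2 - \<alpha>) > 0" using \<alpha> by (intro Gamma_real_pos) auto
  thus "RL_deriv \<alpha> (\<lambda>\<tau>. (Sol (w \<tau>)) y) x = - (rpow y m * (w x) y)"
    using DERIV_imp_deriv[OF d2] by (simp add: RL_deriv_def numeral_2_eq_2)
qed

lemma weighted_limits:
  assumes y: "y \<in> {0..1}"
  shows "((\<lambda>x. x powr (2 - \<alpha>) * (Sol (w x)) y) \<longlongrightarrow> (V 0) y) (at_right 0)"
    and "((\<lambda>x. deriv (\<lambda>t. t powr (2 - \<alpha>) * (Sol (w t)) y) x) \<longlongrightarrow> (V\<^sub>x 0) y) (at_right 0)"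
proof -
  have ev: "eventually (\<lambda>x. x \<in> {0<..<1}) (at_right (0::real))"
    using eventually_at_right_real[of 0 1] by simp
  have lim: "((\<lambda>x. (G x) y) \<longlongrightarrow> (G 0) y) (at_right 0)" if "continuous_on {0..1} G" for G :: "real \<Rightarrow>
      cfun"
  proof -
    have "continuous_on {0..1} (\<lambda>x. (G x) y)"
      by (rule bounded_linear.continuous_on[OF bounded_linear_apply_bcontfun that])
    hence "((\<lambda>x. (G x) y) \<longlongrightarrow> (G 0) y) (at 0 within {0..1})"
      by (simp add: continuous_on_def)
    moreover have "at (0::real) within {0..1} = at_right 0"
      by (rule at_within_Icc_at_right) simp
    ultimately show ?thesis by simp
  qed
  have "eventually (\<lambda>x. (V x) y = x powr (2 - \<alpha>) * (Sol (w x)) y) (at_right 0)"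
    using ev by eventually_elim (use y V_eq in auto)
  thus "((\<lambda>x. x powr (2 - \<alpha>) * (Sol (w x)) y) \<longlongrightarrow> (V 0) y) (at_right 0)"
    using lim[OF V_cont(1)] by (simp add: tendsto_cong)
  have "deriv (\<lambda>t. t powr (2 - \<alpha>) * (Sol (w t)) y) x = (V\<^sub>x x) y" if x: "x \<in> {0<..<1}" for x
  proof (rule DERIV_imp_deriv)
    have "((\<lambda>x. (V x) y) has_real_derivative (V\<^sub>x x) y) (at x within {0..1})"
      using x by (intro V_deriv_x y) auto
    moreover have "at x within {0..1} = at x" using x by (intro at_within_interior) auto
    ultimately have "((\<lambda>x. (V x) y) has_real_derivative (V\<^sub>x x) y) (at x)" by simp
    thus "((\<lambda>t. t powr (2 - \<alpha>) * (Sol (w t)) y) has_real_derivative (V\<^sub>x x) y) (at x)"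
      by (rule has_field_derivative_transform_within_open[of _ _ _ "{0<..<1}"]) (use x y V_eq in
          auto)
  qed
  hence "eventually (\<lambda>x. (V\<^sub>x x) y = deriv (\<lambda>t. t powr (2 - \<alpha>) * (Sol (w t)) y) x) (at_right 0)"
    using ev by (auto elim: eventually_mono)
  thus "((\<lambda>x. deriv (\<lambda>t. t powr (2 - \<alpha>) * (Sol (w t)) y) x) \<longlongrightarrow> (V\<^sub>x 0) y) (at_right 0)"
    using lim[OF V_cont(2)] by (simp add: tendsto_cong)
qed

lemma solves:
  assumes \<psi>: "\<And>y. y \<in> {0..1} \<Longrightarrow> apply_bcontfun (V 0) y = \<psi> y"
    and \<phi>: "\<And>y. y \<in> {0..1} \<Longrightarrow> apply_bcontfun (V\<^sub>x 0) y = \<phi> y"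
  shows "solves_problem_A k \<alpha> m \<phi> \<psi> (\<lambda>x. apply_bcontfun (Sol (w x)))"
  unfolding solves_problem_A_def
proof (intro conjI ballI)
  fix x y :: real assume x: "x \<in> {0<..<1}" and y: "y \<in> {0<..<1}"
  \<comment> \<open>The fractional derivative is -y^m \<open>w\<close> and the derivative of order
    2k is (-1)^k \<open>w\<close>, so both terms are (-1)^k y^m \<open>w\<close>.\<close>
  show "(-1) ^ (k + 1) * RL_deriv \<alpha> (\<lambda>t. apply_bcontfun (Sol (w t)) y) x - rpow y m * nderiv_within
      (2 * k) (apply_bcontfun (Sol (w x))) {0..1} y = 0"
    using x y by (simp add: RL_deriv_eq(3) Sol_nderiv Sol_deriv_top)
next
  fix y :: real assume y: "y \<in> {0..1}"
  show "RL_differentiable_on \<alpha> (\<lambda>t. apply_bcontfun (Sol (w t)) y) {0<..<1}"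
    unfolding RL_differentiable_on_def using RL_int[OF _ y] RL_differentiable[OF _ y] by blast
next
  have wc: "continuous_on ({0<..<1} \<times> {0..1}) (\<lambda>(x, y). apply_bcontfun (w x) y)"
    by (rule continuous_on_apply_joint) (rule continuous_on_subset[OF w_cont], auto)
  have "continuous_on ({0<..<1} \<times> {0..1}) (\<lambda>p. - (rpow (snd p) m * (case p of (x, y) \<Rightarrow>
      apply_bcontfun (w x) y)))"
    by (intro continuous_on_minus continuous_on_mult wc continuous_on_compose2[OF rpow_continuous[OF
        m0]] continuous_on_snd continuous_on_id) auto
  thus "continuous_on ({0<..<1} \<times> {0..1}) (\<lambda>(x, y). RL_deriv \<alpha> (\<lambda>t. apply_bcontfun (Sol (w t)) y)
      x)"
    by (rule continuous_on_eq) (auto simp: RL_deriv_eq(3))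
  have "continuous_on ({0<..<1} \<times> {0..1}) (\<lambda>p. (-1) ^ k * (case p of (x, y) \<Rightarrow> apply_bcontfun (w x)
      y))"
    by (intro continuous_on_mult continuous_on_const wc)
  thus "continuous_on ({0<..<1} \<times> {0..1}) (\<lambda>(x, y). nderiv_within (2 * k) (apply_bcontfun (Sol (w
      x))) {0..1} y)"
    by (rule continuous_on_eq) (auto simp: Sol_nderiv Sol_deriv_top)
next
  show "\<exists>v. C1_on_unit_square v \<and> (\<forall>x\<in>{0<..1}. \<forall>y\<in>{0..1}. v x y = x powr (2 - \<alpha>) * apply_bcontfun
      (Sol (w x)) y)"
  proof (intro exI conjI ballI)
    show "C1_on_unit_square (\<lambda>x. apply_bcontfun (V x))"
      unfolding C1_on_unit_square_def
      by (intro conjI exI[of _ "\<lambda>x. apply_bcontfun (V\<^sub>x x)"] exI[of _ "\<lambda>x. apply_bcontfun (V\<^sub>y x)"]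
          ballI
          continuous_on_apply_joint V_cont V_deriv_x V_deriv_y)
  qed (rule V_eq)
next
  fix x :: real
  \<comment> \<open>Every value of \<open>Sol\<close> is smooth enough and satisfies the boundary
    conditions, so the edge x = 1 needs no separate treatment.\<close>
  show "times_differentiable_on (2 * k) (apply_bcontfun (Sol (w x))) {0..1}" by (rule
      Sol_times_differentiable)
  thus "times_differentiable_on (k - 1) (apply_bcontfun (Sol (w x))) {0..1}"
    by (auto simp: times_differentiable_on_def)
  fix s assume "s \<in> {0..k - 1}"
  hence "s < k" using k by auto
  thus "nderiv_within s (apply_bcontfun (Sol (w x))) {0..1} 0 = 0" "nderiv_within s (apply_bcontfun
      (Sol (w x))) {0..1} 1 = 0"
    by (simp_all add: Sol_nderiv Sol_deriv_boundary)
next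
  fix y :: real assume y: "y \<in> {0..1}"
  show "((\<lambda>x. x powr (2 - \<alpha>) * apply_bcontfun (Sol (w x)) y) \<longlongrightarrow> \<psi> y) (at_right 0)"
    using weighted_limits(1)[OF y] by (simp add: \<psi>[OF y])
  show "((\<lambda>x. deriv (\<lambda>t. t powr (2 - \<alpha>) * apply_bcontfun (Sol (w t)) y) x) \<longlongrightarrow> \<phi> y) (at_right 0)"
    using weighted_limits(2)[OF y] by (simp add: \<phi>[OF y])
qed

end

section \<open>Partial solutions from the calculus\<close>

context dirichlet_problem
begin

lemma nbounded_Sol: "nbounded Sol CS" "nbounded Sol' CS" "nbounded K CS"
  unfolding nbounded_def nrm_def
  by (simp_all add: linear_Sol linear_Sol' linear_K CS_nonneg norm_Sol norm_Sol' norm_K)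

lemma nbounded_apply:
  fixes A :: "cfun \<Rightarrow> cfun"
  assumes "nbounded A C"
  shows "nbounded (\<lambda>F. (A F) y) C"
proof -
  have "linear ((\<lambda>F :: cfun. F y) \<circ> A)"
    by (intro linear_compose nboundedD(1)[OF assms] bounded_linear.linear[OF
        bounded_linear_apply_bcontfun])
  moreover have "\<bar>(A g) y\<bar> \<le> C * nrm g" for g
    using order_trans[OF norm_bounded nboundedD(3)[OF assms]] by simp
  ultimately show ?thesis using nboundedD(2)[OF assms] by (simp add: nbounded_def o_def)
qed

lemma calc_apply:
  fixes A :: "cfun \<Rightarrow> cfun"
  assumes "nbounded A C" "continuous_on {0..1} q"
  shows "calc (\<lambda>F. (A F) y) f q = (calc A f q) y"
  by (rule calc_compose[OF assms(1) bounded_linear_apply_bcontfun assms(2)])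

text \<open>A bound in the supremum norm, unlike the energy bound \<open>norm_Sol\<close>:
  \<open>Sol\<close> is applied to limits taken in \<open>cfun\<close>, such as
  \<open>calc K f p\<close>, and must be continuous for that convergence.\<close>

lemma bounded_linear_Sol: "bounded_linear Sol"
proof (rule bounded_linear_intro)
  have "norm (IR F) \<le> norm F * 1" for F
  proof (rule norm_bound)
    fix y :: real
    have "norm ((IR F) y) \<le> norm F * (1 - max 0 (min 1 y))"
      using norm_integral_cfun_le[of "max 0 (min 1 y)" 1 F] by (simp add: IR_apply)
    also have "\<dots> \<le> norm F * 1" by (intro mult_left_mono) auto
    finally show "norm ((IR F) y) \<le> norm F * 1" .
  qed
  hence IR: "norm ((IR ^^ n) F) \<le> norm F" for n F
    by (induction n) (auto intro: order_trans)
  fix F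
  have "norm (Sol F) \<le> norm (P ((IR ^^ k) F))" unfolding Sol_def by (rule norm_IL_pow)
  also have "\<dots> \<le> CP * norm ((IR ^^ k) F)" by (rule norm_P)
  also have "\<dots> \<le> CP * norm F" by (intro mult_left_mono IR CP_nonneg)
  finally show "norm (Sol F) \<le> norm F * CP" by (simp add: mult.commute)
qed (simp_all add: linear_add[OF linear_Sol] linear_scale[OF linear_Sol])

text \<open>\<open>K\<close> is \<open>c0\<close> times the contraction underlying the calculus, so
  it contributes the symbol c0 t. This links \<open>w\<close>, given by the symbol r, with the
  solution \<open>Sol (w x)\<close>, given by c0 t r.\<close>

lemma Sol_calc_K:
  assumes p: "continuous_on {0..1} p"
  shows "Sol (calc K f p) = calc Sol f (\<lambda>t. c0 * t * p t)"
proof -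
  have "calc Sol f (\<lambda>t. t * p t) = calc (\<lambda>F. (1 / c0) *\<^sub>R Sol (K F)) f p"
    using calc_shift[OF nbounded_Sol(1) p] by (simp add: linear_scale[OF linear_Sol])
  also have "\<dots> = (1 / c0) *\<^sub>R Sol (calc K f p)"
    by (rule calc_compose[OF nbounded_Sol(3) bounded_linear_const_scaleR[OF bounded_linear_Sol] p])
  finally have "Sol (calc K f p) = c0 *\<^sub>R calc Sol f (\<lambda>t. t * p t)" using c0_pos by simp
  also have "\<dots> = calc Sol f (\<lambda>t. c0 * (t * p t))"
    by (intro calc_cmult[OF nbounded_Sol(1), symmetric] continuous_intros p)
  finally show ?thesis by (simp add: mult.assoc)
qed

lemma calc_Sol_eq_rpow:
  assumes p: "continuous_on {0..1} p" and y: "y \<in> {0..1}"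
  shows "(calc Sol f p) y = rpow y m * (calc K f p) y"
proof -
  have "(calc Sol f p) y = calc (\<lambda>F. (Sol F) y) f p"
    by (rule calc_apply[OF nbounded_Sol(1) p, symmetric])
  also have "\<dots> = calc (\<lambda>F. rpow y m * (K F) y) f p"
    by (simp add: rpow_K[OF y])
  also have "\<dots> = rpow y m * (calc K f p) y"
    by (rule calc_compose[OF nbounded_Sol(3) bounded_linear_const_mult[OF
        bounded_linear_apply_bcontfun] p])
  finally show ?thesis .
qed

lemma calc_Sol_linear: "calc Sol f (\<lambda>t. c0 * t) = Sol (K f)"
  using Sol_calc_K[of "\<lambda>t. 1" f] by (simp add: calc_one)

text \<open>\<open>Sol\<close> is \<open>IL\<close> after \<open>Sol'\<close>, and \<open>IL\<close>
  is continuous in the supremum norm, hence commutes with the limit in \<open>calc\<close>.\<close>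

lemma calc_Sol_has_derivative:
  assumes p: "continuous_on {0..1} p" and y: "y \<in> {0..1}"
  shows "((calc Sol f p) has_real_derivative (calc Sol' f p) y) (at y within {0..1})"
proof -
  have "bounded_linear IL"
    by (rule bounded_linear_intro[of _ 1]) (use norm_IL in \<open>simp_all add: linear_add[OF linear_IL]
        linear_scale[OF linear_IL]\<close>)
  hence "calc Sol f p = IL (calc Sol' f p)"
    using calc_compose[OF nbounded_Sol(2) _ p] unfolding Sol_eq_IL[abs_def] by blast
  thus ?thesis using IL_has_derivative[OF y] by simp
qed

text \<open>The locale \<open>scalar_family\<close> lists what the calculus transports: jointly
  continuous symbols give continuity in x, jointly continuous derivatives give derivatives, and an
  integrable majorant gives the fractional integral.\<close>

lemma partial_solution_calc:
  assumes \<alpha>: "1 < \<alpha>" "\<alpha> < 2" and "scalar_family \<alpha> c0 r v v' q q'"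
  shows "partial_solution k m \<alpha> (\<lambda>x. calc K f (r x)) (\<lambda>x. calc Sol f (v x)) (\<lambda>x. calc Sol f (v' x))
      (\<lambda>x. calc Sol' f (v x))
           (\<lambda>x. calc Sol f (q x)) (\<lambda>x. calc Sol f (q' x))"
proof -
  interpret scalar_family \<alpha> c0 r v v' q q' by fact
  have rc: "continuous_on {0..1} (r x)" if "x \<in> {0<..1}" for x by (rule joint_continuous_slice[OF
      r_cont that])
  have vc: "continuous_on {0..1} (v x)" if "x \<in> {0..1}" for x by (rule joint_continuous_slice[OF
      v_cont that])
  have q'c: "continuous_on {0..1} (q' x)" if "x \<in> {0<..<1}" for x by (rule joint_continuous_slice[OF
      q'_cont that])
  have crc: "continuous_on {0..1} (\<lambda>t. c0 * t * r x t)" if "x \<in> {0<..1}" for x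
    by (intro continuous_intros rc that)
  have eval: "((\<lambda>x. (G x) y) has_real_derivative D y) F" if "(G has_vector_derivative D) F" for G ::
      "real \<Rightarrow> cfun" and D y F
    using bounded_linear.has_vector_derivative[OF bounded_linear_apply_bcontfun that]
    by (simp add: has_real_derivative_iff_has_vector_derivative)
  show ?thesis
  proof
    show "1 < \<alpha>" "\<alpha> < 2" by fact+
    show "continuous_on {0<..1} (\<lambda>x. calc K f (r x))" by (rule calc_continuous[OF nbounded_Sol(3)
        r_cont])
    show "continuous_on {0..1} (\<lambda>x. calc Sol f (v x))" by (rule calc_continuous[OF nbounded_Sol(1)
        v_cont])
    show "continuous_on {0..1} (\<lambda>x. calc Sol f (v' x))" by (rule calc_continuous[OF nbounded_Sol(1)
        v'_cont])
    show "continuous_on {0..1} (\<lambda>x. calc Sol' f (v x))" by (rule calc_continuous[OF nbounded_Sol(2)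
        v_cont])
  next
    fix x y :: real assume x: "x \<in> {0..1}" and y: "y \<in> {0..1}"
    show "((\<lambda>x. (calc Sol f (v x)) y) has_real_derivative (calc Sol f (v' x)) y) (at x within
        {0..1})"
      by (rule eval) (rule calc_has_derivative[OF nbounded_Sol(1) _ vc v'_cont v_deriv x], auto)
    show "((calc Sol f (v x)) has_real_derivative (calc Sol' f (v x)) y) (at y within {0..1})"
      by (rule calc_Sol_has_derivative[OF vc[OF x] y])
  next
    fix x y :: real assume x: "x \<in> {0<..1}" and y: "y \<in> {0..1}"
    have "x powr (2 - \<alpha>) * x powr (\<alpha> - 2) = 1" using x by (simp flip: powr_add)
    hence "v x t = x powr (2 - \<alpha>) * (c0 * t * r x t)" if "t \<in> {0..1}" for t
      using v_eq[OF x that] by (simp flip: mult.assoc)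
    hence "calc Sol f (v x) = calc Sol f (\<lambda>t. x powr (2 - \<alpha>) * (c0 * t * r x t))" by (rule
        calc_cong)
    also have "\<dots> = x powr (2 - \<alpha>) *\<^sub>R Sol (calc K f (r x))"
      unfolding Sol_calc_K[OF rc[OF x]] by (rule calc_cmult[OF nbounded_Sol(1) crc[OF x]])
    finally show "(calc Sol f (v x)) y = x powr (2 - \<alpha>) * (Sol (calc K f (r x))) y" by simp
  next
    fix x y :: real assume x: "x \<in> {0<..<1}" and y: "y \<in> {0..1}"
    have at: "at x within {0<..<1} = at x" using x by (intro at_within_open) auto
    have d: "((\<lambda>x. q x t) has_real_derivative q' x t) (at x within {0<..<1})" if "x \<in> {0<..<1}" "t \<in>
        {0..1}" for x t
      using q_deriv[OF that] by (rule has_field_derivative_at_within)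
    have "((\<lambda>x. (calc Sol f (q x)) y) has_real_derivative (calc Sol f (q' x)) y) (at x within
        {0<..<1})"
      by (rule eval) (rule calc_has_derivative[OF nbounded_Sol(1) _ q_cont q'_cont d x], auto)
    thus "((\<lambda>x. (calc Sol f (q x)) y) has_real_derivative (calc Sol f (q' x)) y) (at x)"
      unfolding at .
    have d': "((\<lambda>x. q' x t) has_real_derivative - Gamma (2 - \<alpha>) * r x t) (at x within {0<..<1})" if
        "x \<in> {0<..<1}" "t \<in> {0..1}" for x t
      using q'_deriv[OF that] by (rule has_field_derivative_at_within)
    have "continuous_on ({0<..<1} \<times> {0..1}) (\<lambda>p. - Gamma (2 - \<alpha>) * (case p of (x, t) \<Rightarrow> r x t))"
      by (intro continuous_on_mult continuous_on_const continuous_on_subset[OF r_cont]) auto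
    hence rc': "continuous_on ({0<..<1} \<times> {0..1}) (\<lambda>(x, t). - Gamma (2 - \<alpha>) * r x t)"
      by (rule continuous_on_eq) auto
    have "((\<lambda>x. (calc Sol f (q' x)) y) has_real_derivative (calc Sol f (\<lambda>t. - Gamma (2 - \<alpha>) * r x
        t)) y) (at x within {0<..<1})"
      by (rule eval) (rule calc_has_derivative[OF nbounded_Sol(1) _ q'c rc' d' x], auto)
    moreover have "calc Sol f (\<lambda>t. - Gamma (2 - \<alpha>) * r x t) = - Gamma (2 - \<alpha>) *\<^sub>R calc Sol f (r x)"
      using x by (intro calc_cmult[OF nbounded_Sol(1)] rc) auto
    moreover have "(calc Sol f (r x)) y = rpow y m * (calc K f (r x)) y"
      using x by (intro calc_Sol_eq_rpow rc y) auto
    ultimately show "((\<lambda>x. (calc Sol f (q' x)) y) has_real_derivative - Gamma (2 - \<alpha>) * (rpow y m *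
        (calc K f (r x)) y)) (at x)"
      unfolding at by simp
    \<comment> \<open>The integrand of the fractional integral as a function of \<tau> and the
      spectral variable, continued by zero outside (0,x), so that it is continuous in the latter for
      every \<tau>, as \<open>calc_integral\<close> demands.\<close>
    define p where "p = (\<lambda>\<tau>. if \<tau> \<in> {0<..<x} then (\<lambda>t. 1 / (x - \<tau>) powr (\<alpha> - 1) * (c0 * t * r \<tau> t))
        else (\<lambda>t. 0))"
    have pc: "continuous_on {0..1} (p \<tau>)" for \<tau>
    proof (cases "\<tau> \<in> {0<..<x}")
      case True
      hence "\<tau> \<in> {0<..1}" using x by auto
      thus ?thesis unfolding p_def if_P[OF True] by (intro continuous_on_mult continuous_on_const
          crc)
    next
      case False
      show ?thesis unfolding p_def if_not_P[OF False] by (rule continuous_on_const)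
    qed
    have pk: "p \<tau> t = indicator {0<..<x} \<tau> *\<^sub>R RL_kernel \<alpha> (\<lambda>\<tau>. c0 * t * r \<tau> t) x \<tau>" for \<tau> t
      by (simp add: p_def RL_kernel_def)
    have "compact ((\<lambda>(x, t). v x t) ` ({0..1} \<times> {0..1}))"
      by (intro compact_continuous_image v_cont compact_Times) auto
    then obtain B where "\<forall>y\<in>(\<lambda>(x, t). v x t) ` ({0..1} \<times> {0..1}). norm y \<le> B"
      using compact_imp_bounded bounded_iff by metis
    hence B: "\<bar>v \<tau> t\<bar> \<le> B" if "\<tau> \<in> {0..1}" "t \<in> {0..1}" for \<tau> t using that by auto
    have pmeas: "(\<lambda>\<tau>. p \<tau> t) \<in> borel_measurable lborel" if t: "t \<in> {0..1}" for t
    proof -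
      have "continuous_on {0<..<x} (\<lambda>\<tau>. r \<tau> t)"
        using x t by (intro continuous_on_compose2[OF r_cont, of _ "\<lambda>\<tau>. (\<tau>, t)", simplified]
            continuous_intros) auto
      hence "continuous_on {0<..<x} (\<lambda>\<tau>. RL_kernel \<alpha> (\<lambda>\<tau>. c0 * t * r \<tau> t) x \<tau>)"
        unfolding RL_kernel_def by (intro continuous_intros) auto
      hence "(\<lambda>\<tau>. indicator {0<..<x} \<tau> *\<^sub>R RL_kernel \<alpha> (\<lambda>\<tau>. c0 * t * r \<tau> t) x \<tau>) \<in> borel_measurable
          borel"
        by (intro borel_measurable_continuous_on_indicator) auto
      thus ?thesis by (simp add: pk)
    qed
    \<comment> \<open>A bound \<open>B\<close> of \<open>v\<close> yields |c0 t r| <= B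
      \<tau>^(\<alpha>-2), a singularity at 0 that is integrable because \<alpha> > 1.\<close>
    define W where "W = (\<lambda>\<tau>. B * (indicator {0<..<x} \<tau> *\<^sub>R (\<tau> powr ((\<alpha> - 1) - 1) / (x - \<tau>) powr (\<alpha> -
        1))))"
    have W: "integrable lborel W"
      unfolding W_def using \<alpha> x by (intro integrable_mult_right RL_kernel_powr_integrable) auto
    have le: "\<bar>p \<tau> t\<bar> \<le> W \<tau>" if t: "t \<in> {0..1}" for \<tau> t
    proof (cases "\<tau> \<in> {0<..<x}")
      case True
      have "\<bar>c0 * t * r \<tau> t\<bar> = \<tau> powr (\<alpha> - 2) * \<bar>v \<tau> t\<bar>"
        using v_eq[of \<tau> t] True x t by (simp add: abs_mult)
      also have "\<dots> \<le> \<tau> powr (\<alpha> - 2) * B" using True x t by (intro mult_left_mono B) auto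
      finally have "\<bar>c0 * t * r \<tau> t\<bar> / (x - \<tau>) powr (\<alpha> - 1) \<le> (\<tau> powr (\<alpha> - 2) * B) / (x - \<tau>) powr (\<alpha>
          - 1)"
        by (rule divide_right_mono) simp
      thus ?thesis using True by (simp add: p_def W_def abs_mult mult_ac)
    qed (auto simp: p_def W_def)
    have pq: "(\<integral>\<tau>. p \<tau> t \<partial>lborel) = q x t" if "t \<in> {0..1}" for t
      using q_eq[OF x that] by (simp add: RL_integral_def set_lebesgue_integral_def pk)
    have Qc: "continuous_on {0..1} (\<lambda>t. \<integral>\<tau>. p \<tau> t \<partial>lborel)"
      by (rule continuous_on_eq[OF q_cont[OF x]]) (simp add: pq)
    let ?A = "\<lambda>F. (Sol F) y"
    have nA: "nbounded ?A CS" by (rule nbounded_apply[OF nbounded_Sol(1)])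
    have cp: "calc ?A f (p \<tau>) = indicator {0<..<x} \<tau> *\<^sub>R RL_kernel \<alpha> (\<lambda>\<tau>. (Sol (calc K f (r \<tau>))) y)
        x \<tau>" for \<tau>
    proof (cases "\<tau> \<in> {0<..<x}")
      case True
      hence \<tau>: "\<tau> \<in> {0<..1}" using x by auto
      have "calc ?A f (p \<tau>) = 1 / (x - \<tau>) powr (\<alpha> - 1) * calc ?A f (\<lambda>t. c0 * t * r \<tau> t)"
        using True calc_cmult[OF nA crc[OF \<tau>], of f "1 / (x - \<tau>) powr (\<alpha> - 1)"] by (simp add: p_def)
      also have "calc ?A f (\<lambda>t. c0 * t * r \<tau> t) = (Sol (calc K f (r \<tau>))) y"
        unfolding Sol_calc_K[OF rc[OF \<tau>]] by (rule calc_apply[OF nbounded_Sol(1) crc[OF \<tau>]])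
      finally show ?thesis using True by (simp add: RL_kernel_def)
    next
      case False
      thus ?thesis using calc_cmult[OF nA continuous_on_const[of "{0..1}" 0], of f 0] by (auto simp:
          p_def)
    qed
    have I: "integrable lborel (\<lambda>\<tau>. calc ?A f (p \<tau>))"
      "(\<integral>\<tau>. calc ?A f (p \<tau>) \<partial>lborel) = calc ?A f (\<lambda>t. \<integral>\<tau>. p \<tau> t \<partial>lborel)"
      using calc_integral[where q = p and w = W, OF nA pc pmeas W le Qc] by blast+
    show "set_integrable lborel {0<..<x} (RL_kernel \<alpha> (\<lambda>\<tau>. (Sol (calc K f (r \<tau>))) y) x)"
      unfolding set_integrable_def by (rule I(1)[unfolded cp])
    have "RL_integral \<alpha> (\<lambda>\<tau>. (Sol (calc K f (r \<tau>))) y) x = calc ?A f (\<lambda>t. \<integral>\<tau>. p \<tau> t \<partial>lborel)"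
      unfolding RL_integral_def set_lebesgue_integral_def by (rule I(2)[unfolded cp])
    also have "\<dots> = calc ?A f (q x)" by (rule calc_cong) (rule pq)
    also have "\<dots> = (calc Sol f (q x)) y" by (rule calc_apply[OF nbounded_Sol(1) q_cont[OF x]])
    finally show "RL_integral \<alpha> (\<lambda>\<tau>. (Sol (calc K f (r \<tau>))) y) x = (calc Sol f (q x)) y" .
  qed
qed

end

theorem theorem2:
  fixes k :: nat and \<alpha> m :: real and \<phi> \<psi> :: "real \<Rightarrow> real"
  assumes "k \<ge> 1"
    and "1 < \<alpha>" and "\<alpha> < 2"
    and "0 \<le> m" and "m < real k" and "m \<notin> \<nat> - {0}"
    and "\<forall>\<tau>\<in>{\<phi>, \<psi>}.
           Ck_on (2 * k) \<tau> {0..1} \<and>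
           (\<forall>s\<in>{0..k - 1}. nderiv_within s \<tau> {0..1} 0 = 0 \<and> nderiv_within s \<tau> {0..1} 1 = 0)"
    and "\<forall>\<tau>\<in>{\<phi>, \<psi>}.
           Ck_on (2 * k) (\<lambda>y. rpow y m * nderiv_within (2 * k) \<tau> {0..1} y) {0..1} \<and>
           (\<forall>s\<in>{0..k - 1}.
              nderiv_within s (\<lambda>y. rpow y m * nderiv_within (2 * k) \<tau> {0..1} y) {0..1} 0 = 0 \<and>
              nderiv_within s (\<lambda>y. rpow y m * nderiv_within (2 * k) \<tau> {0..1} y) {0..1} 1 = 0)"
  shows "\<exists>u. solves_problem_A k \<alpha> m \<phi> \<psi> u"
proof -
  interpret dirichlet_problem k m using assms by unfold_locales auto
  note \<alpha> = assms(2,3)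
  have rep: "\<exists>f. \<forall>y\<in>{0..1}. \<tau> y = (Sol (K f)) y" if "\<tau> \<in> {\<phi>, \<psi>}" for \<tau>
  proof -
    have s: "s \<in> {0..k - 1}" if "s < k" for s using that by auto
    show ?thesis
      by (rule data_representation[of \<tau>]) (use assms(7,8) that s in blast)+
  qed
  obtain f where f: "\<And>y. y \<in> {0..1} \<Longrightarrow> \<psi> y = (Sol (K f)) y" using rep[of \<psi>] by blast
  obtain g where g: "\<And>y. y \<in> {0..1} \<Longrightarrow> \<phi> y = (Sol (K g)) y" using rep[of \<phi>] by blast
  note ps = partial_solution_add[OF partial_solution_calc[OF \<alpha> scalar_family_psi[OF \<alpha> c0_pos], of f]
          partial_solution_calc[OF \<alpha> scalar_family_phi[OF \<alpha> c0_pos], of g]]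
  have "\<alpha> - 1 \<notin> \<int>\<^sub>\<le>\<^sub>0" using \<alpha> by (auto elim!: nonpos_Ints_cases)
  hence G: "Gamma \<alpha> = (\<alpha> - 1) * Gamma (\<alpha> - 1)"
    using Gamma_plus1[of "\<alpha> - 1"] by simp
  \<comment> \<open>Each of the two families contributes nothing to the initial value that the other
    one provides.\<close>
  have zero: "calc Sol h (\<lambda>t. 0) = 0" for h
    using calc_cmult[OF nbounded_Sol(1) continuous_on_const[of "{0..1}" 0], of h 0] by simp
  have Gp: "Gamma (\<alpha> - 1) > 0" "Gamma \<alpha> > 0" using \<alpha> by (auto intro!: Gamma_real_pos)
  have r: "rGamma (\<alpha> - 1) = 1 / Gamma (\<alpha> - 1)" "rGamma \<alpha> = 1 / Gamma \<alpha>" by (simp_all add: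
      rGamma_inverse_Gamma divide_inverse)
  \<comment> \<open>At x = 0 the Mittag-Leffler functions reduce to reciprocal Gamma values, which
    leaves the symbol c0 t; by \<open>calc_Sol_linear\<close> it stands for
    \<open>Sol (K f)\<close>, that is for \<psi>.\<close>
  have init: "(\<lambda>t. c0 * Gamma (\<alpha> - 1) * (t * mlf \<alpha> (\<alpha> - 1) (0 powr \<alpha> / (c0 * t)))) = (\<lambda>t. c0 * t)"
    using Gp by (simp add: mlf_0 r)
  have init': "(\<lambda>t. c0 * Gamma \<alpha> * (t * (mlf \<alpha> (\<alpha> - 1) (0 powr \<alpha> / (c0 * t)) + (2 - \<alpha>) * mlf \<alpha> \<alpha> (0
      powr \<alpha> / (c0 * t))))) = (\<lambda>t. c0 * t)"
  proof
    fix t :: real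
    have "Gamma \<alpha> * (1 / Gamma (\<alpha> - 1) + (2 - \<alpha>) * (1 / Gamma \<alpha>)) = 1" using Gp(1)[THEN
        less_imp_neq] \<alpha> by (simp add: G distrib_left)
    thus "c0 * Gamma \<alpha> * (t * (mlf \<alpha> (\<alpha> - 1) (0 powr \<alpha> / (c0 * t)) + (2 - \<alpha>) * mlf \<alpha> \<alpha> (0 powr \<alpha> /
        (c0 * t)))) = c0 * t"
      by (simp add: mlf_0 r mult_ac)
  qed
  show ?thesis
    by (rule exI, rule partial_solution.solves[OF ps])
       (use init init' zero f g in \<open>simp_all add: calc_Sol_linear\<close>)
qed

end
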